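(* Let $d\ge1$, $R>0$, $\alpha\in(0,1)$, $t_1,\dots,t_d\ge0$, $s_1,\dots,s_d>0$, and suppose $$b_l^2=\prod_{j=1}^d l_j^{-2t_j},\qquad a_l^2=\prod_{j=1}^d l_j^{2s_j},\qquad l\in\mathbb{N}_*^d .$$ Set $c_j=(1+4t_j)/s_j$ and assume that $c_1,\dots,c_d$ are strictly ordered: $c_1>c_2>\dots>c_d$. Then: (1) The minimax separation rate $r_\epsilon^\star$ over $\Theta_{a,R}$ satisfies $r_\epsilon^\star\sim\epsilon^{\frac{4}{4+c_1}}$ as $\epsilon\to0$. (2) If $r_\epsilon=C\epsilon^{\frac{4}{4+c_1}}$ for some positive constant $C$, then $u_\epsilon(r_\epsilon)=\mathcal{O}(1)$ as $\epsilon\to0$ and the following sharp asymptotics hold as $\epsilon\to 0$: $\Psi_{\epsilon,H^{(\alpha)}}$ is a level-$\alpha$ test, $\ \beta_\epsilon(\Theta_{a,R}(r_\epsilon),\Psi_{\epsilon,H^{(\alpha)}})=\beta_\epsilon(\Theta_{a,R}(r_\epsilon),\alpha)+o(1)$, and $\beta_\epsilon(\Theta_{a,R}(r_\epsilon),\alpha)=\Phi(H^{(\alpha)}-u_\epsilon(r_\epsilon))+o(1)$.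
   Context: $\mathbb{N}_*=\{1,2,3,\dots\}$. For a noise level $\epsilon>0$ one observes $y=(y_l)_{l\in\mathbb{N}_*^d}$, $y_l=b_l\theta_l+\epsilon\xi_l$, where the $\xi_l$ are i.i.d. standard Gaussian, $b=(b_l)$ is a known sequence and $\theta\in\ell^2(\mathbb{N}_*^d)$ is unknown. $\mathbb{P}_\theta$ is the law of $y$; $\mathbb{P}_0$ corresponds to $\theta=0$. $\|\cdot\|$ is the $\ell^2$ norm. $\Theta_{a,R}=\{\theta\in\ell^2(\mathbb{N}_*^d):\sum_l a_l^2\theta_l^2\le R^2\}$ and $\Theta_{a,R}(r)=\{\theta\in\Theta_{a,R}:\|\theta\|\ge r\}$. All parameters other than $\epsilon$ are fixed. One tests $H_0:\theta=0$ against $\theta\in\Theta_{a,R}(r_\epsilon)$. A test $\psi$ is a measurable function of the data with values in $\{0,1\}$. A level-$\alpha$ test is a test function $\psi_\alpha$ (which may depend on $\epsilon$) satisfying $\mathbb{P}_0(\psi_\alpha=1)\le\alpha+o(1)$ as $\epsilon\to0$. $\beta_\epsilon(\Theta_{a,R}(r_\epsilon),\psi)=\sup_{\theta\in\Theta_{a,R}(r_\epsilon)}\mathbb{P}_\theta(\psi=0)$, and $\beta_\epsilon(\Theta_{a,R}(r_\epsilon),\alpha)=\inf_{\psi_\alpha}\beta_\epsilon(\Theta_{a,R}(r_\epsilon),\psi_\alpha)$, the infimum being over all level-$\alpha$ tests. A family $r^\star_\epsilon$ is a minimax separation rate over $\Theta_{a,R}$ if, as $\epsilon\to0$, $\beta_\epsilon(\Theta_{a,R}(r_\epsilon),\alpha)\to1-\alpha$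 whenever $r_\epsilon/r_\epsilon^\star\to0$, and $\beta_\epsilon(\Theta_{a,R}(r_\epsilon),\alpha)\to0$ whenever $r_\epsilon/r_\epsilon^\star\to\infty$. $v_\epsilon\sim w_\epsilon$ as $\epsilon\to0$ means that there are two positive constants $k_0,k_1$ such that $k_0w_\epsilon\le v_\epsilon\le k_1w_\epsilon$ for all $\epsilon>0$. Extremal problem: $u_\epsilon^2(r_\epsilon)=\frac{1}{2\epsilon^4}\inf_{\theta\in\Theta_{a,R}(r_\epsilon)}\sum_k b_k^4\theta_k^4=\frac1{2\epsilon^4}\sum_k b_k^4\tilde\theta_k^4$, where $\tilde\theta$ is the solution, and $u_\epsilon(r_\epsilon)\ge0$. Filter: $\omega_k=b_k^2\tilde\theta_k^2\big/\sqrt{2\sum_{m}b_m^4\tilde\theta_m^4}$. Test statistic $T=\sum_{k\in\mathbb{N}_*^d}\omega_k\big((y_k/\epsilon)^2-1\big)$ and tests $\Psi_{\epsilon,t}=\mathbf 1_{\{T>t\}}$. $\Phi$ is the standard Gaussian distribution function and $H^{(\alpha)}$ its $(1-\alpha)$-quantile.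
   Formalization: The o(1) in the level condition is a function δ→0 fixed outside the infimum (the result holds for every δ), since otherwise the infimum over level-α tests is 0; for an arbitrary rate, r*∼ε^{4/(4+c_1)} is claimed for all small ε, not all ε>0. *)

theory Defs
  imports "HOL-Probability.Probability" "HOL-Library.Landau_Symbols"
begin

text \<open>
  The index set of \<open>d\<close>-tuples of positive integers, as functions that are undefined
  outside \<open>{1..d}\<close>. All sequences below are functions on \<open>nat \<Rightarrow> nat\<close> of which only
  the values on \<open>multi_idx d\<close> matter.
\<close>

type_synonym idx = "nat \<Rightarrow> nat"

definition multi_idx :: "nat \<Rightarrow> idx set" where
  "multi_idx d = ({1..d} \<rightarrow>\<^sub>E {1..})"


section \<open>The observation model\<close>

definition data_space :: "nat \<Rightarrow> (idx \<Rightarrow> real) measure" where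
  "data_space d = PiM (multi_idx d) (\<lambda>_. borel)"

definition noise_law :: "nat \<Rightarrow> (idx \<Rightarrow> real) measure" where
  "noise_law d = PiM (multi_idx d) (\<lambda>_. std_normal_distribution)"

definition obs_law :: "nat \<Rightarrow> (idx \<Rightarrow> real) \<Rightarrow> real \<Rightarrow> (idx \<Rightarrow> real) \<Rightarrow> (idx \<Rightarrow> real) measure" where
  "obs_law d b \<epsilon> \<theta> =
     distr (noise_law d) (data_space d) (\<lambda>\<xi>. \<lambda>l\<in>multi_idx d. b l * \<theta> l + \<epsilon> * \<xi> l)"


section \<open>Alternatives\<close>

definition ell2 :: "nat \<Rightarrow> (idx \<Rightarrow> real) set" where
  "ell2 d = {\<theta>. (\<lambda>l. (\<theta> l)\<^sup>2) summable_on multi_idx d}"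

definition ell2_norm :: "nat \<Rightarrow> (idx \<Rightarrow> real) \<Rightarrow> real" where
  "ell2_norm d \<theta> = sqrt (\<Sum>\<^sub>\<infinity>l\<in>multi_idx d. (\<theta> l)\<^sup>2)"

text \<open>
  Since \<open>infsum\<close> is \<open>0\<close> on families that are not summable, finiteness of the weighted sum
  has to be required explicitly.
\<close>

definition ellipsoid :: "nat \<Rightarrow> (idx \<Rightarrow> real) \<Rightarrow> real \<Rightarrow> (idx \<Rightarrow> real) set" where
  "ellipsoid d a R =
     {\<theta> \<in> ell2 d. (\<lambda>l. (a l)\<^sup>2 * (\<theta> l)\<^sup>2) summable_on multi_idx d \<and>
                  (\<Sum>\<^sub>\<infinity>l\<in>multi_idx d. (a l)\<^sup>2 * (\<theta> l)\<^sup>2) \<le> R\<^sup>2}"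

definition alternative :: "nat \<Rightarrow> (idx \<Rightarrow> real) \<Rightarrow> real \<Rightarrow> real \<Rightarrow> (idx \<Rightarrow> real) set" where
  "alternative d a R r = {\<theta> \<in> ellipsoid d a R. r \<le> ell2_norm d \<theta>}"


section \<open>Tests and their errors\<close>

definition is_test :: "nat \<Rightarrow> ((idx \<Rightarrow> real) \<Rightarrow> real) \<Rightarrow> bool" where
  "is_test d \<psi> \<longleftrightarrow> \<psi> \<in> borel_measurable (data_space d) \<and> \<psi> \<in> space (data_space d) \<rightarrow> {0, 1}"

definition type1_err :: "nat \<Rightarrow> (idx \<Rightarrow> real) \<Rightarrow> real \<Rightarrow> ((idx \<Rightarrow> real) \<Rightarrow> real) \<Rightarrow> real" where
  "type1_err d b \<epsilon> \<psi> =
     measure (obs_law d b \<epsilon> (\<lambda>_. 0)) {y \<in> space (data_space d). \<psi> y = 1}"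

text \<open>
  Suprema of probabilities are taken in \<open>[0, 1]\<close>, so the supremum over an empty set of
  alternatives is \<open>0\<close>; this is what inserting \<open>0\<close> achieves. The case does occur:
  \<open>alternative d a R r\<close> is empty for large \<open>r\<close>.
\<close>

definition type2_err ::
  "nat \<Rightarrow> (idx \<Rightarrow> real) \<Rightarrow> real \<Rightarrow> (idx \<Rightarrow> real) set \<Rightarrow> ((idx \<Rightarrow> real) \<Rightarrow> real) \<Rightarrow> real" where
  "type2_err d b \<epsilon> A \<psi> =
     Sup (insert 0 ((\<lambda>\<theta>. measure (obs_law d b \<epsilon> \<theta>) {y \<in> space (data_space d). \<psi> y = 0}) ` A))"

definition level_test ::
  "nat \<Rightarrow> (idx \<Rightarrow> real) \<Rightarrow> real \<Rightarrow> (real \<Rightarrow> (idx \<Rightarrow> real) \<Rightarrow> real) \<Rightarrow> bool" where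
  "level_test d b \<alpha> \<psi> \<longleftrightarrow>
     (\<forall>\<epsilon>>0. is_test d (\<psi> \<epsilon>)) \<and>
     (\<exists>\<delta>. (\<delta> \<longlongrightarrow> 0) (at_right 0) \<and> (\<forall>\<epsilon>>0. type1_err d b \<epsilon> (\<psi> \<epsilon>) \<le> \<alpha> + \<delta> \<epsilon>))"

text \<open>
  The minimax second kind error over level-\<open>\<alpha>\<close> tests is an infimum over families \<open>\<psi>\<close> with
  \<open>type1_err d b \<epsilon> (\<psi> \<epsilon>) \<le> \<alpha> + o(1)\<close>. If the \<open>o(1)\<close> term were allowed to vary with \<open>\<psi>\<close>
  inside the infimum at a given \<open>\<epsilon>\<close>, that infimum would be \<open>0\<close>, because a family may be
  changed to the constant \<open>1\<close> at a single \<open>\<epsilon>\<close>. The term is therefore a parameter \<open>\<delta>\<close>,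
  a function tending to \<open>0\<close> at \<open>0\<close>, and statements are made for every such \<open>\<delta>\<close>;
  every level-\<open>\<alpha>\<close> family in the sense of \<open>level_test\<close> is admitted for some \<open>\<delta>\<close>.
\<close>

definition minimax_err ::
  "nat \<Rightarrow> (idx \<Rightarrow> real) \<Rightarrow> real \<Rightarrow> (real \<Rightarrow> real) \<Rightarrow> real \<Rightarrow> (idx \<Rightarrow> real) set \<Rightarrow> real" where
  "minimax_err d b \<alpha> \<delta> \<epsilon> A =
     Inf (type2_err d b \<epsilon> A ` {\<psi>. is_test d \<psi> \<and> type1_err d b \<epsilon> \<psi> \<le> \<alpha> + \<delta> \<epsilon>})"


section \<open>Separation rates\<close>

definition minimax_rate ::
  "nat \<Rightarrow> (idx \<Rightarrow> real) \<Rightarrow> (idx \<Rightarrow> real) \<Rightarrow> real \<Rightarrow> real \<Rightarrow> (real \<Rightarrow> real) \<Rightarrow> (real \<Rightarrow> real) \<Rightarrow> bool" where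
  "minimax_rate d b a R \<alpha> \<delta> rs \<longleftrightarrow>
     (\<forall>\<epsilon>>0. 0 < rs \<epsilon>) \<and>
     (\<forall>r. (\<forall>\<epsilon>>0. 0 \<le> r \<epsilon>) \<longrightarrow>
        (((\<lambda>\<epsilon>. r \<epsilon> / rs \<epsilon>) \<longlongrightarrow> 0) (at_right 0) \<longrightarrow>
           ((\<lambda>\<epsilon>. minimax_err d b \<alpha> \<delta> \<epsilon> (alternative d a R (r \<epsilon>))) \<longlongrightarrow> 1 - \<alpha>) (at_right 0)) \<and>
        (filterlim (\<lambda>\<epsilon>. r \<epsilon> / rs \<epsilon>) at_top (at_right 0) \<longrightarrow>
           ((\<lambda>\<epsilon>. minimax_err d b \<alpha> \<delta> \<epsilon> (alternative d a R (r \<epsilon>))) \<longlongrightarrow> 0) (at_right 0)))"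

text \<open>
  A separation rate constrains a family only as \<open>\<epsilon> \<rightarrow> 0\<close>, hence the two-sided bound is
  required for all sufficiently small \<open>\<epsilon> > 0\<close>.
\<close>

definition same_order :: "(real \<Rightarrow> real) \<Rightarrow> (real \<Rightarrow> real) \<Rightarrow> bool" where
  "same_order v w \<longleftrightarrow>
     (\<exists>k0>0. \<exists>k1>0. \<forall>\<^sub>F \<epsilon> in at_right 0. k0 * w \<epsilon> \<le> v \<epsilon> \<and> v \<epsilon> \<le> k1 * w \<epsilon>)"


section \<open>Extremal problem and the associated tests\<close>

definition quartic :: "nat \<Rightarrow> (idx \<Rightarrow> real) \<Rightarrow> (idx \<Rightarrow> real) \<Rightarrow> real" where
  "quartic d b \<theta> = (\<Sum>\<^sub>\<infinity>k\<in>multi_idx d. (b k)^4 * (\<theta> k)^4)"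

definition extremal_value ::
  "nat \<Rightarrow> (idx \<Rightarrow> real) \<Rightarrow> (idx \<Rightarrow> real) \<Rightarrow> real \<Rightarrow> real \<Rightarrow> real \<Rightarrow> real" where
  "extremal_value d b a R \<epsilon> r =
     sqrt (1 / (2 * \<epsilon>^4) * (INF \<theta>\<in>alternative d a R r. quartic d b \<theta>))"

text \<open>
  The solution of the extremal problem is unique only up to signs; the filter depends on
  its squares only.
\<close>

definition extremal_solution ::
  "nat \<Rightarrow> (idx \<Rightarrow> real) \<Rightarrow> (idx \<Rightarrow> real) \<Rightarrow> real \<Rightarrow> real \<Rightarrow> (idx \<Rightarrow> real)" where
  "extremal_solution d b a R r = arg_min_on (quartic d b) (alternative d a R r)"

definition filter_coeff ::
  "nat \<Rightarrow> (idx \<Rightarrow> real) \<Rightarrow> (idx \<Rightarrow> real) \<Rightarrow> real \<Rightarrow> real \<Rightarrow> idx \<Rightarrow> real" where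
  "filter_coeff d b a R r k =
     (let \<theta> = extremal_solution d b a R r
      in (b k)\<^sup>2 * (\<theta> k)\<^sup>2 / sqrt (2 * quartic d b \<theta>))"

definition test_stat ::
  "nat \<Rightarrow> (idx \<Rightarrow> real) \<Rightarrow> (idx \<Rightarrow> real) \<Rightarrow> real \<Rightarrow> real \<Rightarrow> real \<Rightarrow> (idx \<Rightarrow> real) \<Rightarrow> real" where
  "test_stat d b a R \<epsilon> r y =
     (\<Sum>\<^sub>\<infinity>k\<in>multi_idx d. filter_coeff d b a R r k * ((y k / \<epsilon>)\<^sup>2 - 1))"

definition filter_test ::
  "nat \<Rightarrow> (idx \<Rightarrow> real) \<Rightarrow> (idx \<Rightarrow> real) \<Rightarrow> real \<Rightarrow> real \<Rightarrow> real \<Rightarrow> real \<Rightarrow> (idx \<Rightarrow> real) \<Rightarrow> real" where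
  "filter_test d b a R \<epsilon> r t y = of_bool (t < test_stat d b a R \<epsilon> r y)"

definition Gauss_cdf :: "real \<Rightarrow> real" where
  "Gauss_cdf = cdf std_normal_distribution"

definition Gauss_upper_quantile :: "real \<Rightarrow> real" where
  "Gauss_upper_quantile \<alpha> = Inf {x. 1 - \<alpha> \<le> Gauss_cdf x}"

end

theory Submission
  imports Defs
begin

text \<open>
  The extremal problem is convex in the squares of \<open>\<theta>\<close>, and its solution is
  \<open>(\<theta> k)^2 = A / (b k)^4 * max 0 (1 - (a k)^2 / D)\<close>. It has finite support, and the
  variational inequality says that the mean of the test statistic is at least
  \<open>u = extremal_value\<close> at every alternative. Under the null hypothesis the statistic is
  asymptotically standard Gaussian because all filter coefficients tend to \<open>0\<close>; this uses
  \<open>4 * t j / s j < c j \<le> c 1\<close>. Under an alternative it differs from its null version by its mean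
  and by a linear term that Chebyshev's inequality controls uniformly, whence the upper bound on
  the error of the second kind. For the lower bound, the signs of the extremal solution are
  chosen at random: every such sign change stays in the alternative, and the likelihood ratio of
  the mixture is asymptotically \<open>exp (u * T - u^2 / 2)\<close> with the same statistic \<open>T\<close>.

  As \<open>c 1\<close> is the strict maximum of the \<open>c j\<close>, the sum of \<open>1 / (b l)^4\<close> over
  \<open>(a l)^2 \<le> x\<close> is of order \<open>x powr (c 1 / 2)\<close>, so that \<open>u^2\<close> is of order
  \<open>r powr (4 + c 1) / \<epsilon>^4\<close>. The separation rate follows from the sharp asymptotics at
  \<open>C * \<epsilon> powr (4 / (4 + c 1))\<close> by letting \<open>C\<close> tend to \<open>0\<close> and to infinity, because the
  minimax error is antitone in the radius.
\<close>

subsection \<open>The standard Gaussian distribution\<close>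

text \<open>Every error bound is first proved at a fixed noise level with explicit slack: a normal
  approximation error \<open>\<kappa>\<close>, a bound \<open>m\<close> on the filter coefficients,
  a margin \<open>\<eta>\<close> and a tolerance \<open>\<eta>0\<close> on the level. Limits in
  \<epsilon> enter only at the end. Since the filter changes with \<epsilon>, the normal
  approximation has to be uniform over all filters with small largest coefficient; a compactness
  argument gives this without a rate. Signals measured in units of the noise are unbounded as
  \<epsilon> tends to 0, so the linear term is compared with the excess of the mean over u rather
  than with a constant. The permitted level \<alpha> + \<delta> \<epsilon> may be smaller than
  \<alpha>, and then the test at the quantile may be inadmissible; the upper bound on the minimax
  error therefore uses a slightly larger threshold. The order claim concerns every separation rate:
  two rates that are not comparable would leave room, along a sequence of noise levels, for a radius
  that is negligible against one and dominates the other, so that the minimax error would tend to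
  both 1 - \<alpha> and 0.\<close>

abbreviation std_gauss :: "real measure" where
  "std_gauss \<equiv> std_normal_distribution"

lemma prob_space_std_normal: "prob_space std_gauss"
  by (rule prob_space_normal_density) simp

interpretation std_normal: real_distribution std_gauss
  by (rule real_dist_normal_dist)

lemma measure_std_normal_UNIV [simp]: "measure std_gauss UNIV = 1"
  using std_normal.prob_space by simp

lemma Gauss_cdf_measure: "Gauss_cdf x = measure std_gauss {..x}"
  by (simp add: Gauss_cdf_def cdf_def)

lemma Gauss_cdf_mono: "x \<le> y \<Longrightarrow> Gauss_cdf x \<le> Gauss_cdf y"
  unfolding Gauss_cdf_def by (rule std_normal.cdf_nondecreasing)

lemma Gauss_cdf_nonneg: "0 \<le> Gauss_cdf x"
  unfolding Gauss_cdf_def by (rule std_normal.cdf_nonneg)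

lemma Gauss_cdf_le_1: "Gauss_cdf x \<le> 1"
  unfolding Gauss_cdf_def by (rule std_normal.cdf_bounded_prob)

lemma std_normal_density_le_1: "std_normal_density x \<le> 1"
proof -
  have "1 \<le> sqrt (2 * pi)"
    using pi_gt3 by simp
  moreover have "exp (- (x^2) / 2) \<le> 1" by simp
  ultimately have "exp (- (x^2) / 2) \<le> sqrt (2 * pi)" by linarith
  then show ?thesis
    by (simp add: std_normal_density_def divide_le_eq)
qed

lemma Gauss_cdf_diff:
  assumes "x \<le> y"
  shows "Gauss_cdf y - Gauss_cdf x = measure std_gauss {x<..y}"
proof (cases "x = y")
  case False
  then show ?thesis
    using assms unfolding Gauss_cdf_def by (intro std_normal.cdf_diff_eq) auto
qed simp

text \<open>The density is at most 1, hence the constant 1. This is what turns a margin in a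
  threshold into an equal loss in probability.\<close>

lemma Gauss_cdf_lipschitz:
  assumes "x \<le> y"
  shows "Gauss_cdf y \<le> Gauss_cdf x + (y - x)"
proof -
  have "emeasure std_gauss {x<..y}
      = (\<integral>\<^sup>+z. ennreal (std_normal_density z) * indicator {x<..y} z \<partial>lborel)"
    by (subst emeasure_density) auto
  also have "\<dots> \<le> (\<integral>\<^sup>+z. indicator {x<..y} z \<partial>lborel)"
    by (intro nn_integral_mono) (auto simp: indicator_def std_normal_density_le_1)
  also have "\<dots> = ennreal (y - x)"
    using assms by simp
  finally have "measure std_gauss {x<..y} \<le> y - x"
    using assms by (simp add: std_normal.emeasure_eq_measure)
  then show ?thesis
    using Gauss_cdf_diff[OF assms] by simp
qed

text \<open>The density is positive everywhere, so an interval of Gaussian measure 0 would be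
  Lebesgue null. Strictness pins down the quantile and gives a positive gain in level when a
  threshold is raised.\<close>

lemma Gauss_cdf_strict_mono:
  assumes "x < y"
  shows "Gauss_cdf x < Gauss_cdf y"
proof -
  have "measure std_gauss {x<..y} \<noteq> 0"
  proof
    assume "measure std_gauss {x<..y} = 0"
    then have "emeasure std_gauss {x<..y} = 0"
      by (simp add: std_normal.emeasure_eq_measure)
    then have "{x<..y} \<in> null_sets std_gauss"
      by (simp add: null_sets_def)
    then have "AE z in lborel. z \<in> {x<..y} \<longrightarrow> ennreal (std_normal_density z) = 0"
      by (subst (asm) null_sets_density_iff) auto
    moreover have "ennreal (std_normal_density z) \<noteq> 0" for z
      using normal_density_pos[of 1 0 z] by (simp add: not_le del: normal_density_pos)
    ultimately have "AE z in lborel. z \<notin> {x<..y}" by simp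
    then have "emeasure lborel {x<..y} = 0"
      by (subst (asm) AE_iff_measurable[of "{x<..y}"]) auto
    then show False
      using assms by simp
  qed
  then have "0 < measure std_gauss {x<..y}"
    using measure_nonneg[of std_gauss "{x<..y}"] by linarith
  then show ?thesis
    using Gauss_cdf_diff[of x y] assms by simp
qed

lemma Gauss_cdf_abs_diff: "\<bar>Gauss_cdf y - Gauss_cdf x\<bar> \<le> \<bar>y - x\<bar>"
  using Gauss_cdf_lipschitz[of x y] Gauss_cdf_lipschitz[of y x] Gauss_cdf_mono[of x y] Gauss_cdf_mono[of y x]
  by (cases "x \<le> y") auto

lemma isCont_Gauss_cdf: "isCont Gauss_cdf x"
  unfolding continuous_at_eps_delta dist_real_def
proof (intro allI impI)
  fix e :: real
  assume "0 < e"
  then show "\<exists>d>0. \<forall>x'. \<bar>x' - x\<bar> < d \<longrightarrow> \<bar>Gauss_cdf x' - Gauss_cdf x\<bar> < e"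
    using Gauss_cdf_abs_diff by (meson le_less_trans)
qed

lemma Gauss_cdf_at_top: "(Gauss_cdf \<longlongrightarrow> 1) at_top"
  unfolding Gauss_cdf_def by (rule std_normal.cdf_lim_at_top_prob)

lemma Gauss_cdf_at_bot: "(Gauss_cdf \<longlongrightarrow> 0) at_bot"
  unfolding Gauss_cdf_def by (rule std_normal.cdf_lim_at_bot)

lemma Gauss_cdf_surj:
  assumes "0 < p" "p < 1"
  obtains x where "Gauss_cdf x = p"
proof -
  have "eventually (\<lambda>x. Gauss_cdf x < p) at_bot"
    using order_tendstoD(2)[OF Gauss_cdf_at_bot] assms by blast
  then obtain x where x: "Gauss_cdf x < p"
    by (meson eventually_at_bot_linorder order_refl)
  have "eventually (\<lambda>x. Gauss_cdf x > p) at_top"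
    using order_tendstoD(1)[OF Gauss_cdf_at_top] assms by blast
  then obtain y where y: "Gauss_cdf y > p"
    by (meson eventually_at_top_linorder order_refl)
  have "x \<le> y"
    using x y Gauss_cdf_mono[of y x] by linarith
  then have "\<exists>z\<ge>x. z \<le> y \<and> Gauss_cdf z = p"
    using x y isCont_Gauss_cdf by (intro IVT) auto
  then show ?thesis
    using that by blast
qed

lemma Gauss_cdf_upper_quantile:
  assumes "0 < \<alpha>" "\<alpha> < 1"
  shows "Gauss_cdf (Gauss_upper_quantile \<alpha>) = 1 - \<alpha>"
proof -
  obtain x where x: "Gauss_cdf x = 1 - \<alpha>"
    using Gauss_cdf_surj[of "1 - \<alpha>"] assms by auto
  have "{z. 1 - \<alpha> \<le> Gauss_cdf z} = {x..}"
    using x Gauss_cdf_mono[of x] Gauss_cdf_strict_mono[of _ x] by (auto simp: not_less[symmetric])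
  then show ?thesis
    using x by (simp add: Gauss_upper_quantile_def)
qed

text \<open>Polya's argument: the limit is continuous, so its quantiles at the levels i / m form a
  finite grid, and monotonicity bounds the error between two grid points by the error at the grid
  points plus the spacing 1 / m.\<close>

lemma uniform_convergence_to_Gauss_cdf:
  fixes F :: "nat \<Rightarrow> real \<Rightarrow> real"
  assumes mono: "\<And>n x y. x \<le> y \<Longrightarrow> F n x \<le> F n y"
    and bounds: "\<And>n x. 0 \<le> F n x" "\<And>n x. F n x \<le> 1"
    and lim: "\<And>x. (\<lambda>n. F n x) \<longlonglongrightarrow> Gauss_cdf x"
    and "0 < \<eta>"
  shows "eventually (\<lambda>n. \<forall>x. \<bar>F n x - Gauss_cdf x\<bar> \<le> \<eta>) sequentially"
proof -
  obtain m :: nat where m: "2 / \<eta> < real m"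
    using reals_Archimedean2 by blast
  then have m0: "0 < m"
    using \<open>0 < \<eta>\<close> by (cases m) (auto simp: divide_less_0_iff)
  have m1: "1 / m < \<eta> / 2"
    using m m0 \<open>0 < \<eta>\<close> by (simp add: field_simps)
  have "\<exists>q. Gauss_cdf q = real i / m" if "i \<in> {1..<m}" for i
    using Gauss_cdf_surj[of "real i / m"] that by auto
  then obtain q where q: "\<And>i. i \<in> {1..<m} \<Longrightarrow> Gauss_cdf (q i) = real i / m"
    by metis
  have "eventually (\<lambda>n. \<forall>i\<in>{1..<m}. \<bar>F n (q i) - Gauss_cdf (q i)\<bar> < \<eta> / 2) sequentially"
  proof (intro eventually_ball_finite ballI)
    fix i
    show "eventually (\<lambda>n. \<bar>F n (q i) - Gauss_cdf (q i)\<bar> < \<eta> / 2) sequentially"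
      using tendstoD[OF lim, of "\<eta> / 2" "q i"] \<open>0 < \<eta>\<close> by (simp add: dist_real_def)
  qed simp
  then show ?thesis
  proof (rule eventually_mono, intro allI)
    fix n x
    assume close: "\<forall>i\<in>{1..<m}. \<bar>F n (q i) - Gauss_cdf (q i)\<bar> < \<eta> / 2"
    \<comment> \<open>The cell from i / m to (i + 1) / m that contains \<open>Gauss_cdf x\<close>.
      The first and the last cell have no grid point on one side; there the bounds 0 and 1 on
      \<open>F\<close> replace it.\<close>
    define i where "i = nat \<lfloor>m * Gauss_cdf x\<rfloor>"
    have i: "real i \<le> m * Gauss_cdf x" "m * Gauss_cdf x < real i + 1"
      using Gauss_cdf_nonneg[of x] by (auto simp: i_def)
    have lo: "real i / m \<le> Gauss_cdf x" and hi: "Gauss_cdf x < (real i + 1) / m"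
      using i m0 by (auto simp: field_simps)
    have "F n x \<le> Gauss_cdf x + \<eta>"
    proof (cases "i + 1 < m")
      case True
      then have c: "Gauss_cdf (q (i + 1)) = (real i + 1) / m" "\<bar>F n (q (i + 1)) - Gauss_cdf (q (i + 1))\<bar> < \<eta> / 2"
        using q[of "i + 1"] bspec[OF close, of "i + 1"] by auto
      have "x \<le> q (i + 1)"
        using c(1) hi Gauss_cdf_mono[of "q (i + 1)" x] by linarith
      then have "F n x \<le> (real i + 1) / m + \<eta> / 2"
        using mono[of x "q (i + 1)" n] c by linarith
      then show ?thesis
        using lo m1 by (simp add: add_divide_distrib)
    next
      case False
      then have "m \<le> i + 1" by simp
      then have "1 \<le> (real i + 1) / m"
        using m0 by (simp add: field_simps flip: of_nat_Suc)
      then show ?thesis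
        using bounds(2)[of n x] lo m1 \<open>0 < \<eta>\<close> by (simp add: add_divide_distrib)
    qed
    moreover have "Gauss_cdf x \<le> F n x + \<eta>"
    proof (cases "i = 0")
      case False
      have "Gauss_cdf x < 1 \<or> Gauss_cdf x = 1"
        using Gauss_cdf_le_1[of x] by linarith
      moreover have "Gauss_cdf x \<noteq> 1"
        using Gauss_cdf_strict_mono[of x "x + 1"] Gauss_cdf_le_1[of "x + 1"] by auto
      ultimately have "real i < m"
        using i(1) m0 by (smt (verit) mult_less_cancel_left2 of_nat_0_less_iff)
      then have "i \<in> {1..<m}"
        using False by auto
      then have c: "Gauss_cdf (q i) = real i / m" "\<bar>F n (q i) - Gauss_cdf (q i)\<bar> < \<eta> / 2"
        using q[of i] bspec[OF close, of i] by auto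
      have "q i \<le> x"
        using lo c(1) Gauss_cdf_strict_mono[of x "q i"] by linarith
      then have "real i / m \<le> F n x + \<eta> / 2"
        using mono[of "q i" x n] c by linarith
      then show ?thesis
        using hi m1 by (simp add: add_divide_distrib)
    next
      case True
      then show ?thesis
        using hi m1 bounds(1)[of n x] \<open>0 < \<eta>\<close> by simp
    qed
    ultimately show "\<bar>F n x - Gauss_cdf x\<bar> \<le> \<eta>" by linarith
  qed
qed

text \<open>The eighth moment gives the variance of the fourth power, needed for the quartic
  remainder in the lower bound.\<close>

lemma std_normal_moments:
  "(LINT x|std_gauss. x) = 0"
  "(LINT x|std_gauss. x^2) = 1"
  "(LINT x|std_gauss. x^4) = 3"
  "(LINT x|std_gauss. x^8) = 105"
  using integral_std_normal_distribution_moment_odd[of 1] std_normal_distribution_even_moments(1)[of 1]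
    std_normal_distribution_even_moments(1)[of 2] std_normal_distribution_even_moments(1)[of 4]
  by (simp_all add: fact_numeral)

lemmas std_normal_integrable_power [simp] = integrable_std_normal_distribution_moment

lemma std_normal_integrable_id [simp]: "integrable std_gauss (\<lambda>x. x)"
  using integrable_std_normal_distribution_moment[of 1] by simp

subsection \<open>Independent standard Gaussian coordinates\<close>

abbreviation gauss_prod :: "'i set \<Rightarrow> ('i \<Rightarrow> real) measure" where
  "gauss_prod I \<equiv> PiM I (\<lambda>_. std_gauss)"

lemma prob_space_gauss_prod: "prob_space (gauss_prod I)"
  by (intro prob_space_PiM prob_space_std_normal)

lemma distr_gauss_prod_component:
  "k \<in> I \<Longrightarrow> distr (gauss_prod I) borel (\<lambda>\<xi>. \<xi> k) = std_gauss"
  using distr_PiM_component[of I "\<lambda>_. std_gauss" k] prob_space_std_normal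
  by (simp cong: distr_cong)

lemma measurable_gauss_component:
  "k \<in> I \<Longrightarrow> (\<lambda>\<xi>. \<xi> k) \<in> borel_measurable (gauss_prod I)"
  using measurable_component_singleton[of k I "\<lambda>_. std_gauss"] by simp

lemma measurable_gauss_fun_component:
  assumes "k \<in> I" "g \<in> borel_measurable borel"
  shows "(\<lambda>\<xi>. g (\<xi> k)) \<in> borel_measurable (gauss_prod I)"
  using measurable_compose[OF measurable_gauss_component assms(2)] assms(1) .

lemma integral_gauss_component:
  fixes g :: "real \<Rightarrow> 'b::{banach, second_countable_topology}"
  assumes "k \<in> I" and [measurable]: "g \<in> borel_measurable borel"
  shows "(LINT \<xi>|gauss_prod I. g (\<xi> k)) = (LINT x|std_gauss. g x)"
  using integral_distr[of "\<lambda>\<xi>. \<xi> k" "gauss_prod I" borel g] measurable_gauss_component[of k I] assms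
  by (simp add: distr_gauss_prod_component)

lemma integrable_gauss_component:
  fixes g :: "real \<Rightarrow> 'b::{banach, second_countable_topology}"
  assumes "k \<in> I" and [measurable]: "g \<in> borel_measurable borel"
    and "integrable std_gauss g"
  shows "integrable (gauss_prod I) (\<lambda>\<xi>. g (\<xi> k))"
  using integrable_distr_eq[of "\<lambda>\<xi>. \<xi> k" "gauss_prod I" borel g] measurable_gauss_component[of k I] assms
  by (simp add: distr_gauss_prod_component)

lemma nn_integral_gauss_component:
  assumes "k \<in> I" and [measurable]: "g \<in> borel_measurable borel"
  shows "(\<integral>\<^sup>+\<xi>. g (\<xi> k) \<partial>gauss_prod I) = (\<integral>\<^sup>+x. g x \<partial>std_gauss)"
  using nn_integral_distr[of "\<lambda>\<xi>. \<xi> k" "gauss_prod I" borel g] measurable_gauss_component[of k I] assms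
  by (simp add: distr_gauss_prod_component)

lemma indep_vars_gauss_prod:
  assumes "K \<subseteq> I"
  shows "prob_space.indep_vars (gauss_prod I) (\<lambda>_. borel) (\<lambda>k \<xi>. \<xi> k) K"
proof (cases "I = {}")
  case True
  interpret prob_space "gauss_prod I" by (rule prob_space_gauss_prod)
  have "K = {}" using True assms by simp
  then show ?thesis
    unfolding indep_vars_def2 by (intro conjI ballI indep_setsI) blast+
next
  case False
  interpret prob_space "gauss_prod I" by (rule prob_space_gauss_prod)
  have "distr (gauss_prod I) (\<Pi>\<^sub>M i\<in>I. borel) (\<lambda>x. \<lambda>i\<in>I. x i) = distr (gauss_prod I) (gauss_prod I) (\<lambda>x. x)"
    by (rule distr_cong) (auto simp: space_PiM extensional_def PiE_def intro!: sets_PiM_cong)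
  also have "\<dots> = gauss_prod I"
    by (rule distr_id)
  also have "\<dots> = (\<Pi>\<^sub>M i\<in>I. distr (gauss_prod I) borel (\<lambda>\<xi>. \<xi> i))"
    by (rule PiM_cong) (simp_all add: distr_gauss_prod_component)
  finally have "indep_vars (\<lambda>_. borel) (\<lambda>k \<xi>. \<xi> k) I"
    by (subst indep_vars_iff_distr_eq_PiM'[OF False]) auto
  then show ?thesis
    using assms by (rule indep_vars_subset)
qed

lemma indep_vars_gauss_fun:
  assumes "K \<subseteq> I" "\<And>k. k \<in> K \<Longrightarrow> g k \<in> measurable borel (N k)"
  shows "prob_space.indep_vars (gauss_prod I) N (\<lambda>k \<xi>. g k (\<xi> k)) K"
proof -
  interpret prob_space "gauss_prod I" by (rule prob_space_gauss_prod)
  show ?thesis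
    by (rule indep_vars_compose2[OF indep_vars_gauss_prod[OF assms(1)] assms(2)])
qed

text \<open>Products of two distinct terms have mean 0 by independence and centring, so only the
  diagonal of the double sum survives.\<close>

lemma
  fixes g :: "'i \<Rightarrow> real \<Rightarrow> real"
  assumes K: "finite K" "K \<subseteq> I"
    and meas: "\<And>k. g k \<in> borel_measurable borel"
    and int2: "\<And>k. k \<in> K \<Longrightarrow> integrable std_gauss (\<lambda>x. (g k x)^2)"
    and centred: "\<And>k. k \<in> K \<Longrightarrow> (LINT x|std_gauss. g k x) = 0"
  shows integrable_gauss_sum_square: "integrable (gauss_prod I) (\<lambda>\<xi>. (\<Sum>k\<in>K. g k (\<xi> k))^2)"
    and integral_gauss_sum_square: "(LINT \<xi>|gauss_prod I. (\<Sum>k\<in>K. g k (\<xi> k))^2)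
      = (\<Sum>k\<in>K. LINT x|std_gauss. (g k x)^2)"
proof -
  interpret prob_space "gauss_prod I" by (rule prob_space_gauss_prod)
  note meas [measurable]
  have int1: "integrable std_gauss (g k)" if "k \<in> K" for k
    by (rule std_normal.square_integrable_imp_integrable[OF _ int2[OF that]]) simp
  have sq: "(\<Sum>k\<in>K. g k (\<xi> k))^2 = (\<Sum>i\<in>K. \<Sum>j\<in>K. g i (\<xi> i) * g j (\<xi> j))" for \<xi>
    by (simp add: power2_eq_square sum_product)
  have *: "integrable (gauss_prod I) (\<lambda>\<xi>. g i (\<xi> i) * g j (\<xi> j)) \<and>
      (LINT \<xi>|gauss_prod I. g i (\<xi> i) * g j (\<xi> j))
       = (if i = j then LINT x|std_gauss. (g i x)^2 else 0)"
    if ij: "i \<in> K" "j \<in> K" for i j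
  proof (cases "i = j")
    case True
    then show ?thesis
      using integrable_gauss_component[of i I "\<lambda>x. (g i x)^2"] integral_gauss_component[of i I "\<lambda>x. (g i x)^2"]
        int2[of i] ij K by (auto simp: power2_eq_square)
  next
    case False
    have sub: "{i, j} \<subseteq> I" using ij K by auto
    have ind: "indep_vars (\<lambda>_. borel) (\<lambda>k \<xi>. g k (\<xi> k)) {i, j}"
      by (rule indep_vars_gauss_fun[OF sub]) simp
    have int: "integrable (gauss_prod I) (\<lambda>\<xi>. g k (\<xi> k))" if "k \<in> {i, j}" for k
      using that ij K int1 by (intro integrable_gauss_component) auto
    have "(LINT \<xi>|gauss_prod I. (\<Prod>k\<in>{i, j}. g k (\<xi> k))) = (\<Prod>k\<in>{i, j}. LINT \<xi>|gauss_prod I. g k (\<xi> k))"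
      by (rule indep_vars_lebesgue_integral[OF _ ind int]) auto
    moreover have "(LINT \<xi>|gauss_prod I. g i (\<xi> i)) = 0"
      using ij K centred by (subst integral_gauss_component) auto
    moreover have "integrable (gauss_prod I) (\<lambda>\<xi>. (\<Prod>k\<in>{i, j}. g k (\<xi> k)))"
      by (rule indep_vars_integrable[OF _ ind int]) auto
    ultimately show ?thesis
      using False by simp
  qed
  show "integrable (gauss_prod I) (\<lambda>\<xi>. (\<Sum>k\<in>K. g k (\<xi> k))^2)"
    unfolding sq using * by (intro Bochner_Integration.integrable_sum) auto
  have "(LINT \<xi>|gauss_prod I. (\<Sum>k\<in>K. g k (\<xi> k))^2)
      = (\<Sum>i\<in>K. \<Sum>j\<in>K. LINT \<xi>|gauss_prod I. g i (\<xi> i) * g j (\<xi> j))"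
    unfolding sq using * by (simp add: Bochner_Integration.integral_sum)
  also have "\<dots> = (\<Sum>i\<in>K. \<Sum>j\<in>K. if i = j then LINT x|std_gauss. (g i x)^2 else 0)"
    using * by (intro sum.cong refl) blast
  also have "\<dots> = (\<Sum>k\<in>K. LINT x|std_gauss. (g k x)^2)"
    using K by (simp add: sum.delta)
  finally show "(LINT \<xi>|gauss_prod I. (\<Sum>k\<in>K. g k (\<xi> k))^2)
      = (\<Sum>k\<in>K. LINT x|std_gauss. (g k x)^2)" .
qed

lemma gauss_sum_Chebyshev:
  fixes g :: "'i \<Rightarrow> real \<Rightarrow> real"
  assumes K: "finite K" "K \<subseteq> I"
    and meas: "\<And>k. g k \<in> borel_measurable borel"
    and int2: "\<And>k. k \<in> K \<Longrightarrow> integrable std_gauss (\<lambda>x. (g k x)^2)"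
    and centred: "\<And>k. k \<in> K \<Longrightarrow> (LINT x|std_gauss. g k x) = 0"
    and "0 < \<eta>"
  shows "measure (gauss_prod I) {\<xi> \<in> space (gauss_prod I). \<eta> \<le> \<bar>\<Sum>k\<in>K. g k (\<xi> k)\<bar>}
    \<le> (\<Sum>k\<in>K. LINT x|std_gauss. (g k x)^2) / \<eta>^2"
proof -
  interpret prob_space "gauss_prod I" by (rule prob_space_gauss_prod)
  note meas [measurable]
  have [measurable]: "(\<lambda>\<xi>. g k (\<xi> k)) \<in> borel_measurable (gauss_prod I)" if "k \<in> K" for k
    using that K by (intro measurable_gauss_fun_component) auto
  have "measure (gauss_prod I) {\<xi> \<in> space (gauss_prod I). \<eta> \<le> \<bar>\<Sum>k\<in>K. g k (\<xi> k)\<bar>}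
      \<le> (LINT \<xi>|gauss_prod I. (\<Sum>k\<in>K. g k (\<xi> k))^2) / \<eta>^2"
    using \<open>0 < \<eta>\<close> K by (intro second_moment_method integrable_gauss_sum_square int2 centred) auto
  then show ?thesis
    using integral_gauss_sum_square[OF K, of g] int2 centred by simp
qed

section \<open>Normal approximation of weighted sums of centred squares, uniform in the
  weights\<close>

lemma exp_minus_approx:
  fixes y :: real
  assumes "0 \<le> y"
  shows "\<bar>exp (- y) - (1 - y)\<bar> \<le> y^2 / 2"
proof -
  have "exp (- y) \<ge> 1 - y"
    using exp_ge_add_one_self[of "- y"] by simp
  moreover have "exp (- y) \<le> 1 - y + y^2 / 2"
  proof -
    define f :: "real \<Rightarrow> real" where "f x = 1 - x + x^2 / 2 - exp (- x)" for x
    have "f 0 \<le> f y"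
    proof (rule DERIV_nonneg_imp_nondecreasing[OF assms])
      fix x :: real
      have "(f has_real_derivative - 1 + x + exp (- x)) (at x)"
        unfolding f_def by (auto intro!: derivative_eq_intros)
      moreover have "0 \<le> - 1 + x + exp (- x)"
        using exp_ge_add_one_self[of "- x"] by simp
      ultimately show "\<exists>z. (f has_real_derivative z) (at x) \<and> 0 \<le> z" by blast
    qed
    then show ?thesis by (simp add: f_def)
  qed
  ultimately show ?thesis by simp
qed

text \<open>The variable x^2 - 1 is centred with variance 2, so its characteristic function is 1 -
  s^2 up to third order, and 1 - s^2 is exp (- s^2) up to fourth order. The factor s^2 is split off
  because it sums to a constant over the weights, while the bracket is small uniformly.\<close>

lemma char_gauss_quadratic:
  fixes s :: real
  defines "B \<equiv> LINT x|std_gauss. \<bar>x^2 - 1\<bar>^3"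
  shows "cmod (char (distr std_gauss borel (\<lambda>x. x^2 - 1)) s - exp (- (s^2)))
     \<le> s^2 * (\<bar>s\<bar> * B + s^2)"
proof -
  let ?M = "std_gauss"
  have 2: "(x^2 - 1)^2 = x^4 - 2 * x^2 + 1" for x :: real
    by algebra
  have int2: "integrable ?M (\<lambda>x. (x^2 - 1)^2)"
    unfolding 2 by simp
  have var: "(LINT x|?M. (x^2 - 1)^2) = 2"
    unfolding 2 by (simp add: std_normal_moments)
  have mean: "(LINT x|?M. x^2 - 1) = 0"
    by (simp add: std_normal_moments)
  have 3: "\<bar>x^2 - 1\<bar>^3 \<le> x^6 + 3 * x^4 + 3 * x^2 + 1" for x :: real
  proof -
    have "\<bar>x^2 - 1\<bar>^3 \<le> (x^2 + 1)^3"
      by (rule power_mono) (auto simp: abs_le_iff)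
    also have "\<dots> = x^6 + 3 * x^4 + 3 * x^2 + 1" by algebra
    finally show ?thesis .
  qed
  have int3: "integrable ?M (\<lambda>x. \<bar>x^2 - 1\<bar>^3)"
  proof (rule Bochner_Integration.integrable_bound)
    show "integrable ?M (\<lambda>x. x^6 + 3 * x^4 + 3 * x^2 + 1)" by simp
    show "AE x in ?M. norm (\<bar>x^2 - 1\<bar>^3) \<le> norm (x^6 + 3 * x^4 + 3 * x^2 + 1)"
    proof (rule AE_I2)
      fix x :: real
      show "norm (\<bar>x^2 - 1\<bar>^3) \<le> norm (x^6 + 3 * x^4 + 3 * x^2 + 1)"
        using order_trans[OF 3 abs_ge_self, of x] by (simp add: power_abs)
    qed
  qed simp
  have B: "0 \<le> B" by (simp add: B_def)
  have "cmod (char (distr ?M borel (\<lambda>x. x^2 - 1)) s - (1 - s^2 * 2 / 2))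
      \<le> (s^2 / 6) * (LINT x|?M. min (6 * (x^2 - 1)^2) (\<bar>s\<bar> * \<bar>x^2 - 1\<bar>^3))"
    using std_normal.char_approx3'[of "\<lambda>x. x^2 - 1" 2 "distr ?M borel (\<lambda>x. x^2 - 1)" s] int2 mean var
    by simp
  also have "\<dots> \<le> (s^2 / 6) * (LINT x|?M. \<bar>s\<bar> * \<bar>x^2 - 1\<bar>^3)"
    using int2 int3 by (intro mult_left_mono integral_mono integrable_min integrable_mult_right) auto
  also have "\<dots> = s^2 / 6 * (\<bar>s\<bar> * B)"
    by (simp add: B_def)
  finally have 1: "cmod (char (distr ?M borel (\<lambda>x. x^2 - 1)) s - (1 - s^2)) \<le> s^2 / 6 * (\<bar>s\<bar> * B)"
    by simp
  have "cmod (complex_of_real (exp (- (s^2)) - (1 - s^2))) \<le> (s^2)^2 / 2"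
    unfolding norm_of_real using exp_minus_approx[of "s^2"] by simp
  then have "cmod ((1 - s^2) - complex_of_real (exp (- (s^2)))) \<le> (s^2)^2 / 2"
    by (simp add: norm_minus_commute)
  from norm_triangle_mono[OF 1 this]
  have "cmod (char (distr ?M borel (\<lambda>x. x^2 - 1)) s - exp (- (s^2))) \<le> s^2 / 6 * (\<bar>s\<bar> * B) + (s^2)^2 / 2"
    by simp
  also have "\<dots> \<le> s^2 * (\<bar>s\<bar> * B) + (s^2)^2"
  proof -
    have "0 \<le> s^2 * (\<bar>s\<bar> * B)" "0 \<le> (s^2)^2"
      using B by simp_all
    then show ?thesis by linarith
  qed
  also have "\<dots> = s^2 * (\<bar>s\<bar> * B + s^2)"
    by (simp add: distrib_left power2_eq_square[of "s^2"])
  finally show ?thesis .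
qed

text \<open>A bound \<open>\<kappa>\<close> on the Kolmogorov distance to the Gaussian law for all
  weight families bounded by \<open>m\<close>. As each centred square has variance 2, the
  normalisation 1 / 2 gives the sum variance 1.\<close>

definition clt_bound :: "'i set \<Rightarrow> real \<Rightarrow> real \<Rightarrow> bool" where
  "clt_bound I m \<kappa> \<longleftrightarrow> (\<forall>K w x. finite K \<longrightarrow> K \<subseteq> I \<longrightarrow> (\<forall>k\<in>K. 0 \<le> w k) \<longrightarrow> (\<forall>k\<in>K. w k \<le> m) \<longrightarrow>
     (\<Sum>k\<in>K. (w k)^2) = 1 / 2 \<longrightarrow>
     \<bar>measure (gauss_prod I) {\<xi> \<in> space (gauss_prod I). (\<Sum>k\<in>K. w k * ((\<xi> k)^2 - 1)) \<le> x} - Gauss_cdf x\<bar> \<le> \<kappa>)"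

lemma clt_bound_mono: "clt_bound I m \<kappa> \<Longrightarrow> m' \<le> m \<Longrightarrow> clt_bound I m' \<kappa>"
  unfolding clt_bound_def by (meson order_trans)

text \<open>If no \<open>m\<close> worked, there would be weight families bounded by 1 / (n + 1)
  whose distribution functions differ from the Gaussian one by more than \<eta> at some point
  \<open>x n\<close>. Levy's continuity theorem for this triangular array contradicts that.\<close>

lemma gauss_quadratic_clt:
  fixes I :: "'i set"
  assumes "0 < \<eta>"
  obtains m where "0 < m" "clt_bound I m \<eta>"
proof (rule ccontr)
  let ?M = "gauss_prod I"
  interpret prob_space ?M by (rule prob_space_gauss_prod)
  assume no: "\<not> thesis"
  define P where "P n K w x \<longleftrightarrow> finite K \<and> K \<subseteq> I \<and> (\<forall>k\<in>K. 0 \<le> w k) \<and> (\<forall>k\<in>K. w k \<le> 1 / real (Suc n)) \<and> (\<Sum>k\<in>K. (w k)^2) = 1 / 2 \<and>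
      \<not> \<bar>prob {\<xi> \<in> space ?M. (\<Sum>k\<in>K. w k * ((\<xi> k)^2 - 1)) \<le> x} - Gauss_cdf x\<bar> \<le> \<eta>" for n K w x
  have "\<not> clt_bound I (1 / real (Suc n)) \<eta>" for n
    using that[of "1 / real (Suc n)"] no by auto
  then have "\<exists>K w x. P n K w x" for n
    unfolding clt_bound_def P_def by (simp only: not_all not_imp)
  then obtain K w x where P: "\<And>n. P n (K n) (w n) (x n)"
    by metis
  have K: "\<And>n. finite (K n)" "\<And>n. K n \<subseteq> I"
    and w: "\<And>n k. k \<in> K n \<Longrightarrow> 0 \<le> w n k" "\<And>n k. k \<in> K n \<Longrightarrow> w n k \<le> 1 / real (Suc n)"
    and sq: "\<And>n. (\<Sum>k\<in>K n. (w n k)^2) = 1 / 2"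
    and far: "\<And>n. \<not> \<bar>prob {\<xi> \<in> space ?M. (\<Sum>k\<in>K n. w n k * ((\<xi> k)^2 - 1)) \<le> x n} - Gauss_cdf (x n)\<bar> \<le> \<eta>"
    using P by (simp_all add: P_def)
  define X where "X n \<xi> = (\<Sum>k\<in>K n. w n k * ((\<xi> k)^2 - 1))" for n and \<xi> :: "'i \<Rightarrow> real"
  define D where "D n = distr ?M borel (X n)" for n
  have comp [measurable]: "(\<lambda>\<xi>. \<xi> k) \<in> borel_measurable ?M" if "k \<in> K n" for k n
    using that K(2) by (intro measurable_gauss_component) auto
  have X [measurable]: "X n \<in> borel_measurable ?M" for n
    unfolding X_def by measurable
  have D: "real_distribution (D n)" for n
    unfolding D_def by simp
  have cdf_D: "cdf (D n) z = prob {\<xi> \<in> space ?M. X n \<xi> \<le> z}" for n z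
    unfolding D_def cdf_def by (subst measure_distr) (auto intro!: arg_cong[where f=prob])
  define B where "B = (LINT x|std_gauss. \<bar>x^2 - 1\<bar>^3)"
  have B: "0 \<le> B" by (simp add: B_def)
  have "weak_conv_m D std_gauss"
  proof (rule levy_continuity[OF D real_dist_normal_dist])
    fix t :: real
    let ?\<phi> = "\<lambda>s. char (distr std_gauss borel (\<lambda>x. x^2 - 1)) s"
    have bound: "cmod (char (D n) t - exp (- (t^2) / 2)) \<le> t^2 / 2 * (inverse (real (Suc n)) * \<bar>t\<bar> * B + (inverse (real (Suc n)) * \<bar>t\<bar>)^2)" for n
    proof -
      let ?m = "inverse (real (Suc n))"
      have single: "char (distr ?M borel (\<lambda>\<xi>. w n k * ((\<xi> k)^2 - 1))) t = ?\<phi> (t * w n k)" if "k \<in> K n" for k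
      proof -
        have k: "k \<in> I" using that K by auto
        have "char (distr ?M borel (\<lambda>\<xi>. w n k * ((\<xi> k)^2 - 1))) t
            = (CLINT \<xi>|?M. iexp (t * (w n k * ((\<xi> k)^2 - 1))))"
          unfolding char_def using comp[OF that] by (subst integral_distr) auto
        also have "\<dots> = (CLINT z|std_gauss. iexp (t * (w n k * (z^2 - 1))))"
          using k by (intro integral_gauss_component) auto
        also have "\<dots> = ?\<phi> (t * w n k)"
          unfolding char_def by (subst integral_distr) (auto simp: mult_ac)
        finally show ?thesis .
      qed
      have "char (D n) t = (\<Prod>k\<in>K n. char (distr ?M borel (\<lambda>\<xi>. w n k * ((\<xi> k)^2 - 1))) t)"
        unfolding D_def X_def
        by (rule char_distr_sum, rule indep_vars_gauss_fun[OF K(2)]) simp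
      also have "\<dots> = (\<Prod>k\<in>K n. ?\<phi> (t * w n k))"
        using single by (intro prod.cong) auto
      finally have c: "char (D n) t = (\<Prod>k\<in>K n. ?\<phi> (t * w n k))" .
      \<comment> \<open>The squared weights sum to 1 / 2, so the Gaussian characteristic function
        splits into one factor for each coordinate.\<close>
      have "exp (- (t^2) / 2) = exp (\<Sum>k\<in>K n. - ((t * w n k)^2))"
        by (simp add: sum_negf power_mult_distrib sq flip: sum_distrib_left)
      also have "\<dots> = (\<Prod>k\<in>K n. exp (- ((t * w n k)^2)))"
        using K by (simp add: exp_sum)
      finally have e: "complex_of_real (exp (- (t^2) / 2)) = (\<Prod>k\<in>K n. complex_of_real (exp (- ((t * w n k)^2))))"
        by simp
      \<comment> \<open>All factors have modulus at most 1, so the difference of the products is at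
        most the sum of the differences of the factors.\<close>
      have "cmod (char (D n) t - exp (- (t^2) / 2)) \<le> (\<Sum>k\<in>K n. cmod (?\<phi> (t * w n k) - exp (- ((t * w n k)^2))))"
        unfolding c e
      proof (rule norm_prod_diff)
        fix k
        interpret \<phi>: real_distribution "distr std_gauss borel (\<lambda>x. x^2 - 1)" by simp
        show "cmod (?\<phi> (t * w n k)) \<le> 1" by (rule \<phi>.cmod_char_le_1)
      qed (auto simp: norm_of_real simp del: of_real_exp)
      also have "\<dots> \<le> (\<Sum>k\<in>K n. (w n k)^2 * (t^2 * (?m * \<bar>t\<bar> * B + (?m * \<bar>t\<bar>)^2)))"
      proof (rule sum_mono)
        fix k assume k: "k \<in> K n"
        have wm: "\<bar>t * w n k\<bar> \<le> ?m * \<bar>t\<bar>"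
          using mult_left_mono[OF w(2)[OF k] abs_ge_zero[of t]] w(1)[OF k]
          by (simp add: abs_mult divide_inverse mult.commute del: of_nat_Suc)
        have "cmod (?\<phi> (t * w n k) - exp (- ((t * w n k)^2)))
            \<le> (t * w n k)^2 * (\<bar>t * w n k\<bar> * B + (t * w n k)^2)"
          using char_gauss_quadratic[of "t * w n k"] unfolding B_def .
        also have "\<dots> \<le> (t * w n k)^2 * (?m * \<bar>t\<bar> * B + (?m * \<bar>t\<bar>)^2)"
          using wm B by (intro mult_left_mono add_mono mult_right_mono) (auto simp: abs_le_square_iff[symmetric] abs_mult)
        finally show "cmod (?\<phi> (t * w n k) - exp (- ((t * w n k)^2))) \<le> (w n k)^2 * (t^2 * (?m * \<bar>t\<bar> * B + (?m * \<bar>t\<bar>)^2))"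
          by (simp add: power_mult_distrib mult_ac)
      qed
      also have "\<dots> = t^2 / 2 * (?m * \<bar>t\<bar> * B + (?m * \<bar>t\<bar>)^2)"
        by (simp add: sq flip: sum_distrib_right)
      finally show ?thesis .
    qed
    have "(\<lambda>n. t^2 / 2 * (inverse (real (Suc n)) * \<bar>t\<bar> * B + (inverse (real (Suc n)) * \<bar>t\<bar>)^2)) \<longlonglongrightarrow> t^2 / 2 * (0 * \<bar>t\<bar> * B + (0 * \<bar>t\<bar>)^2)"
      by (intro tendsto_intros LIMSEQ_inverse_real_of_nat)
    then have null: "(\<lambda>n. t^2 / 2 * (inverse (real (Suc n)) * \<bar>t\<bar> * B + (inverse (real (Suc n)) * \<bar>t\<bar>)^2)) \<longlonglongrightarrow> 0"
      by simp
    have "(\<lambda>n. char (D n) t - exp (- (t^2) / 2)) \<longlonglongrightarrow> 0"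
      by (rule Lim_null_comparison[OF always_eventually null]) (rule allI, rule bound)
    then show "(\<lambda>n. char (D n) t) \<longlonglongrightarrow> char std_gauss t"
      unfolding char_std_normal_distribution by (rule LIM_zero_cancel)
  qed
  then have "(\<lambda>n. cdf (D n) z) \<longlonglongrightarrow> Gauss_cdf z" for z
    using isCont_Gauss_cdf[of z] unfolding weak_conv_m_def weak_conv_def Gauss_cdf_def by blast
  moreover have "cdf (D n) y \<le> cdf (D n) z" if "y \<le> z" for n y z
    using that D by (meson finite_borel_measure.cdf_nondecreasing real_distribution.finite_borel_measure_M)
  moreover have "0 \<le> cdf (D n) z" "cdf (D n) z \<le> 1" for n z
    by (simp_all add: cdf_D)
  \<comment> \<open>The points \<open>x n\<close> move with n, so pointwise convergence of the
    distribution functions would not suffice.\<close>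
  ultimately have "eventually (\<lambda>n. \<forall>z. \<bar>cdf (D n) z - Gauss_cdf z\<bar> \<le> \<eta>) sequentially"
    using \<open>0 < \<eta>\<close> by (intro uniform_convergence_to_Gauss_cdf) auto
  then show False
    using far by (auto simp: cdf_D X_def eventually_sequentially)
qed

subsection \<open>Error of the second kind of a quadratic test\<close>

text \<open>The shift \<open>x\<close> adds to the null statistic its mean S and a centred linear
  term whose variance is at most 4 * m * S. No bound on S is available, but the statistic can stay
  below the threshold only if the linear term cancels S - v + \<eta>, or the null part is below h -
  v + \<eta>; Chebyshev at that growing level gives a bound independent of S.\<close>

lemma gauss_quadratic_test_type2:
  fixes I :: "'i set" and w x :: "'i \<Rightarrow> real"
  defines "P \<equiv> \<lambda>Q. measure (gauss_prod I) {\<xi> \<in> space (gauss_prod I). Q \<xi>}"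
  assumes K: "finite K" "K \<subseteq> I"
    and w: "\<And>k. k \<in> K \<Longrightarrow> 0 \<le> w k" "\<And>k. k \<in> K \<Longrightarrow> w k \<le> m"
    and m: "0 < m" and \<eta>: "0 < \<eta>"
    and v: "0 \<le> v" "v \<le> (\<Sum>k\<in>K. w k * (x k)^2)"
    and clt: "\<And>z. \<bar>P (\<lambda>\<xi>. (\<Sum>k\<in>K. w k * ((\<xi> k)^2 - 1)) \<le> z) - Gauss_cdf z\<bar> \<le> \<kappa>"
  shows "P (\<lambda>\<xi>. (\<Sum>k\<in>K. w k * ((x k + \<xi> k)^2 - 1)) \<le> h)
    \<le> Gauss_cdf (h - v + \<eta>) + \<kappa> + 4 * m * (1 / \<eta> + v / \<eta>^2)"
proof -
  let ?M = "gauss_prod I"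
  interpret prob_space ?M by (rule prob_space_gauss_prod)
  have comp [measurable]: "(\<lambda>\<xi>. \<xi> k) \<in> borel_measurable ?M" if "k \<in> K" for k
    using that K(2) by (intro measurable_gauss_component) auto
  define S where "S = (\<Sum>k\<in>K. w k * (x k)^2)"
  \<comment> \<open>The excess of the mean over its guaranteed value. It grows with the variance of
    the linear term and absorbs it in the quotient \<open>S / (a + \<eta>)^2\<close> below.\<close>
  define a where "a = S - v"
  have a: "0 \<le> a" using v by (simp add: a_def S_def)
  let ?T0 = "\<lambda>\<xi>. \<Sum>k\<in>K. w k * ((\<xi> k)^2 - 1)"
  let ?V = "\<lambda>\<xi>. \<Sum>k\<in>K. (2 * w k * x k) * \<xi> k"
  have expand: "(\<Sum>k\<in>K. w k * ((x k + \<xi> k)^2 - 1)) = ?T0 \<xi> + S + ?V \<xi>" for \<xi>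
    by (simp add: S_def power2_sum algebra_simps sum.distrib sum_subtractf)
  have "P (\<lambda>\<xi>. (\<Sum>k\<in>K. w k * ((x k + \<xi> k)^2 - 1)) \<le> h)
      \<le> prob ({\<xi> \<in> space ?M. ?T0 \<xi> \<le> h - v + \<eta>} \<union> {\<xi> \<in> space ?M. a + \<eta> \<le> \<bar>?V \<xi>\<bar>})"
    unfolding P_def
  proof (rule finite_measure_mono)
    show "{\<xi> \<in> space ?M. (\<Sum>k\<in>K. w k * ((x k + \<xi> k)^2 - 1)) \<le> h}
      \<subseteq> {\<xi> \<in> space ?M. ?T0 \<xi> \<le> h - v + \<eta>} \<union> {\<xi> \<in> space ?M. a + \<eta> \<le> \<bar>?V \<xi>\<bar>}"
      unfolding expand a_def by auto
  qed measurable
  also have "\<dots> \<le> P (\<lambda>\<xi>. ?T0 \<xi> \<le> h - v + \<eta>) + P (\<lambda>\<xi>. a + \<eta> \<le> \<bar>?V \<xi>\<bar>)"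
    unfolding P_def by (rule measure_Un_le) measurable
  also have "P (\<lambda>\<xi>. ?T0 \<xi> \<le> h - v + \<eta>) \<le> Gauss_cdf (h - v + \<eta>) + \<kappa>"
    using clt[of "h - v + \<eta>"] by linarith
  also have "P (\<lambda>\<xi>. a + \<eta> \<le> \<bar>?V \<xi>\<bar>) \<le> (\<Sum>k\<in>K. LINT z|std_gauss. (2 * w k * x k * z)^2) / (a + \<eta>)^2"
    unfolding P_def using a \<eta> by (intro gauss_sum_Chebyshev K) (auto simp: power_mult_distrib std_normal_moments)
  also have "(\<Sum>k\<in>K. LINT z|std_gauss. (2 * w k * x k * z)^2) = (\<Sum>k\<in>K. 4 * (w k * (x k)^2) * w k)"
    by (intro sum.cong refl) (simp add: power_mult_distrib std_normal_moments, simp add: power2_eq_square)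
  also have "\<dots> \<le> (\<Sum>k\<in>K. 4 * (w k * (x k)^2) * m)"
    using w by (intro sum_mono mult_left_mono) auto
  also have "\<dots> = 4 * m * S"
    by (simp add: S_def sum_distrib_left mult_ac)
  also have "4 * m * S / (a + \<eta>)^2 \<le> 4 * m * (1 / \<eta> + v / \<eta>^2)"
  proof -
    have pos: "0 < (a + \<eta>)^2" "0 < a + \<eta>" using a \<eta> by simp_all
    have "a / (a + \<eta>)^2 \<le> (a + \<eta>) / (a + \<eta>)^2"
      using pos \<eta> by (intro divide_right_mono) auto
    also have "\<dots> = 1 / (a + \<eta>)" using pos by (simp add: power2_eq_square)
    also have "\<dots> \<le> 1 / \<eta>" using a \<eta> by (intro divide_left_mono) auto
    finally have 1: "a / (a + \<eta>)^2 \<le> 1 / \<eta>" .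
    have "\<eta>^2 \<le> (a + \<eta>)^2" using a \<eta> by (intro power_mono) auto
    then have 2: "v / (a + \<eta>)^2 \<le> v / \<eta>^2" using v \<eta> pos by (intro divide_left_mono) auto
    have "S / (a + \<eta>)^2 = a / (a + \<eta>)^2 + v / (a + \<eta>)^2"
      by (simp add: a_def flip: add_divide_distrib)
    then have "S / (a + \<eta>)^2 \<le> 1 / \<eta> + v / \<eta>^2" using 1 2 by linarith
    from mult_left_mono[OF this, of "4 * m"] show ?thesis using m by simp
  qed
  finally show ?thesis
    by (simp add: divide_right_mono)
qed

subsection \<open>Change of measure\<close>

lemma std_normal_shift:
  fixes A :: "real set"
  assumes [measurable]: "A \<in> sets borel"
  shows "(\<integral>\<^sup>+z. ennreal (exp (x * z - x^2 / 2)) * indicator A z \<partial>std_gauss)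
    = emeasure std_gauss {z. x + z \<in> A}"
proof -
  have dens: "std_normal_density (x + z) * exp (x * (x + z) - x^2 / 2) = std_normal_density z" for z
  proof -
    have "- ((x + z)^2) / 2 + (x * (x + z) - x^2 / 2) = - (z^2) / 2"
      by (simp add: power2_eq_square field_simps)
    then show ?thesis
      by (simp add: std_normal_density_def flip: exp_add)
  qed
  have "(\<integral>\<^sup>+z. ennreal (exp (x * z - x^2 / 2)) * indicator A z \<partial>std_gauss)
      = (\<integral>\<^sup>+z. ennreal (std_normal_density z * exp (x * z - x^2 / 2)) * indicator A z \<partial>lborel)"
    by (subst nn_integral_density) (auto simp: ennreal_mult mult.assoc)
  also have "\<dots> = (\<integral>\<^sup>+z. ennreal (std_normal_density (x + z) * exp (x * (x + z) - x^2 / 2)) * indicator A (x + z) \<partial>lborel)"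
    by (subst nn_integral_real_affine[where c=1 and t=x]) simp_all
  also have "\<dots> = (\<integral>\<^sup>+z. ennreal (std_normal_density z) * indicator {z. x + z \<in> A} z \<partial>lborel)"
    unfolding dens by (simp add: indicator_def)
  also have "\<dots> = emeasure std_gauss {z. x + z \<in> A}"
    by (subst emeasure_density) auto
  finally show ?thesis .
qed

lemma emeasure_gauss_prod_Collect:
  assumes "finite J" "J \<subseteq> I" "\<And>j. j \<in> J \<Longrightarrow> A j \<in> sets borel"
  shows "emeasure (gauss_prod I) {\<xi> \<in> space (gauss_prod I). \<forall>j\<in>J. \<xi> j \<in> A j}
    = (\<Prod>j\<in>J. emeasure std_gauss (A j))"
proof -
  interpret product_prob_space "\<lambda>_. std_gauss" I
    by (intro product_prob_spaceI prob_space_std_normal)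
  show ?thesis
    using assms by (intro emeasure_PiM_Collect) auto
qed

lemma measurable_gauss_shift:
  "(\<lambda>\<xi>. \<lambda>i\<in>I. x i + \<xi> i) \<in> measurable (gauss_prod I) (gauss_prod I)"
proof (rule measurable_restrict)
  fix i assume "i \<in> I"
  from measurable_gauss_component[OF this]
  show "(\<lambda>\<xi>. x i + \<xi> i) \<in> gauss_prod I \<rightarrow>\<^sub>M std_gauss"
    by simp
qed

text \<open>Only finitely many coordinates are shifted, so the density is a finite product even if
  \<open>I\<close> is infinite. Both measures factor over cylinder sets, where the claim reduces to
  the one-dimensional shift.\<close>

lemma gauss_prod_Cameron_Martin:
  fixes x :: "'i \<Rightarrow> real"
  assumes K: "finite K" "K \<subseteq> I" and x: "\<And>i. i \<in> I - K \<Longrightarrow> x i = 0"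
  shows "distr (gauss_prod I) (gauss_prod I) (\<lambda>\<xi>. \<lambda>i\<in>I. x i + \<xi> i)
    = density (gauss_prod I) (\<lambda>\<xi>. \<Prod>k\<in>K. ennreal (exp (x k * \<xi> k - (x k)^2 / 2)))"
proof (rule measure_eqI_PiM_infinite[where I = I and M = "\<lambda>_. std_gauss"])
  let ?M = "gauss_prod I" and ?N = std_gauss
  interpret prob_space ?M by (rule prob_space_gauss_prod)
  let ?g = "\<lambda>\<xi> k. ennreal (exp (x k * \<xi> k - (x k)^2 / 2))"
  note shift = measurable_gauss_shift[of x I]
  show "finite_measure (distr ?M ?M (\<lambda>\<xi>. \<lambda>i\<in>I. x i + \<xi> i))"
    by (rule finite_measure_distr[OF shift])
  fix A :: "'i \<Rightarrow> real set" and J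
  assume J: "finite J" "J \<subseteq> I" and A': "\<And>i. i \<in> J \<Longrightarrow> A i \<in> sets ?N"
  \<comment> \<open>The cylinder over \<open>J\<close> is viewed as one over
    \<open>J \<union> K\<close> with the new coordinates unrestricted, so that every shifted
    coordinate contributes its density factor. Factors at indices outside \<open>K\<close> equal 1
    because \<open>x\<close> vanishes there.\<close>
  define B where "B i = (if i \<in> J then A i else UNIV)" for i
  have B: "B i \<in> sets borel" for i
    using A' by (auto simp: B_def)
  define C where "C = {\<xi> \<in> space ?M. \<forall>i\<in>J \<union> K. \<xi> i \<in> B i}"
  have C: "prod_emb I (\<lambda>_. ?N) J (Pi\<^sub>E J A) = C"
    using J by (auto simp: C_def B_def prod_emb_def space_PiM PiE_iff extensional_def)
  have JK: "finite (J \<union> K)" "J \<union> K \<subseteq> I"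
    using J K by auto
  have Cs: "C \<in> sets ?M"
    unfolding C[symmetric] using J A' by (intro sets_PiM_I) auto
  have "emeasure (distr ?M ?M (\<lambda>\<xi>. \<lambda>i\<in>I. x i + \<xi> i)) C
      = emeasure ?M {\<xi> \<in> space ?M. \<forall>i\<in>J \<union> K. \<xi> i \<in> {z. x i + z \<in> B i}}"
  proof (subst emeasure_distr[OF shift Cs], rule arg_cong[where f = "emeasure ?M"])
    show "(\<lambda>\<xi>. \<lambda>i\<in>I. x i + \<xi> i) -` C \<inter> space ?M = {\<xi> \<in> space ?M. \<forall>i\<in>J \<union> K. \<xi> i \<in> {z. x i + z \<in> B i}}"
      using JK(2) measurable_space[OF shift] unfolding C_def by (auto simp: subset_eq)
  qed
  also have "\<dots> = (\<Prod>i\<in>J \<union> K. emeasure ?N {z. x i + z \<in> B i})"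
  proof (rule emeasure_gauss_prod_Collect[OF JK])
    fix j
    have [measurable]: "B j \<in> sets borel" by (rule B)
    show "{z. x j + z \<in> B j} \<in> sets borel" by measurable
  qed
  also have "\<dots> = (\<Prod>i\<in>J \<union> K. \<integral>\<^sup>+z. ennreal (exp (x i * z - (x i)^2 / 2)) * indicator (B i) z \<partial>?N)"
    by (simp only: std_normal_shift[OF B])
  also have "\<dots> = (\<Prod>i\<in>J \<union> K. \<integral>\<^sup>+\<xi>. ?g \<xi> i * indicator (B i) (\<xi> i) \<partial>?M)"
    using JK(2) B
    by (intro prod.cong refl nn_integral_gauss_component[symmetric]
        borel_measurable_times borel_measurable_indicator) auto
  also have "\<dots> = (\<integral>\<^sup>+\<xi>. (\<Prod>i\<in>J \<union> K. ?g \<xi> i * indicator (B i) (\<xi> i)) \<partial>?M)"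
    by (rule indep_vars_nn_integral[symmetric, OF JK(1)
          indep_vars_gauss_fun[OF JK(2), where g = "\<lambda>i z. ennreal (exp (x i * z - (x i)^2 / 2)) * indicator (B i) z"]])
      (use B in auto)
  also have "\<dots> = (\<integral>\<^sup>+\<xi>. (\<Prod>k\<in>K. ?g \<xi> k) * indicator C \<xi> \<partial>?M)"
  proof (intro nn_integral_cong)
    fix \<xi> assume \<xi>: "\<xi> \<in> space ?M"
    have "(\<Prod>i\<in>J \<union> K. ?g \<xi> i) = (\<Prod>k\<in>K. ?g \<xi> k)"
      using JK K x by (intro prod.mono_neutral_right) auto
    moreover have "(\<Prod>i\<in>J \<union> K. indicator (B i) (\<xi> i)) = (indicator C \<xi> :: ennreal)"
    proof (cases "\<xi> \<in> C")
      case False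
      then obtain i where i: "i \<in> J \<union> K" "\<xi> i \<notin> B i" using \<xi> by (auto simp: C_def)
      then have "(\<Prod>i\<in>J \<union> K. indicator (B i) (\<xi> i)) = (0 :: ennreal)"
        by (intro prod_zero JK(1) bexI[OF _ i(1)]) (simp add: i(2))
      then show ?thesis using False by simp
    qed (simp add: C_def)
    ultimately show "(\<Prod>i\<in>J \<union> K. ?g \<xi> i * indicator (B i) (\<xi> i)) = (\<Prod>k\<in>K. ?g \<xi> k) * indicator C \<xi>"
      by (simp add: prod.distrib)
  qed
  also have "\<dots> = emeasure (density ?M (\<lambda>\<xi>. \<Prod>k\<in>K. ?g \<xi> k)) C"
  proof (rule emeasure_density[symmetric, OF _ Cs])
    have "(\<lambda>\<xi>. \<xi> k) \<in> borel_measurable ?M" if "k \<in> K" for k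
      using that K(2) by (intro measurable_gauss_component) auto
    then show "(\<lambda>\<xi>. \<Prod>k\<in>K. ?g \<xi> k) \<in> borel_measurable ?M" by measurable
  qed
  finally show "emeasure (distr ?M ?M (\<lambda>\<xi>. \<lambda>i\<in>I. x i + \<xi> i)) (prod_emb I (\<lambda>_. ?N) J (Pi\<^sub>E J A))
      = emeasure (density ?M (\<lambda>\<xi>. \<Prod>k\<in>K. ?g \<xi> k)) (prod_emb I (\<lambda>_. ?N) J (Pi\<^sub>E J A))"
    unfolding C .
qed simp_all

lemma
  fixes x :: "'i \<Rightarrow> real"
  assumes K: "finite K" "K \<subseteq> I" and x: "\<And>i. i \<in> I - K \<Longrightarrow> x i = 0" and A: "A \<in> sets (gauss_prod I)"
  shows measure_gauss_shift: "measure (gauss_prod I) {\<xi> \<in> space (gauss_prod I). (\<lambda>i\<in>I. x i + \<xi> i) \<in> A}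
      = (LINT \<xi>|gauss_prod I. indicator A \<xi> * (\<Prod>k\<in>K. exp (x k * \<xi> k - (x k)^2 / 2)))"
    and integrable_gauss_shift:
      "integrable (gauss_prod I) (\<lambda>\<xi>. indicator A \<xi> * (\<Prod>k\<in>K. exp (x k * \<xi> k - (x k)^2 / 2)))"
proof -
  let ?M = "gauss_prod I"
  interpret prob_space ?M by (rule prob_space_gauss_prod)
  note shift = measurable_gauss_shift[of x I]
  let ?L = "\<lambda>\<xi>. \<Prod>k\<in>K. exp (x k * \<xi> k - (x k)^2 / 2)"
  have comp: "(\<lambda>\<xi>. \<xi> k) \<in> borel_measurable ?M" if "k \<in> K" for k
    using that K(2) by (intro measurable_gauss_component) auto
  then have L: "?L \<in> borel_measurable ?M" by measurable
  have meas: "(\<lambda>\<xi>. indicator A \<xi> * ?L \<xi>) \<in> borel_measurable ?M"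
    using L A by measurable
  have "emeasure ?M {\<xi> \<in> space ?M. (\<lambda>i\<in>I. x i + \<xi> i) \<in> A} = emeasure (distr ?M ?M (\<lambda>\<xi>. \<lambda>i\<in>I. x i + \<xi> i)) A"
    by (subst emeasure_distr[OF shift A]) (auto intro!: arg_cong[where f = "emeasure ?M"])
  also have "\<dots> = emeasure (density ?M (\<lambda>\<xi>. ennreal (?L \<xi>))) A"
    using gauss_prod_Cameron_Martin[OF K x] by (simp add: prod_ennreal)
  also have "\<dots> = (\<integral>\<^sup>+\<xi>. ennreal (?L \<xi>) * indicator A \<xi> \<partial>?M)"
    using L A by (intro emeasure_density) auto
  also have "\<dots> = (\<integral>\<^sup>+\<xi>. ennreal (indicator A \<xi> * ?L \<xi>) \<partial>?M)"
    by (intro nn_integral_cong) (simp add: indicator_def)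
  finally have eq: "(\<integral>\<^sup>+\<xi>. ennreal (indicator A \<xi> * ?L \<xi>) \<partial>?M)
      = ennreal (measure ?M {\<xi> \<in> space ?M. (\<lambda>i\<in>I. x i + \<xi> i) \<in> A})"
    by (simp add: emeasure_eq_measure)
  have "has_bochner_integral ?M (\<lambda>\<xi>. indicator A \<xi> * ?L \<xi>)
      (measure ?M {\<xi> \<in> space ?M. (\<lambda>i\<in>I. x i + \<xi> i) \<in> A})"
    by (rule has_bochner_integral_nn_integral[OF meas _ _ eq]) (auto intro!: AE_I2 mult_nonneg_nonneg prod_nonneg)
  then show "measure ?M {\<xi> \<in> space ?M. (\<lambda>i\<in>I. x i + \<xi> i) \<in> A} = (LINT \<xi>|?M. indicator A \<xi> * ?L \<xi>)"
    and "integrable ?M (\<lambda>\<xi>. indicator A \<xi> * ?L \<xi>)"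
    by (auto simp: has_bochner_integral_iff)
qed

subsection \<open>Lower bound on the error of the second kind\<close>

text \<open>The Taylor polynomial of ln (cosh z) of order 4 is a global lower bound. Three
  integrations from 0 show it for z \<ge> 0: tanh x \<le> x, then tanh x \<ge> x - x^3 / 3 from
  tanh' = 1 - tanh^2, then the claim from (ln cosh)' = tanh. Negative z follow by evenness.\<close>

lemma cosh_ge_exp:
  fixes z :: real
  shows "exp (z^2 / 2 - z^4 / 12) \<le> cosh z"
proof -
  have *: "exp (y^2 / 2 - y^4 / 12) \<le> cosh y" if y: "0 \<le> y" for y :: real
  proof -
    have tanh_le: "tanh x \<le> x" if "0 \<le> x" for x :: real
    proof -
      have "0 - tanh 0 \<le> x - tanh x"
      proof (rule DERIV_nonneg_imp_nondecreasing[OF that])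
        fix z :: real
        have "((\<lambda>x. x - tanh x) has_real_derivative ((tanh z)^2)) (at z)"
          by (auto intro!: derivative_eq_intros)
        then show "\<exists>D. ((\<lambda>x. x - tanh x) has_real_derivative D) (at z) \<and> 0 \<le> D" by force
      qed
      then show ?thesis by simp
    qed
    have tanh_ge: "x - x^3 / 3 \<le> tanh x" if "0 \<le> x" for x :: real
    proof -
      have "tanh 0 - 0 + 0^3 / 3 \<le> tanh x - x + x^3 / 3"
      proof (rule DERIV_nonneg_imp_nondecreasing[OF that])
        fix z :: real assume z: "0 \<le> z"
        have "((\<lambda>x. tanh x - x + x^3 / 3) has_real_derivative (z^2) - (tanh z)^2) (at z)"
          by (auto intro!: derivative_eq_intros simp: power2_eq_square)
        moreover have "(tanh z)^2 \<le> z^2"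
          using z tanh_le[OF z] by (intro power_mono) auto
        ultimately show "\<exists>D. ((\<lambda>x. tanh x - x + x^3 / 3) has_real_derivative D) (at z) \<and> 0 \<le> D" by force
      qed
      then show ?thesis by simp
    qed
    have "ln (cosh 0) - 0^2 / 2 + 0^4 / 12 \<le> ln (cosh y) - y^2 / 2 + y^4 / (12 :: real)"
    proof (rule DERIV_nonneg_imp_nondecreasing[OF y])
      fix z :: real assume z: "0 \<le> z"
      have "((\<lambda>x. ln (cosh x) - x^2 / 2 + x^4 / 12) has_real_derivative tanh z - z + z^3 / 3) (at z)"
        by (auto intro!: derivative_eq_intros simp: tanh_def)
      then show "\<exists>D. ((\<lambda>x. ln (cosh x) - x^2 / 2 + x^4 / 12) has_real_derivative D) (at z) \<and> 0 \<le> D"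
        using tanh_ge[OF z] by force
    qed
    then have "y^2 / 2 - y^4 / 12 \<le> ln (cosh y)" by simp
    then show ?thesis by (metis cosh_real_pos exp_le_cancel_iff exp_ln)
  qed
  show ?thesis
    using *[of z] *[of "- z"] by (cases "0 \<le> z") auto
qed

text \<open>Layer-cake formula: the truncated difference is the length of the set of y between X and
  c, and the integrals are exchanged. The expectation thus depends on X only through its
  distribution function on \<open>{0..c}\<close>.\<close>

lemma nn_integral_max_0_diff:
  fixes X :: "'a \<Rightarrow> real"
  assumes "prob_space M" and X [measurable]: "X \<in> borel_measurable M" and nonneg: "\<And>\<omega>. 0 \<le> X \<omega>"
  shows "(\<integral>\<^sup>+\<omega>. ennreal (max 0 (c - X \<omega>)) \<partial>M)
    = (\<integral>\<^sup>+y. indicator {0..c} y * ennreal (measure M {\<omega> \<in> space M. X \<omega> \<le> y}) \<partial>lborel)"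
proof -
  interpret prob_space M by fact
  interpret pair_sigma_finite M lborel by standard
  have "(\<integral>\<^sup>+\<omega>. ennreal (max 0 (c - X \<omega>)) \<partial>M)
      = (\<integral>\<^sup>+\<omega>. (\<integral>\<^sup>+y. indicator {0..c} y * indicator {y. X \<omega> \<le> y} y \<partial>lborel) \<partial>M)"
  proof (rule nn_integral_cong)
    fix \<omega>
    have "(\<integral>\<^sup>+y. indicator {0..c} y * indicator {y. X \<omega> \<le> y} y \<partial>lborel) = (\<integral>\<^sup>+y. indicator {X \<omega>..c} y \<partial>lborel)"
      using nonneg[of \<omega>] by (intro nn_integral_cong) (auto simp: indicator_def)
    then show "ennreal (max 0 (c - X \<omega>)) = (\<integral>\<^sup>+y. indicator {0..c} y * indicator {y. X \<omega> \<le> y} y \<partial>lborel)"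
      by (cases "X \<omega> \<le> c") auto
  qed
  also have "\<dots> = (\<integral>\<^sup>+y. (\<integral>\<^sup>+\<omega>. indicator {0..c} y * indicator {y. X \<omega> \<le> y} y \<partial>M) \<partial>lborel)"
    by (rule Fubini'[symmetric]) measurable
  also have "\<dots> = (\<integral>\<^sup>+y. indicator {0..c} y * ennreal (measure M {\<omega> \<in> space M. X \<omega> \<le> y}) \<partial>lborel)"
  proof (rule nn_integral_cong)
    fix y
    have "(\<integral>\<^sup>+\<omega>. indicator {y. X \<omega> \<le> y} y \<partial>M) = (\<integral>\<^sup>+\<omega>. indicator {\<omega> \<in> space M. X \<omega> \<le> y} \<omega> \<partial>M)"
      by (intro nn_integral_cong) (auto simp: indicator_def)
    also have "\<dots> = ennreal (measure M {\<omega> \<in> space M. X \<omega> \<le> y})"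
      by (simp add: emeasure_eq_measure)
    finally show "(\<integral>\<^sup>+\<omega>. indicator {0..c} y * indicator {y. X \<omega> \<le> y} y \<partial>M)
        = indicator {0..c} y * ennreal (measure M {\<omega> \<in> space M. X \<omega> \<le> y})"
      by (subst nn_integral_cmult) auto
  qed
  finally show ?thesis .
qed

text \<open>A one-sided bound between distribution functions becomes a bound between expectations;
  the error is integrated over an interval of length c. In this form the normal approximation of T
  applies to the exponential of T, which is unbounded.\<close>

lemma integral_max_0_diff_le:
  fixes X :: "'a \<Rightarrow> real" and Y :: "'b \<Rightarrow> real"
  assumes M: "prob_space M" and N: "prob_space N"
    and X [measurable]: "X \<in> borel_measurable M" and Y [measurable]: "Y \<in> borel_measurable N"
    and nonneg: "\<And>\<omega>. 0 \<le> X \<omega>" "\<And>\<omega>. 0 \<le> Y \<omega>" and c: "0 \<le> c"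
    and le: "\<And>y. measure M {\<omega> \<in> space M. X \<omega> \<le> y} \<le> measure N {\<omega> \<in> space N. Y \<omega> \<le> y} + \<kappa>"
  shows "(LINT \<omega>|M. max 0 (c - X \<omega>)) \<le> (LINT \<omega>|N. max 0 (c - Y \<omega>)) + \<kappa> * c"
proof -
  interpret M: prob_space M by fact
  interpret N: prob_space N by fact
  \<comment> \<open>At y = -1 both probabilities are 0, which forces \<kappa> \<ge> 0.\<close>
  have "\<not> Y \<omega> \<le> - 1" for \<omega>
    using nonneg(2)[of \<omega>] by linarith
  then have "0 \<le> 0 + \<kappa>"
    using order_trans[OF measure_nonneg le[of "- 1"]] by simp
  then have \<kappa>: "0 \<le> \<kappa>" by simp
  have int: "integrable M (\<lambda>\<omega>. max 0 (c - X \<omega>))" "integrable N (\<lambda>\<omega>. max 0 (c - Y \<omega>))"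
    using nonneg c by (auto intro!: M.integrable_const_bound[where B = c] N.integrable_const_bound[where B = c])
  have "ennreal (LINT \<omega>|M. max 0 (c - X \<omega>)) = (\<integral>\<^sup>+y. indicator {0..c} y * ennreal (measure M {\<omega> \<in> space M. X \<omega> \<le> y}) \<partial>lborel)"
    unfolding nn_integral_max_0_diff[OF M X nonneg(1), symmetric]
    using int(1) by (intro nn_integral_eq_integral[symmetric]) auto
  also have "\<dots> \<le> (\<integral>\<^sup>+y. indicator {0..c} y * ennreal (measure N {\<omega> \<in> space N. Y \<omega> \<le> y}) + ennreal \<kappa> * indicator {0..c} y \<partial>lborel)"
    using le \<kappa> by (intro nn_integral_mono) (auto simp: indicator_def simp flip: ennreal_plus intro!: ennreal_leI)
  also have "\<dots> = (\<integral>\<^sup>+y. indicator {0..c} y * ennreal (measure N {\<omega> \<in> space N. Y \<omega> \<le> y}) \<partial>lborel) + ennreal \<kappa> * ennreal c"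
    using c by (subst nn_integral_add) (auto simp: nn_integral_cmult)
  also have "\<dots> = ennreal ((LINT \<omega>|N. max 0 (c - Y \<omega>)) + \<kappa> * c)"
  proof -
    have "(\<integral>\<^sup>+y. indicator {0..c} y * ennreal (measure N {\<omega> \<in> space N. Y \<omega> \<le> y}) \<partial>lborel)
        = ennreal (LINT \<omega>|N. max 0 (c - Y \<omega>))"
      unfolding nn_integral_max_0_diff[OF N Y nonneg(2), symmetric]
      using int(2) by (intro nn_integral_eq_integral) auto
    then show ?thesis
      using \<kappa> c by (simp add: ennreal_mult ennreal_plus integral_nonneg_AE)
  qed
  finally show ?thesis
    using \<kappa> c by (subst (asm) ennreal_le_iff) (auto intro!: add_nonneg_nonneg integral_nonneg_AE)
qed

lemma
  fixes u h :: real
  shows integrable_std_normal_exp_atMost: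
      "integrable std_gauss (\<lambda>z. indicator {..h} z * exp (u * z - u^2 / 2))"
    and integral_std_normal_exp_atMost:
      "(LINT z|std_gauss. indicator {..h} z * exp (u * z - u^2 / 2)) = Gauss_cdf (h - u)"
proof -
  have "(\<integral>\<^sup>+z. ennreal (indicator {..h} z * exp (u * z - u^2 / 2)) \<partial>std_gauss)
      = (\<integral>\<^sup>+z. ennreal (exp (u * z - u^2 / 2)) * indicator {..h} z \<partial>std_gauss)"
    by (intro nn_integral_cong) (simp add: indicator_def)
  also have "\<dots> = emeasure std_gauss {z. u + z \<in> {..h}}"
    by (rule std_normal_shift) simp
  also have "{z. u + z \<in> {..h}} = {..h - u}" by auto
  also have "emeasure std_gauss {..h - u} = ennreal (Gauss_cdf (h - u))"
    by (simp add: std_normal.emeasure_eq_measure Gauss_cdf_measure)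
  finally have eq: "(\<integral>\<^sup>+z. ennreal (indicator {..h} z * exp (u * z - u^2 / 2)) \<partial>std_gauss)
      = ennreal (Gauss_cdf (h - u))" .
  have "has_bochner_integral std_gauss (\<lambda>z. indicator {..h} z * exp (u * z - u^2 / 2)) (Gauss_cdf (h - u))"
    by (rule has_bochner_integral_nn_integral[OF _ _ _ eq]) (auto simp: Gauss_cdf_nonneg)
  then show "integrable std_gauss (\<lambda>z. indicator {..h} z * exp (u * z - u^2 / 2))"
    and "(LINT z|std_gauss. indicator {..h} z * exp (u * z - u^2 / 2)) = Gauss_cdf (h - u)"
    by (auto simp: has_bochner_integral_iff)
qed

text \<open>As c is the likelihood ratio at h and u > 0, the positive part lives on z \<le> h, the
  acceptance region of the Neyman-Pearson test with threshold h.\<close>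

lemma integral_std_normal_max_0_diff_exp:
  fixes u h :: real
  defines "c \<equiv> exp (u * h - u^2 / 2)"
  assumes "0 < u"
  shows "(LINT z|std_gauss. max 0 (c - exp (u * z - u^2 / 2))) = c * Gauss_cdf h - Gauss_cdf (h - u)"
proof -
  have "max 0 (c - exp (u * z - u^2 / 2)) = c * indicator {..h} z - indicator {..h} z * exp (u * z - u^2 / 2)" for z
    using \<open>0 < u\<close> by (auto simp: c_def indicator_def max_def)
  moreover have "integrable std_gauss (\<lambda>z. c * indicator {..h} z)"
    by (intro integrable_mult_right std_normal.integrable_const_bound[where B = 1]) auto
  ultimately show ?thesis
    using Bochner_Integration.integral_diff[OF _ integrable_std_normal_exp_atMost[of h u]]
    by (simp add: integral_std_normal_exp_atMost) (simp add: Gauss_cdf_measure)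
qed

text \<open>
  Under the uniform prior on the sign vectors the likelihood ratio is
  \<open>L = \<Prod>k\<in>K. exp (- ((x k)^2) / 2) * cosh (x k * \<xi> k)\<close>. Since \<open>ln (cosh z) \<ge> z^2 / 2 - z^4 / 12\<close>, it is at
  least \<open>exp (- \<eta>) * exp (u * T - u^2 / 2)\<close> outside an event of small probability,
  and the Neyman-Pearson bound for the latter only involves the distribution of \<open>T\<close>.
\<close>

lemma gauss_sign_prior_lower_bound:
  fixes I :: "'i set" and x :: "'i \<Rightarrow> real"
  defines "P \<equiv> \<lambda>Q. measure (gauss_prod I) {\<xi> \<in> space (gauss_prod I). Q \<xi>}"
  assumes K: "finite K" "K \<subseteq> I"
    and u: "0 < u" "(\<Sum>k\<in>K. (x k)^4) = 2 * u^2"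
    and m: "\<And>k. k \<in> K \<Longrightarrow> (x k)^2 / (2 * u) \<le> m"
    and \<eta>: "0 < \<eta>"
    and clt: "\<And>z. \<bar>P (\<lambda>\<xi>. (\<Sum>k\<in>K. (x k)^2 / (2 * u) * ((\<xi> k)^2 - 1)) \<le> z) - Gauss_cdf z\<bar> \<le> \<kappa>"
    and A: "A \<in> sets (gauss_prod I)" "Gauss_cdf h - \<eta>0 \<le> measure (gauss_prod I) A"
  obtains \<sigma> :: "'i \<Rightarrow> real" where "\<And>k. k \<in> K \<Longrightarrow> (\<sigma> k)^2 = 1"
    "exp (- \<eta>) * (Gauss_cdf (h - u) - exp (u * h - u^2 / 2) * (\<eta>0 + \<kappa> + 6 * u^4 * m^2 / \<eta>^2))
      \<le> P (\<lambda>\<xi>. (\<lambda>i\<in>I. (if i \<in> K then \<sigma> i * x i else 0) + \<xi> i) \<in> A)"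
proof -
  let ?M = "gauss_prod I"
  interpret prob_space ?M by (rule prob_space_gauss_prod)
  have comp [measurable]: "(\<lambda>\<xi>. \<xi> k) \<in> borel_measurable ?M" if "k \<in> K" for k
    using that K(2) by (intro measurable_gauss_component) auto
  note A(1) [measurable]
  define T where "T \<xi> = (\<Sum>k\<in>K. (x k)^2 / (2 * u) * ((\<xi> k)^2 - 1))" for \<xi> :: "'i \<Rightarrow> real"
  \<comment> \<open>The centred quartic term of the bound on ln cosh. Its removed mean, the sum of
    \<open>(x k)^4 / 4\<close>, is exactly the \<open>u^2 / 2\<close> of the Gaussian likelihood
    ratio.\<close>
  define E where "E \<xi> = (\<Sum>k\<in>K. (x k)^4 / 12 * ((\<xi> k)^4 - 3))" for \<xi> :: "'i \<Rightarrow> real"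
  define L where "L \<xi> = (\<Prod>k\<in>K. exp (- ((x k)^2) / 2) * cosh (x k * \<xi> k))" for \<xi> :: "'i \<Rightarrow> real"
  define G where "G = {\<xi> \<in> space ?M. \<not> \<eta> \<le> \<bar>E \<xi>\<bar>}"
  \<comment> \<open>The critical value of the likelihood ratio that corresponds to the threshold
    \<open>h\<close> for T.\<close>
  define c where "c = exp (u * h - u^2 / 2)"
  let ?L' = "\<lambda>\<xi>. exp (u * T \<xi> - u^2 / 2)"
  have meas [measurable]: "T \<in> borel_measurable ?M" "E \<in> borel_measurable ?M"
    unfolding T_def E_def by measurable
  have G [measurable]: "G \<in> sets ?M" unfolding G_def by measurable
  have c: "0 < c" by (simp add: c_def)

  have L_ge: "exp (- E \<xi>) * ?L' \<xi> \<le> L \<xi>" for \<xi>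
  proof -
    have uT: "u * T \<xi> = (\<Sum>k\<in>K. (x k)^2 / 2 * ((\<xi> k)^2 - 1))"
      using u(1) by (simp add: T_def sum_distrib_left)
    have "u^2 / 2 = (\<Sum>k\<in>K. (x k)^4 / 4)"
      using u(2) by (simp flip: sum_divide_distrib)
    then have "- E \<xi> + (u * T \<xi> - u^2 / 2)
        = (\<Sum>k\<in>K. - ((x k)^4 / 12 * ((\<xi> k)^4 - 3)) + ((x k)^2 / 2 * ((\<xi> k)^2 - 1) - (x k)^4 / 4))"
      unfolding uT E_def by (simp add: sum.distrib sum_subtractf sum_negf)
    also have "\<dots> = (\<Sum>k\<in>K. - ((x k)^2) / 2 + ((x k * \<xi> k)^2 / 2 - (x k * \<xi> k)^4 / 12))"
      by (intro sum.cong refl) (simp add: field_simps)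
    finally have "exp (- E \<xi>) * ?L' \<xi> = exp (\<Sum>k\<in>K. - ((x k)^2) / 2 + ((x k * \<xi> k)^2 / 2 - (x k * \<xi> k)^4 / 12))"
      by (simp flip: exp_add)
    also have "\<dots> = (\<Prod>k\<in>K. exp (- ((x k)^2) / 2) * exp ((x k * \<xi> k)^2 / 2 - (x k * \<xi> k)^4 / 12))"
      by (simp only: exp_sum[OF K(1)] exp_add)
    also have "\<dots> \<le> L \<xi>"
      unfolding L_def using cosh_ge_exp by (intro prod_mono) (auto intro!: mult_left_mono)
    finally show ?thesis .
  qed

  have bad: "1 - measure ?M G \<le> 6 * u^4 * m^2 / \<eta>^2"
  proof -
    have 4: "(z^4 - 3)^2 = z^8 - 6 * z^4 + 9" for z :: real
      by algebra
    \<comment> \<open>The variance of the fourth power is 105 - 9 = 96, and 96 / 144 = 2 /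
      3.\<close>
    have var: "(LINT z|std_gauss. (y / 12 * (z^4 - 3))^2) = 2 / 3 * y^2" for y :: real
      unfolding power_mult_distrib 4
      by (simp add: std_normal_moments power_divide)
    have "1 - measure ?M G = measure ?M (space ?M - G)"
      using prob_compl[OF G] by simp
    also have "space ?M - G = {\<xi> \<in> space ?M. \<eta> \<le> \<bar>\<Sum>k\<in>K. (x k)^4 / 12 * ((\<xi> k)^4 - 3)\<bar>}"
      by (auto simp: G_def E_def)
    also have "measure ?M \<dots> \<le> (\<Sum>k\<in>K. LINT z|std_gauss. ((x k)^4 / 12 * (z^4 - 3))^2) / \<eta>^2"
      using \<eta> unfolding power_mult_distrib
      by (intro gauss_sum_Chebyshev[where g = "\<lambda>k z. (x k)^4 / 12 * (z^4 - 3)", unfolded power_mult_distrib] K)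
        (auto simp: 4 std_normal_moments)
    also have "\<dots> = (\<Sum>k\<in>K. 2 / 3 * ((x k)^4)^2) / \<eta>^2"
      unfolding var ..
    also have "\<dots> \<le> (\<Sum>k\<in>K. 2 / 3 * ((2 * u * m)^2 * (x k)^4)) / \<eta>^2"
    proof (intro divide_right_mono sum_mono mult_left_mono)
      fix k assume "k \<in> K"
      then have "(x k)^2 \<le> 2 * u * m"
        using m[of k] u(1) by (simp add: field_simps)
      then have "((x k)^2)^2 \<le> (2 * u * m)^2"
        by (intro power_mono) auto
      then have "(x k)^4 * (x k)^4 \<le> (2 * u * m)^2 * (x k)^4"
        by (intro mult_right_mono) auto
      then show "((x k)^4)^2 \<le> (2 * u * m)^2 * (x k)^4"
        by (simp add: power2_eq_square)
    qed auto
    also have "\<dots> = 16 / 3 * u^4 * m^2 / \<eta>^2"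
    proof -
      have "(\<Sum>k\<in>K. 2 / 3 * ((2 * u * m)^2 * (x k)^4)) = 2 / 3 * ((2 * u * m)^2 * (2 * u^2))"
        by (simp only: u(2) flip: sum_distrib_left)
      also have "\<dots> = 16 / 3 * u^4 * m^2"
        by (simp add: power2_eq_square power4_eq_xxxx)
      finally show ?thesis by (simp only:)
    qed
    also have "\<dots> \<le> 6 * u^4 * m^2 / \<eta>^2"
      by (intro divide_right_mono mult_right_mono) auto
    finally show ?thesis .
  qed

  \<comment> \<open>As u > 0, the approximate likelihood ratio is increasing in T, so its sublevel
    sets are sublevel sets of T and the normal approximation applies to them directly.\<close>
  have trunc: "(LINT \<xi>|?M. max 0 (c - ?L' \<xi>)) \<le> c * Gauss_cdf h - Gauss_cdf (h - u) + \<kappa> * c"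
  proof -
    have "(LINT \<xi>|?M. max 0 (c - ?L' \<xi>)) \<le> (LINT z|std_gauss. max 0 (c - exp (u * z - u^2 / 2))) + \<kappa> * c"
    proof (rule integral_max_0_diff_le[OF prob_space_gauss_prod prob_space_std_normal])
      fix y
      have \<kappa>: "0 \<le> \<kappa>" using clt[of 0] by linarith
      show "prob {\<xi> \<in> space ?M. ?L' \<xi> \<le> y}
        \<le> measure std_gauss {z \<in> space std_gauss. exp (u * z - u^2 / 2) \<le> y} + \<kappa>"
      proof (cases "0 < y")
        case False
        then have "\<not> exp z \<le> y" for z
          using exp_gt_zero[of z] by linarith
        then show ?thesis using \<kappa> by simp
      next
        case True
        define q where "q = (ln y + u^2 / 2) / u"
        have iff: "exp (u * z - u^2 / 2) \<le> y \<longleftrightarrow> z \<le> q" for z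
        proof -
          have "exp (u * z - u^2 / 2) \<le> y \<longleftrightarrow> u * z - u^2 / 2 \<le> ln y"
            using True by (simp add: ln_ge_iff)
          also have "\<dots> \<longleftrightarrow> z \<le> q"
            using u(1) by (simp add: q_def field_simps)
          finally show ?thesis .
        qed
        have "prob {\<xi> \<in> space ?M. T \<xi> \<le> q} \<le> Gauss_cdf q + \<kappa>"
          using clt[of q] unfolding P_def T_def by linarith
        then show ?thesis
          unfolding iff by (simp add: Gauss_cdf_measure atMost_def)
      qed
    qed (use c in auto)
    also have "(LINT z|std_gauss. max 0 (c - exp (u * z - u^2 / 2))) = c * Gauss_cdf h - Gauss_cdf (h - u)"
      unfolding c_def by (rule integral_std_normal_max_0_diff_exp[OF u(1)])
    finally show ?thesis by simp
  qed

  \<comment> \<open>All sign vectors, extensional so that they form a finite set. The sum over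
    \<open>S\<close> of the products \<open>?f\<close> factors over the coordinates, and each factor
    is a hyperbolic cosine.\<close>
  define S :: "('i \<Rightarrow> real) set" where "S = (\<Pi>\<^sub>E k\<in>K. {-1, 1})"
  have S: "finite S" "S \<noteq> {}"
    unfolding S_def using K by (auto intro!: finite_PiE simp: PiE_eq_empty_iff)
  define B where "B \<sigma> = P (\<lambda>\<xi>. (\<lambda>i\<in>I. (if i \<in> K then \<sigma> i * x i else 0) + \<xi> i) \<in> A)" for \<sigma>
  let ?f = "\<lambda>\<sigma> \<xi>. \<Prod>k\<in>K. exp (\<sigma> k * x k * \<xi> k - (x k)^2 / 2)"
  have B: "B \<sigma> = (LINT \<xi>|?M. indicator A \<xi> * ?f \<sigma> \<xi>) \<and> integrable ?M (\<lambda>\<xi>. indicator A \<xi> * ?f \<sigma> \<xi>)"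
    if "\<sigma> \<in> S" for \<sigma>
  proof -
    have \<sigma>: "(\<sigma> k)^2 = 1" if "k \<in> K" for k
      using PiE_mem[OF \<open>\<sigma> \<in> S\<close>[unfolded S_def] that] by auto
    let ?y = "\<lambda>i. if i \<in> K then \<sigma> i * x i else 0"
    have "(\<Prod>k\<in>K. exp (?y k * \<xi> k - (?y k)^2 / 2)) = ?f \<sigma> \<xi>" for \<xi> :: "'i \<Rightarrow> real"
      using \<sigma> by (intro prod.cong refl) (simp add: power_mult_distrib)
    then show ?thesis
      using measure_gauss_shift[OF K _ A(1), of ?y] integrable_gauss_shift[OF K _ A(1), of ?y]
      unfolding B_def P_def by simp
  qed
  have sum_f: "(\<Sum>\<sigma>\<in>S. ?f \<sigma> \<xi>) = real (card S) * L \<xi>" for \<xi>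
  proof -
    have card: "real (card S) = (\<Prod>k\<in>K. 2)"
      unfolding S_def using K by (simp add: card_PiE)
    have "(\<Sum>\<sigma>\<in>S. ?f \<sigma> \<xi>) = (\<Prod>k\<in>K. \<Sum>s\<in>{-1, 1}. exp (s * x k * \<xi> k - (x k)^2 / 2))"
      unfolding S_def using K by (intro prod_sum_PiE[symmetric]) auto
    also have "\<dots> = (\<Prod>k\<in>K. 2 * (exp (- ((x k)^2) / 2) * cosh (x k * \<xi> k)))"
    proof (intro prod.cong refl)
      fix k
      have "exp (s * x k * \<xi> k - (x k)^2 / 2) = exp (- ((x k)^2) / 2) * exp (s * (x k * \<xi> k))" for s :: real
        by (simp flip: exp_add)
      then show "(\<Sum>s\<in>{-1, 1}. exp (s * x k * \<xi> k - (x k)^2 / 2)) = 2 * (exp (- ((x k)^2) / 2) * cosh (x k * \<xi> k))"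
        by (simp add: cosh_field_def distrib_left)
    qed
    also have "\<dots> = real (card S) * L \<xi>"
      unfolding card L_def by (simp add: prod.distrib)
    finally show ?thesis .
  qed
  have sum_B: "(\<Sum>\<sigma>\<in>S. B \<sigma>) = real (card S) * (LINT \<xi>|?M. indicator A \<xi> * L \<xi>)"
    and int_L: "integrable ?M (\<lambda>\<xi>. indicator A \<xi> * L \<xi>)"
  proof -
    have eq: "(\<Sum>\<sigma>\<in>S. indicator A \<xi> * ?f \<sigma> \<xi>) = real (card S) * (indicator A \<xi> * L \<xi>)" for \<xi>
      using sum_f[of \<xi>] by (simp flip: sum_distrib_left)
    have "integrable ?M (\<lambda>\<xi>. \<Sum>\<sigma>\<in>S. indicator A \<xi> * ?f \<sigma> \<xi>)"
      using B by (intro Bochner_Integration.integrable_sum) auto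
    then have "integrable ?M (\<lambda>\<xi>. real (card S) * (indicator A \<xi> * L \<xi>))"
      unfolding eq .
    then show "integrable ?M (\<lambda>\<xi>. indicator A \<xi> * L \<xi>)"
      using S by (simp add: card_gt_0_iff)
    have "(\<Sum>\<sigma>\<in>S. B \<sigma>) = (\<Sum>\<sigma>\<in>S. (LINT \<xi>|?M. indicator A \<xi> * ?f \<sigma> \<xi>))"
      using B by (intro sum.cong) auto
    also have "\<dots> = (LINT \<xi>|?M. (\<Sum>\<sigma>\<in>S. indicator A \<xi> * ?f \<sigma> \<xi>))"
      using B by (intro Bochner_Integration.integral_sum[symmetric]) auto
    finally show "(\<Sum>\<sigma>\<in>S. B \<sigma>) = real (card S) * (LINT \<xi>|?M. indicator A \<xi> * L \<xi>)"
      unfolding eq by simp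
  qed

  let ?R = "exp (- \<eta>) * (Gauss_cdf (h - u) - c * (\<eta>0 + \<kappa> + 6 * u^4 * m^2 / \<eta>^2))"
  have int_max: "integrable ?M (\<lambda>\<xi>. max 0 (c - ?L' \<xi>))"
    using c by (intro integrable_const_bound[where B = c]) auto
  have ind: "integrable ?M (\<lambda>\<xi>. c * indicator (A \<inter> G) \<xi>)"
    by (intro integrable_mult_right integrable_const_bound[where B = 1]) auto
  have "?R \<le> exp (- \<eta>) * (c * measure ?M (A \<inter> G) - (LINT \<xi>|?M. max 0 (c - ?L' \<xi>)))"
  proof (rule mult_left_mono)
    have "measure ?M A \<le> measure ?M ((A \<inter> G) \<union> (space ?M - G))"
      using sets.sets_into_space[OF A(1)] by (intro finite_measure_mono) auto
    also have "\<dots> \<le> measure ?M (A \<inter> G) + measure ?M (space ?M - G)"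
      by (rule measure_Un_le) auto
    also have "measure ?M (space ?M - G) = 1 - measure ?M G"
      using prob_compl[OF G] .
    finally have "Gauss_cdf h - (\<eta>0 + 6 * u^4 * m^2 / \<eta>^2) \<le> measure ?M (A \<inter> G)"
      using A(2) bad by linarith
    from mult_left_mono[OF this, of c] c
    show "Gauss_cdf (h - u) - c * (\<eta>0 + \<kappa> + 6 * u^4 * m^2 / \<eta>^2) \<le> c * measure ?M (A \<inter> G) - (LINT \<xi>|?M. max 0 (c - ?L' \<xi>))"
      using trunc by (simp add: algebra_simps)
  qed simp
  also have "\<dots> = (LINT \<xi>|?M. exp (- \<eta>) * (c * indicator (A \<inter> G) \<xi> - max 0 (c - ?L' \<xi>)))"
  proof -
    have "A \<inter> G \<subseteq> space ?M" by (auto simp: G_def)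
    then show ?thesis
      using Bochner_Integration.integral_diff[OF ind int_max] by (simp add: Int_absorb2)
  qed
  \<comment> \<open>Pointwise form of the Neyman-Pearson bound: on \<open>A \<inter> G\<close> the
    bracket is the minimum of c and \<open>?L'\<close>, which up to exp (- \<eta>) is at most
    \<open>L\<close>; elsewhere the left side is nonpositive.\<close>
  also have "\<dots> \<le> (LINT \<xi>|?M. indicator A \<xi> * L \<xi>)"
  proof (rule integral_mono)
    show "integrable ?M (\<lambda>\<xi>. exp (- \<eta>) * (c * indicator (A \<inter> G) \<xi> - max 0 (c - ?L' \<xi>)))"
      using int_max by (intro integrable_mult_right Bochner_Integration.integrable_diff ind)
    fix \<xi> assume "\<xi> \<in> space ?M"
    have L0: "0 \<le> L \<xi>" unfolding L_def by (intro prod_nonneg) auto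
    show "exp (- \<eta>) * (c * indicator (A \<inter> G) \<xi> - max 0 (c - ?L' \<xi>)) \<le> indicator A \<xi> * L \<xi>"
    proof (cases "\<xi> \<in> A \<inter> G")
      case True
      have "exp (- \<eta>) * (c - max 0 (c - ?L' \<xi>)) \<le> exp (- \<eta>) * ?L' \<xi>"
        by (intro mult_left_mono) auto
      also have "\<dots> \<le> exp (- E \<xi>) * ?L' \<xi>"
        using True by (intro mult_right_mono) (auto simp: G_def)
      also have "\<dots> \<le> L \<xi>" by (rule L_ge)
      finally show ?thesis using True by simp
    next
      case False
      have "exp (- \<eta>) * (c * indicator (A \<inter> G) \<xi> - max 0 (c - ?L' \<xi>)) \<le> 0"
        using False by (intro mult_nonneg_nonpos) auto
      also have "0 \<le> indicator A \<xi> * L \<xi>" using L0 by simp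
      finally show ?thesis .
    qed
  qed (rule int_L)
  finally have avg: "real (card S) * ?R \<le> (\<Sum>\<sigma>\<in>S. B \<sigma>)"
    unfolding sum_B by (intro mult_left_mono) auto
  have "\<exists>\<sigma>\<in>S. ?R \<le> B \<sigma>"
  proof (rule ccontr)
    assume "\<not> ?thesis"
    then have "(\<Sum>\<sigma>\<in>S. B \<sigma>) < (\<Sum>\<sigma>\<in>S. ?R)"
      using S by (intro sum_strict_mono) auto
    then show False using avg by simp
  qed
  then obtain \<sigma> where \<sigma>: "\<sigma> \<in> S" "?R \<le> B \<sigma>" by blast
  show ?thesis
  proof (rule that)
    show "(\<sigma> k)^2 = 1" if "k \<in> K" for k
      using PiE_mem[OF \<sigma>(1)[unfolded S_def] that] by auto
    show "exp (- \<eta>) * (Gauss_cdf (h - u) - exp (u * h - u^2 / 2) * (\<eta>0 + \<kappa> + 6 * u^4 * m^2 / \<eta>^2))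
      \<le> P (\<lambda>\<xi>. (\<lambda>i\<in>I. (if i \<in> K then \<sigma> i * x i else 0) + \<xi> i) \<in> A)"
      using \<sigma>(2) unfolding B_def c_def .
  qed
qed

subsection \<open>Counting multi-indices\<close>

lemma sum_powr_upper_bound:
  fixes p Y :: real
  assumes "finite U" "\<And>n. n \<in> U \<Longrightarrow> 1 \<le> n \<and> real n \<le> Y" "0 \<le> p" "0 < Y"
  shows "(\<Sum>n\<in>U. real n powr p) \<le> Y powr (1 + p)"
proof -
  have "U \<subseteq> {1..nat \<lfloor>Y\<rfloor>}"
    using assms(2) by (auto simp: le_nat_floor)
  then have "card U \<le> nat \<lfloor>Y\<rfloor>"
    using card_mono[of "{1..nat \<lfloor>Y\<rfloor>}" U] by simp
  then have card: "real (card U) \<le> Y"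
    using assms(4) by linarith
  have "(\<Sum>n\<in>U. real n powr p) \<le> (\<Sum>n\<in>U. Y powr p)"
    using assms by (intro sum_mono powr_mono2) auto
  also have "\<dots> \<le> Y * Y powr p"
    using card by (simp add: mult_right_mono)
  finally show ?thesis
    using assms(4) by (simp add: powr_add)
qed

text \<open>The upper half of the range suffices: it has at least X / 4 integers, each at least X /
  4.\<close>

lemma sum_powr_lower_bound:
  fixes p X :: real
  assumes "1 \<le> X" "0 \<le> p"
  shows "(X / 4) powr (1 + p) \<le> (\<Sum>n\<in>{1..nat \<lfloor>X\<rfloor>}. real n powr p)"
proof -
  define n where "n = nat \<lfloor>X\<rfloor>"
  have n: "X / 2 \<le> real n" "1 \<le> n"
  proof -
    have "1 \<le> \<lfloor>X\<rfloor>" using assms(1) by simp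
    then show "X / 2 \<le> real n" "1 \<le> n"
      unfolding n_def by linarith+
  qed
  have "(X / 4) powr (1 + p) = X / 4 * (X / 4) powr p"
    using assms by (simp add: powr_add)
  also have "\<dots> \<le> real (n + 1 - (n + 1) div 2) * (X / 4) powr p"
  proof (rule mult_right_mono)
    have "n \<le> 2 * (n + 1 - (n + 1) div 2)" by linarith
    then have "real n \<le> 2 * real (n + 1 - (n + 1) div 2)"
      by (metis of_nat_le_iff of_nat_mult of_nat_numeral)
    then show "X / 4 \<le> real (n + 1 - (n + 1) div 2)"
      using n by linarith
  qed simp
  also have "\<dots> = (\<Sum>k\<in>{(n + 1) div 2..n}. (X / 4) powr p)"
    by simp
  also have "\<dots> \<le> (\<Sum>k\<in>{(n + 1) div 2..n}. real k powr p)"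
  proof (intro sum_mono powr_mono2)
    fix k assume "k \<in> {(n + 1) div 2..n}"
    then have "n \<le> 2 * k" by auto
    then have "real n \<le> 2 * real k"
      by (metis of_nat_le_iff of_nat_mult of_nat_numeral)
    then show "X / 4 \<le> real k" using n by linarith
  qed (use assms in auto)
  also have "\<dots> \<le> (\<Sum>k\<in>{1..n}. real k powr p)"
    using n by (intro sum_mono2) auto
  finally show ?thesis unfolding n_def .
qed

section \<open>Level sets of the product weights and their order of growth\<close>

locale tensor_weights =
  fixes d :: nat and t s c :: "nat \<Rightarrow> real" and b a :: "idx \<Rightarrow> real"
  assumes d: "1 \<le> d"
    and t: "\<And>j. j \<in> {1..d} \<Longrightarrow> 0 \<le> t j"
    and s: "\<And>j. j \<in> {1..d} \<Longrightarrow> 0 < s j"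
    and b: "\<And>l. l \<in> multi_idx d \<Longrightarrow> (b l)^2 = (\<Prod>j=1..d. real (l j) powr (- 2 * t j))"
    and a: "\<And>l. l \<in> multi_idx d \<Longrightarrow> (a l)^2 = (\<Prod>j=1..d. real (l j) powr (2 * s j))"
    and c: "\<And>j. j \<in> {1..d} \<Longrightarrow> c j = (1 + 4 * t j) / s j"
    and c_ordered: "\<And>i j. i \<in> {1..d} \<Longrightarrow> j \<in> {1..d} \<Longrightarrow> i < j \<Longrightarrow> c j < c i"
begin

abbreviation I :: "idx set" where "I \<equiv> multi_idx d"

abbreviation "alt \<equiv> alternative d a"
abbreviation "quart \<equiv> quartic d b"
abbreviation "err1 \<equiv> type1_err d b"
abbreviation "err2 \<equiv> type2_err d b"
abbreviation "minimax \<equiv> minimax_err d b"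
abbreviation "optimum \<equiv> extremal_value d b a"
abbreviation "solution \<equiv> extremal_solution d b a"
abbreviation "fcoeff \<equiv> filter_coeff d b a"
abbreviation "stat \<equiv> test_stat d b a"
abbreviation "ftest \<equiv> filter_test d b a"

lemma idx_ge_1: "l \<in> I \<Longrightarrow> j \<in> {1..d} \<Longrightarrow> 1 \<le> real (l j)"
  using PiE_mem[of l "{1..d}" "\<lambda>_. {1..}" j] by (simp add: multi_idx_def)

lemma c1_pos: "0 < c 1"
  using c[of 1] s[of 1] t[of 1] d by simp

lemma a2_ge_component:
  assumes "l \<in> I" "j \<in> {1..d}"
  shows "real (l j) powr (2 * s j) \<le> (a l)^2"
proof -
  have ge1: "1 \<le> real (l i) powr (2 * s i)" if "i \<in> {1..d}" for i
    using idx_ge_1[OF assms(1) that] s[OF that] by (simp add: ge_one_powr_ge_zero)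
  have "(a l)^2 = real (l j) powr (2 * s j) * (\<Prod>i\<in>{1..d} - {j}. real (l i) powr (2 * s i))"
    using a[OF assms(1)] assms(2) by (simp add: prod.remove)
  moreover have "1 \<le> (\<Prod>i\<in>{1..d} - {j}. real (l i) powr (2 * s i))"
    using ge1 by (intro prod_ge_1) auto
  ultimately show ?thesis
    using mult_left_mono[of 1 "\<Prod>i\<in>{1..d} - {j}. real (l i) powr (2 * s i)" "real (l j) powr (2 * s j)"] by simp
qed

lemma b2_pos: "l \<in> I \<Longrightarrow> 0 < (b l)^2"
  unfolding b by (intro prod_pos) (use idx_ge_1[of l] in fastforce)

lemma b_nonzero: "l \<in> I \<Longrightarrow> b l \<noteq> 0"
  using b2_pos by fastforce

lemma b2_le_1: "l \<in> I \<Longrightarrow> (b l)^2 \<le> 1"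
  unfolding b 
proof (intro prod_le_1 conjI)
  fix j assume l: "l \<in> I" and j: "j \<in> {1..d}"
  show "real (l j) powr (- 2 * t j) \<le> 1"
    using powr_mono[of "- 2 * t j" 0 "real (l j)"] idx_ge_1[OF l j] t[OF j] by simp
qed simp

lemma inverse_b4:
  assumes "l \<in> I"
  shows "1 / (b l)^4 = (\<Prod>j=1..d. real (l j) powr (4 * t j))"
proof -
  have "(b l)^4 = ((b l)^2)^2" by simp
  also have "\<dots> = (\<Prod>j=1..d. (real (l j) powr (- 2 * t j))^2)"
    unfolding b[OF assms] by (rule prod_power_distrib)
  also have "\<dots> = (\<Prod>j=1..d. 1 / real (l j) powr (4 * t j))"
    by (intro prod.cong refl) (simp add: power2_eq_square powr_minus_divide flip: powr_add)
  finally show ?thesis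
    by (simp add: prod_dividef)
qed

text \<open>All factors of (a l)^2 are at least 1, so a bound on the product bounds every
  coordinate. This is the source of the finite support of the extremal solution.\<close>

lemma finite_level: "finite {l \<in> I. (a l)^2 \<le> x}"
proof -
  have range: "l j \<in> {1..nat \<lfloor>x powr (1 / (2 * s j))\<rfloor>}" if "l \<in> I" "(a l)^2 \<le> x" "j \<in> {1..d}" for l j
  proof -
    have sj: "0 < s j" using s that by blast
    have l1: "1 \<le> real (l j)" using idx_ge_1 that by blast
    have "real (l j) powr (2 * s j) \<le> x"
      using a2_ge_component[OF that(1,3)] that(2) by linarith
    then have "(real (l j) powr (2 * s j)) powr (1 / (2 * s j)) \<le> x powr (1 / (2 * s j))"
      using sj by (intro powr_mono2) auto
    then have "real (l j) \<le> x powr (1 / (2 * s j))"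
      using sj l1 by (simp add: powr_powr)
    then show ?thesis
      using l1 by (simp add: le_nat_floor)
  qed
  have "{l \<in> I. (a l)^2 \<le> x} \<subseteq> (\<Pi>\<^sub>E j\<in>{1..d}. {1..nat \<lfloor>x powr (1 / (2 * s j))\<rfloor>})"
  proof
    fix l assume "l \<in> {l \<in> I. (a l)^2 \<le> x}"
    then have l: "l \<in> I" "(a l)^2 \<le> x" by auto
    show "l \<in> (\<Pi>\<^sub>E j\<in>{1..d}. {1..nat \<lfloor>x powr (1 / (2 * s j))\<rfloor>})"
    proof (rule PiE_I)
      fix j assume j: "j \<in> {1..d}"
      show "l j \<in> {1..nat \<lfloor>x powr (1 / (2 * s j))\<rfloor>}" by (rule range[OF l j])
    next
      fix j assume "j \<notin> {1..d}"
      then show "l j = undefined"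
        using PiE_arb l(1) unfolding multi_idx_def by metis
    qed
  qed
  then show ?thesis
    by (rule finite_subset) (simp add: finite_PiE)
qed

text \<open>The effective dimension of the problem: by Cauchy-Schwarz, it links the energy of a
  sequence on a level set to its quartic form.\<close>

definition level_sum :: "real \<Rightarrow> real" where
  "level_sum x = (\<Sum>l\<in>{l \<in> I. (a l)^2 \<le> x}. 1 / (b l)^4)"

text \<open>The multi-indices on the first coordinate axis. As \<open>c 1\<close> is the largest
  exponent, they alone attain the order of \<open>level_sum\<close>.\<close>

definition axis :: "nat \<Rightarrow> idx" where
  "axis n = (\<lambda>j\<in>{1..d}. if j = 1 then n else 1)"

lemma axis_in_I: "1 \<le> n \<Longrightarrow> axis n \<in> I"
  by (simp add: axis_def multi_idx_def PiE_iff)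

lemma prod_axis: "1 \<le> n \<Longrightarrow> (\<Prod>j=1..d. real (axis n j) powr p j) = real n powr p 1"
  using d by (subst prod.remove[of _ 1]) (auto simp: axis_def intro!: prod.neutral)

lemma a2_axis: "1 \<le> n \<Longrightarrow> (a (axis n))^2 = real n powr (2 * s 1)"
  using a[OF axis_in_I] prod_axis by simp

lemma level_sum_lower:
  obtains k where "0 < k" "\<And>x. 1 \<le> x \<Longrightarrow> k * x powr (c 1 / 2) \<le> level_sum x"
proof
  have s1: "0 < s 1" and t1: "0 \<le> t 1" and c1: "c 1 = (1 + 4 * t 1) / s 1"
    using s t c d by auto
  show "0 < (1 / 4 :: real) powr (1 + 4 * t 1)" by simp
  fix x :: real assume x: "1 \<le> x"
  define X where "X = x powr (1 / (2 * s 1))"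
  have X: "1 \<le> X" unfolding X_def using x s1 by (intro ge_one_powr_ge_zero) auto
  have "X powr (1 + 4 * t 1) = x powr (c 1 / 2)"
    unfolding X_def c1 by (simp add: powr_powr mult.commute)
  then have "(1 / 4) powr (1 + 4 * t 1) * x powr (c 1 / 2) = (X / 4) powr (1 + 4 * t 1)"
    using X by (simp add: powr_divide)
  also have "\<dots> \<le> (\<Sum>n\<in>{1..nat \<lfloor>X\<rfloor>}. real n powr (4 * t 1))"
    using X t1 by (intro sum_powr_lower_bound) auto
  also have "\<dots> = (\<Sum>n\<in>{1..nat \<lfloor>X\<rfloor>}. 1 / (b (axis n))^4)"
  proof (rule sum.cong[OF refl])
    fix n assume "n \<in> {1..nat \<lfloor>X\<rfloor>}"
    then have n: "1 \<le> n" by simp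
    show "real n powr (4 * t 1) = 1 / (b (axis n))^4"
      unfolding inverse_b4[OF axis_in_I[OF n]] using prod_axis[OF n, of "\<lambda>j. 4 * t j"] ..
  qed
  also have "\<dots> = (\<Sum>l\<in>axis ` {1..nat \<lfloor>X\<rfloor>}. 1 / (b l)^4)"
  proof -
    have "inj_on axis {1..nat \<lfloor>X\<rfloor>}"
    proof
      fix m n assume "axis m = axis n"
      then have "axis m 1 = axis n 1" by simp
      then show "m = n" using d by (simp add: axis_def)
    qed
    then show ?thesis by (simp add: sum.reindex)
  qed
  also have "\<dots> \<le> level_sum x"
    unfolding level_sum_def
  proof (rule sum_mono2[OF finite_level])
    show "axis ` {1..nat \<lfloor>X\<rfloor>} \<subseteq> {l \<in> I. (a l)^2 \<le> x}"
    proof safe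
      fix n assume n: "n \<in> {1..nat \<lfloor>X\<rfloor>}"
      then show "axis n \<in> I" by (simp add: axis_in_I)
      have "real n \<le> X" using n X by (simp add: le_nat_iff le_floor_iff)
      then have "real n powr (2 * s 1) \<le> X powr (2 * s 1)" using s1 by (intro powr_mono2) auto
      then show "(a (axis n))^2 \<le> x"
        using n s1 x by (simp add: a2_axis X_def powr_powr)
    qed
  qed auto
  finally show "(1 / 4) powr (1 + 4 * t 1) * x powr (c 1 / 2) \<le> level_sum x" .
qed

text \<open>Sum over the first coordinate first. With the other coordinates fixed at
  \<open>g\<close>, the bound on (a l)^2 limits it to (x / q) powr (1 / (2 * s 1)), and its sum is
  at most (x / q) powr (c 1 / 2). What is left is a product of series with exponents
  \<open>e j = 4 * t j - s j * c 1\<close>, and e j < -1 says exactly that c j < c 1. Equality would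
  give harmonic series and hence logarithms.\<close>

lemma level_sum_upper:
  obtains k where "0 < k" "\<And>x. 1 \<le> x \<Longrightarrow> level_sum x \<le> k * x powr (c 1 / 2)"
proof
  have s1: "0 < s 1" and t1: "0 \<le> t 1" and c1: "c 1 = (1 + 4 * t 1) / s 1"
    using s t c d by auto
  define J where "J = {2..d}"
  have J: "finite J" "J \<subseteq> {1..d}" "1 \<notin> J" "{1..d} = insert 1 J"
    using d by (auto simp: J_def)
  define e where "e j = 4 * t j - s j * c 1" for j
  have e: "e j < - 1" if "j \<in> J" for j
  proof -
    have j: "j \<in> {1..d}" "1 < j" using that by (auto simp: J_def)
    have "(1 + 4 * t j) / s j < c 1" using c_ordered[of 1 j] c[of j] j d by auto
    then show ?thesis using s[OF j(1)] by (simp add: e_def field_simps)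
  qed
  define Z where "Z j = (\<Sum>n. real n powr e j)" for j
  have summ: "summable (\<lambda>n. real n powr e j)" if "j \<in> J" for j
    using e[OF that] by (simp add: summable_real_powr_iff)
  have Z: "(\<Sum>n\<in>U. real n powr e j) \<le> Z j" if "j \<in> J" "finite U" for j U
    unfolding Z_def using summ[OF that(1)] that(2) by (intro sum_le_suminf) auto
  have Z_ge1: "1 \<le> Z j" if "j \<in> J" for j
    using Z[OF that, of "{1}"] by simp
  show "0 < (\<Prod>j\<in>J. Z j)"
    using Z_ge1 by (intro prod_pos) fastforce
  fix x :: real assume x: "1 \<le> x"
  define S where "S = {l \<in> I. (a l)^2 \<le> x}"
  have S: "finite S" unfolding S_def by (rule finite_level)
  define r where "r l = restrict l J" for l :: idx
  \<comment> \<open>A finite box that contains the tails \<open>r l\<close> of all indices of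
    \<open>S\<close>. Summing over the whole box lets the sum factor; empty fibres contribute
    0.\<close>
  define V where "V j = (\<lambda>l. l j) ` S" for j
  have V: "finite (V j)" for j using S by (simp add: V_def)
  have rS: "r ` S \<subseteq> (\<Pi>\<^sub>E j\<in>J. V j)"
    by (auto simp: r_def V_def)
  have fibre: "(\<Sum>l\<in>{l \<in> S. r l = g}. 1 / (b l)^4) \<le> x powr (c 1 / 2) * (\<Prod>j\<in>J. real (g j) powr e j)"
    if g: "g \<in> (\<Pi>\<^sub>E j\<in>J. V j)" for g
  proof -
    have gpos: "0 < real (g j)" if j: "j \<in> J" for j
    proof -
      obtain l where "l \<in> S" "g j = l j" using PiE_mem[OF g j] by (auto simp: V_def)
      then show ?thesis using idx_ge_1[of l j] j J(2) by (force simp: S_def)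
    qed
    define q where "q = (\<Prod>j\<in>J. real (g j) powr (2 * s j))"
    have q: "0 < q" unfolding q_def using gpos by (intro prod_pos) auto
    define Y where "Y = (x / q) powr (1 / (2 * s 1))"
    have Y: "0 < Y" using x q by (simp add: Y_def)
    have Yp: "Y powr (1 + 4 * t 1) = (x / q) powr (c 1 / 2)"
      unfolding Y_def c1 by (simp add: powr_powr mult.commute)
    have gj: "l j = g j" if "r l = g" "j \<in> J" for l j
      using that by (auto simp: r_def)
    have "(\<Sum>l\<in>{l \<in> S. r l = g}. 1 / (b l)^4)
        = (\<Sum>l\<in>{l \<in> S. r l = g}. (\<Prod>j\<in>J. real (g j) powr (4 * t j)) * real (l 1) powr (4 * t 1))"
    proof (rule sum.cong[OF refl])
      fix l assume l: "l \<in> {l \<in> S. r l = g}"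
      then show "1 / (b l)^4 = (\<Prod>j\<in>J. real (g j) powr (4 * t j)) * real (l 1) powr (4 * t 1)"
        using inverse_b4[of l] J(1,3) gj[of l] unfolding J(4) by (simp add: S_def)
    qed
    also have "\<dots> = (\<Prod>j\<in>J. real (g j) powr (4 * t j)) * (\<Sum>l\<in>{l \<in> S. r l = g}. real (l 1) powr (4 * t 1))"
      by (simp add: sum_distrib_left)
    also have "(\<Sum>l\<in>{l \<in> S. r l = g}. real (l 1) powr (4 * t 1))
        = (\<Sum>n\<in>(\<lambda>l. l 1) ` {l \<in> S. r l = g}. real n powr (4 * t 1))"
    proof -
      have "inj_on (\<lambda>l. l 1) {l \<in> S. r l = g}"
      proof
        fix l l' assume l: "l \<in> {l \<in> S. r l = g}" "l' \<in> {l \<in> S. r l = g}" "l 1 = l' 1"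
        show "l = l'"
        proof (rule PiE_ext)
          show "l \<in> (\<Pi>\<^sub>E j\<in>{1..d}. {1..})" "l' \<in> (\<Pi>\<^sub>E j\<in>{1..d}. {1..})"
            using l by (auto simp: S_def multi_idx_def)
          fix j assume "j \<in> {1..d}"
          then show "l j = l' j" using l gj[of l j] gj[of l' j] unfolding J(4) by auto
        qed
      qed
      then show ?thesis by (simp add: sum.reindex)
    qed
    also have "\<dots> \<le> Y powr (1 + 4 * t 1)"
    proof (rule sum_powr_upper_bound)
      fix n assume "n \<in> (\<lambda>l. l 1) ` {l \<in> S. r l = g}"
      then obtain l where l: "l \<in> S" "r l = g" "n = l 1" by auto
      have n1: "1 \<le> real n" using idx_ge_1[of l 1] l d by (simp add: S_def)
      have "(a l)^2 = real n powr (2 * s 1) * q"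
        using a[of l] l gj[of l] J(1,3) unfolding J(4) q_def by (simp add: S_def)
      then have "real n powr (2 * s 1) \<le> x / q"
        using l(1) q by (simp add: S_def field_simps)
      then have "(real n powr (2 * s 1)) powr (1 / (2 * s 1)) \<le> Y"
        unfolding Y_def using s1 by (intro powr_mono2) auto
      then show "1 \<le> n \<and> real n \<le> Y"
        using n1 s1 by (simp add: powr_powr)
    qed (use S Y t1 in auto)
    also have "Y powr (1 + 4 * t 1) = x powr (c 1 / 2) * (\<Prod>j\<in>J. real (g j) powr (- s j * c 1))"
    proof -
      have "q powr (c 1 / 2) = (\<Prod>j\<in>J. (real (g j) powr (2 * s j)) powr (c 1 / 2))"
        unfolding q_def by (rule prod_powr_distrib)
      also have "\<dots> = (\<Prod>j\<in>J. 1 / real (g j) powr (- s j * c 1))"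
        by (intro prod.cong refl) (simp add: powr_powr powr_minus_divide)
      finally have q': "q powr (c 1 / 2) = 1 / (\<Prod>j\<in>J. real (g j) powr (- s j * c 1))"
        by (simp add: prod_dividef)
      have "Y powr (1 + 4 * t 1) = x powr (c 1 / 2) / q powr (c 1 / 2)"
        unfolding Yp using x q by (simp add: powr_divide)
      then show ?thesis
        unfolding q' by simp
    qed
    also have "(\<Prod>j\<in>J. real (g j) powr (4 * t j)) * (x powr (c 1 / 2) * (\<Prod>j\<in>J. real (g j) powr (- s j * c 1)))
        = x powr (c 1 / 2) * (\<Prod>j\<in>J. real (g j) powr e j)"
      by (simp add: e_def prod.distrib[symmetric] powr_add[symmetric] mult.left_commute)
    finally show ?thesis
      by (simp add: mult_left_mono prod_nonneg)
  qed
  have "level_sum x = (\<Sum>g\<in>(\<Pi>\<^sub>E j\<in>J. V j). \<Sum>l\<in>{l \<in> S. r l = g}. 1 / (b l)^4)"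
    unfolding level_sum_def S_def[symmetric]
    using S V J(1) rS by (intro sum.group[symmetric] finite_PiE) auto
  also have "\<dots> \<le> (\<Sum>g\<in>(\<Pi>\<^sub>E j\<in>J. V j). x powr (c 1 / 2) * (\<Prod>j\<in>J. real (g j) powr e j))"
    by (rule sum_mono[OF fibre])
  also have "\<dots> = x powr (c 1 / 2) * (\<Prod>j\<in>J. \<Sum>n\<in>V j. real n powr e j)"
    using V J(1) by (subst prod_sum_PiE) (auto simp: sum_distrib_left)
  also have "\<dots> \<le> x powr (c 1 / 2) * (\<Prod>j\<in>J. Z j)"
    using Z V by (intro mult_left_mono prod_mono) (auto intro: sum_nonneg)
  finally show "level_sum x \<le> (\<Prod>j\<in>J. Z j) * x powr (c 1 / 2)"
    by (simp add: mult.commute)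
qed

text \<open>\<open>\<tau>\<close> is the largest ratio t j / s j, attained at some j, and there c j
  = 1 / s j + 4 * \<tau>. The gap between 4 * \<tau> and c 1 makes every single filter coefficient
  negligible.\<close>

lemma inverse_b2_le_a2_powr:
  obtains \<tau> where "0 \<le> \<tau>" "4 * \<tau> < c 1" "\<And>l. l \<in> I \<Longrightarrow> 1 / (b l)^2 \<le> ((a l)^2) powr \<tau>"
proof
  define \<tau> where "\<tau> = Max ((\<lambda>j. t j / s j) ` {1..d})"
  have le: "t j / s j \<le> \<tau>" if "j \<in> {1..d}" for j
    unfolding \<tau>_def using that by (intro Max_ge) auto
  show "0 \<le> \<tau>"
    using le[of 1] t[of 1] s[of 1] d by (auto intro: order_trans[OF divide_nonneg_pos])
  have "\<tau> \<in> (\<lambda>j. t j / s j) ` {1..d}"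
    unfolding \<tau>_def using d by (intro Max_in) auto
  then obtain j where j: "j \<in> {1..d}" "\<tau> = t j / s j" by auto
  have "4 * \<tau> < c j"
    using j s[OF j(1)] c[OF j(1)] by (simp add: divide_strict_right_mono)
  also have "c j \<le> c 1"
    using c_ordered[of 1 j] j(1) d by (cases "j = 1") auto
  finally show "4 * \<tau> < c 1" .
  fix l assume l: "l \<in> I"
  have "1 / (b l)^2 = (\<Prod>j=1..d. 1 / real (l j) powr (- 2 * t j))"
    unfolding b[OF l] by (simp add: prod_dividef)
  also have "\<dots> = (\<Prod>j=1..d. real (l j) powr (2 * t j))"
    by (intro prod.cong refl) (simp add: powr_minus_divide)
  also have "\<dots> \<le> (\<Prod>j=1..d. (real (l j) powr (2 * s j)) powr \<tau>)"
  proof (intro prod_mono conjI)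
    fix j assume j: "j \<in> {1..d}"
    have "t j \<le> s j * \<tau>" using le[OF j] s[OF j] by (simp add: field_simps)
    then show "real (l j) powr (2 * t j) \<le> (real (l j) powr (2 * s j)) powr \<tau>"
      using idx_ge_1[OF l j] by (simp add: powr_powr powr_mono)
  qed simp
  also have "\<dots> = ((a l)^2) powr \<tau>"
    unfolding a[OF l] by (rule prod_powr_distrib[symmetric])
  finally show "1 / (b l)^2 \<le> ((a l)^2) powr \<tau>" .
qed

end

subsection \<open>The extremal problem\<close>

lemma
  fixes f :: "'a \<Rightarrow> real"
  assumes "finite E" "E \<subseteq> S" "\<And>k. k \<in> S - E \<Longrightarrow> f k = 0"
  shows infsum_finite_support: "infsum f S = sum f E"
    and summable_on_finite_support: "f summable_on S"
proof -
  have "(f has_sum sum f E) S"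
    by (rule has_sum_finite_neutralI[OF assms(1,2,3)]) simp_all
  then show "infsum f S = sum f E" "f summable_on S"
    by (auto simp: infsumI summable_on_def)
qed

lemma
  fixes f :: "'a \<Rightarrow> real"
  assumes "f summable_on S"
  shows summable_on_divide_const: "(\<lambda>x. f x / c) summable_on S"
    and infsum_divide_const: "(\<Sum>\<^sub>\<infinity>x\<in>S. f x / c) = infsum f S / c"
  using has_sum_divide_const[OF has_sum_infsum[OF assms], of c]
  by (auto simp: infsumI summable_on_def)

lemma square_ratio_powr:
  fixes R r e :: real
  assumes "0 < R" "0 < r"
  shows "(R^2 / r^2) powr e = R powr (2 * e) * r powr (- 2 * e)"
proof -
  have "(R^2 / r^2) powr e = (R powr 2 / r powr 2) powr e"
    using assms by simp
  also have "\<dots> = R powr (2 * e) / r powr (2 * e)"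
    using assms by (simp add: powr_divide powr_powr del: powr_numeral)
  finally show ?thesis
    using assms by (simp add: powr_minus_divide)
qed

context tensor_weights
begin

abbreviation level :: "real \<Rightarrow> idx set" where
  "level x \<equiv> {l \<in> I. (a l)^2 \<le> x}"

lemma inverse_b4_ge_1: "l \<in> I \<Longrightarrow> 1 \<le> 1 / (b l)^4"
  using b2_le_1[of l] b2_pos[of l] power_le_one[of "(b l)^2" 2]
  by (simp add: b_nonzero)

lemma a2_unbounded:
  obtains l where "l \<in> I" "x \<le> (a l)^2"
proof -
  have s1: "0 < s 1" using s d by auto
  define y where "y = max 1 x"
  define n where "n = nat \<lceil>y powr (1 / (2 * s 1))\<rceil>"
  have y: "0 < y" "1 \<le> y" "x \<le> y" by (auto simp: y_def)
  have n: "y powr (1 / (2 * s 1)) \<le> real n" unfolding n_def by linarith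
  have "1 \<le> y powr (1 / (2 * s 1))" using y s1 by (intro ge_one_powr_ge_zero) auto
  then have n1: "1 \<le> n" using n by linarith
  have "(y powr (1 / (2 * s 1))) powr (2 * s 1) \<le> real n powr (2 * s 1)"
    using n s1 by (intro powr_mono2) auto
  then have "y \<le> (a (axis n))^2"
    using y s1 a2_axis[OF n1] by (simp add: powr_powr)
  then show ?thesis
    using that[of "axis n"] axis_in_I[OF n1] y by simp
qed

text \<open>The energy of the extremal candidate before scaling; its amplitude will be r^2 divided
  by this number.\<close>

definition shrunk_sum :: "real \<Rightarrow> real" where
  "shrunk_sum D = (\<Sum>k\<in>level D. 1 / (b k)^4 * (1 - (a k)^2 / D))"

text \<open>
  \<open>D\<close> is the threshold for which the truncated weights \<open>1 / (b k)^4 * (1 - (a k)^2 / D)\<close>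
  meet both constraints with equality; their weighted mean of \<open>(a k)^2\<close> is too small at
  \<open>D = R^2 / r^2\<close> and unbounded as \<open>D\<close> grows.
\<close>

lemma threshold_exists:
  assumes "0 < r" "r < R"
  obtains D where "R^2 / r^2 \<le> D"
    "(\<Sum>k\<in>level D. (a k)^2 / (b k)^4 * (1 - (a k)^2 / D)) * r^2 = R^2 * shrunk_sum D"
proof -
  define D1 where "D1 = R^2 / r^2"
  have D1: "0 < D1" "D1 * r^2 = R^2" using assms by (auto simp: D1_def)
  have ls: "0 \<le> R^2 * level_sum D1" unfolding level_sum_def by (intro mult_nonneg_nonneg sum_nonneg) auto
  \<comment> \<open>An index so heavy that its term alone outweighs all negative terms of
    \<open>h D2\<close>, which add up to at least - (R^2 * level_sum D1).\<close>
  obtain k0 where k0: "k0 \<in> I" "D1 + 2 * (R^2 * level_sum D1) / r^2 + 1 \<le> (a k0)^2"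
    by (rule a2_unbounded)
  have "0 \<le> 2 * (R^2 * level_sum D1) / r^2" using ls by simp
  then have k0D1: "D1 < (a k0)^2" and k0': "2 * (R^2 * level_sum D1) / r^2 \<le> (a k0)^2 - D1"
    using k0(2) D1(1) by linarith+
  have a_pos: "0 < (a k0)^2" using k0D1 D1(1) by linarith
  \<comment> \<open>The truncation factor of \<open>k0\<close> is then 1 / 2, whence the factor 2 in
    the choice of \<open>k0\<close>.\<close>
  define D2 where "D2 = 2 * (a k0)^2"
  define F where "F = level D2"
  have F: "finite F" unfolding F_def by (rule finite_level)
  \<comment> \<open>Summing positive parts over the fixed set \<open>F\<close> makes
    \<open>h\<close> continuous in D although \<open>level D\<close> jumps.\<close>
  let ?g = "\<lambda>D k. ((a k)^2 * r^2 - R^2) / (b k)^4 * max 0 (1 - (a k)^2 / D)"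
  define h where "h D = (\<Sum>k\<in>F. ?g D k)" for D
  have D12: "D1 \<le> D2" unfolding D2_def using k0D1 a_pos by linarith
  have num: "(a k)^2 * r^2 - R^2 = ((a k)^2 - D1) * r^2" for k
    using D1(2) by (simp add: left_diff_distrib)
  have "h D1 \<le> 0"
    unfolding h_def num
  proof (rule sum_nonpos)
    fix k assume "k \<in> F"
    show "((a k)^2 - D1) * r^2 / (b k)^4 * max 0 (1 - (a k)^2 / D1) \<le> 0"
    proof (cases "(a k)^2 \<le> D1")
      case True
      then show ?thesis by (intro mult_nonpos_nonneg divide_nonpos_nonneg) auto
    next
      case False
      then show ?thesis using D1(1) by (simp add: max_def)
    qed
  qed
  moreover have "0 \<le> h D2"
  proof -
    have mx: "max 0 (1 - (a k)^2 / D2) \<le> 1" for k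
      using a_pos by (simp add: D2_def)
    have "- (R^2 * level_sum D1) \<le> (\<Sum>k\<in>level D1. ?g D2 k)"
      unfolding level_sum_def sum_distrib_left sum_negf[symmetric]
    proof (rule sum_mono)
      fix k
      have "- (R^2 * (1 / (b k)^4)) \<le> - (R^2) / (b k)^4 * max 0 (1 - (a k)^2 / D2)"
        using mult_left_mono[OF mx, of "R^2 / (b k)^4" k] by simp
      also have "\<dots> \<le> ?g D2 k"
        by (intro mult_right_mono divide_right_mono) auto
      finally show "- (R^2 * (1 / (b k)^4)) \<le> ?g D2 k" .
    qed
    moreover have "R^2 * level_sum D1 \<le> (\<Sum>k\<in>F - level D1. ?g D2 k)"
    proof -
      have "R^2 * level_sum D1 \<le> ((a k0)^2 - D1) * r^2 * 1 * (1 / 2)"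
        using k0' assms by (simp add: field_simps)
      also have "\<dots> \<le> ((a k0)^2 - D1) * r^2 * (1 / (b k0)^4) * (1 / 2)"
        using inverse_b4_ge_1[OF k0(1)] k0D1 by (intro mult_right_mono mult_left_mono) auto
      also have "\<dots> = ?g D2 k0"
        using a_pos unfolding num by (simp add: D2_def)
      also have "\<dots> \<le> (\<Sum>k\<in>F - level D1. ?g D2 k)"
      proof (rule member_le_sum)
        show "k0 \<in> F - level D1" using k0(1) k0D1 a_pos by (simp add: F_def D2_def)
        fix k assume "k \<in> F - level D1 - {k0}"
        then have "D1 \<le> (a k)^2" by (auto simp: F_def)
        then show "0 \<le> ?g D2 k" unfolding num by simp
      qed (use F in simp)
      finally show ?thesis .
    qed
    moreover have "level D1 \<subseteq> F" using D12 by (auto simp: F_def)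
    ultimately show ?thesis
      unfolding h_def using sum.subset_diff[OF _ F, of "level D1" "?g D2"] by linarith
  qed
  moreover have "continuous_on {D1..D2} h"
    unfolding h_def using D1(1) b_nonzero by (intro continuous_intros) (auto simp: F_def)
  ultimately obtain D where D: "D1 \<le> D" "D \<le> D2" "h D = 0"
    using IVT'[of h D1 0 D2] D12 by auto
  have "level D \<subseteq> F" using D by (auto simp: F_def)
  have restrict: "(\<Sum>k\<in>level D. f k * (1 - (a k)^2 / D)) = (\<Sum>k\<in>F. f k * max 0 (1 - (a k)^2 / D))" for f
  proof (intro sum.mono_neutral_cong_left F \<open>level D \<subseteq> F\<close> ballI)
    fix k assume "k \<in> F - level D"
    then have "D \<le> (a k)^2" by (auto simp: F_def)
    then show "f k * max 0 (1 - (a k)^2 / D) = 0" using D D1 by simp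
  qed (use D D1 in auto)
  have "h D = r^2 * (\<Sum>k\<in>F. (a k)^2 / (b k)^4 * max 0 (1 - (a k)^2 / D)) - R^2 * (\<Sum>k\<in>F. 1 / (b k)^4 * max 0 (1 - (a k)^2 / D))"
    unfolding h_def sum_distrib_left sum_subtractf[symmetric]
    by (intro sum.cong refl) (simp add: algebra_simps diff_divide_distrib)
  then have "(\<Sum>k\<in>level D. (a k)^2 / (b k)^4 * (1 - (a k)^2 / D)) * r^2 = R^2 * shrunk_sum D"
    using D(3) unfolding shrunk_sum_def restrict by (simp add: mult.commute)
  then show ?thesis
    using that D(1) unfolding D1_def by blast
qed

lemma shrunk_sum_ge:
  assumes "0 < D"
  shows "level_sum (D / 2) / 2 \<le> shrunk_sum D"
proof -
  have "level_sum (D / 2) / 2 = (\<Sum>k\<in>level (D / 2). 1 / (b k)^4 * (1 / 2))"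
    unfolding level_sum_def by (simp add: sum_divide_distrib)
  also have "\<dots> \<le> (\<Sum>k\<in>level (D / 2). 1 / (b k)^4 * (1 - (a k)^2 / D))"
    using assms by (intro sum_mono mult_left_mono) (auto simp: field_simps)
  also have "\<dots> \<le> shrunk_sum D"
    unfolding shrunk_sum_def using assms
    by (intro sum_mono2 finite_level) (auto intro!: divide_nonneg_nonneg)
  finally show ?thesis .
qed

lemma shrunk_sum_pos:
  assumes "1 < D"
  shows "0 < shrunk_sum D"
  unfolding shrunk_sum_def
proof (rule sum_pos2[OF finite_level])
  have a1: "(a (axis 1))^2 = 1" using a2_axis[of 1] by simp
  then show "axis 1 \<in> level D" using assms axis_in_I[of 1] by simp
  show "0 < 1 / (b (axis 1))^4 * (1 - (a (axis 1))^2 / D)"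
    using assms b_nonzero[OF axis_in_I[of 1]] unfolding a1 by simp
qed (use assms in auto)

text \<open>Square summability bounds the entries, and (b k)^2 \<le> 1. Summability matters since a
  divergent \<open>infsum\<close> has the default value 0, which would spoil the infimum.\<close>

lemma quartic_summable:
  assumes "\<theta> \<in> ell2 d"
  shows "(\<lambda>k. (b k)^4 * (\<theta> k)^4) summable_on I"
proof -
  have sq: "(\<lambda>k. (\<theta> k)^2) summable_on I" using assms by (simp add: ell2_def)
  define M where "M = (\<Sum>\<^sub>\<infinity>k\<in>I. (\<theta> k)^2)"
  have M: "(\<theta> k)^2 \<le> M" if "k \<in> I" for k
    using finite_sum_le_infsum[OF sq, of "{k}"] that by (simp add: M_def)
  show ?thesis
  proof (rule summable_on_comparison_test)
    show "(\<lambda>k. M * (\<theta> k)^2) summable_on I" using sq by (rule summable_on_cmult_right)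
    fix k assume k: "k \<in> I"
    have "(b k)^4 \<le> 1" using power_le_one[OF _ b2_le_1[OF k], of 2] by simp
    then have "(b k)^4 * (\<theta> k)^4 \<le> 1 * (\<theta> k)^4" by (intro mult_right_mono) auto
    also have "\<dots> = (\<theta> k)^2 * (\<theta> k)^2" by (simp flip: power_add)
    also have "\<dots> \<le> M * (\<theta> k)^2" using M[OF k] by (intro mult_right_mono) auto
    finally show "(b k)^4 * (\<theta> k)^4 \<le> M * (\<theta> k)^2" .
  qed simp
qed

lemma alternativeD:
  assumes "\<theta> \<in> alt R r" "0 \<le> r"
  shows "\<theta> \<in> ell2 d" "(\<lambda>k. (\<theta> k)^2) summable_on I" "(\<lambda>k. (a k)^2 * (\<theta> k)^2) summable_on I"
    "(\<Sum>\<^sub>\<infinity>k\<in>I. (a k)^2 * (\<theta> k)^2) \<le> R^2" "r^2 \<le> (\<Sum>\<^sub>\<infinity>k\<in>I. (\<theta> k)^2)"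
proof -
  show "\<theta> \<in> ell2 d" "(\<lambda>k. (\<theta> k)^2) summable_on I" "(\<lambda>k. (a k)^2 * (\<theta> k)^2) summable_on I"
    "(\<Sum>\<^sub>\<infinity>k\<in>I. (a k)^2 * (\<theta> k)^2) \<le> R^2"
    using assms by (auto simp: alternative_def ellipsoid_def ell2_def)
  have "r \<le> sqrt (\<Sum>\<^sub>\<infinity>k\<in>I. (\<theta> k)^2)"
    using assms by (simp add: alternative_def ell2_norm_def)
  then have "r^2 \<le> (sqrt (\<Sum>\<^sub>\<infinity>k\<in>I. (\<theta> k)^2))^2"
    using assms(2) by (intro power_mono)
  then show "r^2 \<le> (\<Sum>\<^sub>\<infinity>k\<in>I. (\<theta> k)^2)"
    by (simp add: infsum_nonneg)
qed

lemma finite_support_in_alternative: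
  assumes E: "finite E" "E \<subseteq> I" and zero: "\<And>k. k \<in> I - E \<Longrightarrow> \<theta> k = 0" and "0 \<le> r"
    and "(\<Sum>k\<in>E. (a k)^2 * (\<theta> k)^2) \<le> R^2" "r^2 \<le> (\<Sum>k\<in>E. (\<theta> k)^2)"
  shows "\<theta> \<in> alt R r" "quart \<theta> = (\<Sum>k\<in>E. (b k)^4 * (\<theta> k)^4)"
proof -
  show "quart \<theta> = (\<Sum>k\<in>E. (b k)^4 * (\<theta> k)^4)"
    unfolding quartic_def using zero by (intro infsum_finite_support E) auto
  have "(\<Sum>\<^sub>\<infinity>k\<in>I. (\<theta> k)^2) = (\<Sum>k\<in>E. (\<theta> k)^2)" "(\<lambda>k. (\<theta> k)^2) summable_on I"
    "(\<Sum>\<^sub>\<infinity>k\<in>I. (a k)^2 * (\<theta> k)^2) = (\<Sum>k\<in>E. (a k)^2 * (\<theta> k)^2)" "(\<lambda>k. (a k)^2 * (\<theta> k)^2) summable_on I"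
    using zero by (auto intro!: infsum_finite_support[OF E] summable_on_finite_support[OF E])
  moreover have "r \<le> sqrt (\<Sum>k\<in>E. (\<theta> k)^2)"
    using assms(6) by (rule real_le_rsqrt)
  ultimately show "\<theta> \<in> alt R r"
    using assms(5) by (simp add: alternative_def ellipsoid_def ell2_def ell2_norm_def)
qed

text \<open>The squares \<open>w\<close> are the Lagrange candidate: \<open>(b k)^4 * w k\<close> is
  the positive part of A * (1 - (a k)^2 / D), with both constraints active. Optimality follows from
  convexity in the squares, and the squares of any minimiser must equal \<open>w\<close>, so the
  form holds for whichever minimiser is chosen. The last claim is the variational inequality that
  bounds the mean of the test statistic.\<close>

lemma extremal_solution_structure:
  assumes "0 < r" "r < R"
  defines "\<theta> \<equiv> solution R r"
  obtains D A where "R^2 / r^2 \<le> D" "0 < A" "A * shrunk_sum D = r^2"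
    "\<theta> \<in> alt R r"
    "\<And>k. k \<in> I \<Longrightarrow> (\<theta> k)^2 = A / (b k)^4 * max 0 (1 - (a k)^2 / D)"
    "quart \<theta> = (\<Sum>k\<in>level D. (b k)^4 * (\<theta> k)^4)"
    "0 < quart \<theta>"
    "\<And>\<theta>'. \<theta>' \<in> alt R r \<Longrightarrow> quart \<theta> \<le> quart \<theta>'"
    "\<And>\<theta>'. \<theta>' \<in> alt R r \<Longrightarrow> quart \<theta> \<le> (\<Sum>k\<in>level D. (b k)^4 * (\<theta> k)^2 * (\<theta>' k)^2)"
proof -
  obtain D where D: "R^2 / r^2 \<le> D"
    and eq: "(\<Sum>k\<in>level D. (a k)^2 / (b k)^4 * (1 - (a k)^2 / D)) * r^2 = R^2 * shrunk_sum D"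
    using threshold_exists[OF assms(1,2)] by blast
  have "1 < R^2 / r^2" using assms by (simp add: power_strict_mono)
  then have D1: "1 < D" using D by linarith
  define A where "A = r^2 / shrunk_sum D"
  have S: "0 < shrunk_sum D" by (rule shrunk_sum_pos[OF D1])
  have A: "0 < A" "A * shrunk_sum D = r^2" using S assms by (auto simp: A_def)
  define w where "w k = A / (b k)^4 * max 0 (1 - (a k)^2 / D)" for k
  have w0: "0 \<le> w k" for k using A by (simp add: w_def)
  have w_level: "w k = A * (1 / (b k)^4 * (1 - (a k)^2 / D))" if "k \<in> level D" for k
    using that D1 by (simp add: w_def)
  have w_out: "w k = 0" if "k \<in> I - level D" for k
    using that D1 by (auto simp: w_def)
  have sum_w: "(\<Sum>k\<in>level D. w k) = r^2"
    using A(2) by (simp add: w_level shrunk_sum_def sum_distrib_left)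
  have sum_aw: "(\<Sum>k\<in>level D. (a k)^2 * w k) = R^2"
  proof -
    have "(\<Sum>k\<in>level D. (a k)^2 * w k) = A * (\<Sum>k\<in>level D. (a k)^2 / (b k)^4 * (1 - (a k)^2 / D))"
      unfolding sum_distrib_left by (intro sum.cong refl) (simp add: w_level)
    also have "\<dots> = R^2" using eq S by (simp add: A_def field_simps)
    finally show ?thesis .
  qed
  define Q where "Q = (\<Sum>k\<in>level D. (b k)^4 * (w k)^2)"
  have bw: "(b k)^4 * w k = A * max 0 (1 - (a k)^2 / D)" if "k \<in> I" for k
    using b_nonzero[OF that] by (simp add: w_def)
  \<comment> \<open>The value of the Lagrangian at the candidate, with r^2 and R^2 inserted for the
    two active constraints.\<close>
  have Q_eq: "Q = A * (r^2 - R^2 / D)"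
  proof -
    have "Q = (\<Sum>k\<in>level D. A * (w k - (a k)^2 * w k / D))"
      unfolding Q_def
    proof (rule sum.cong[OF refl])
      fix k assume k: "k \<in> level D"
      then have "(b k)^4 * w k = A * (1 - (a k)^2 / D)"
        using bw[of k] D1 by simp
      then have "(b k)^4 * w k * w k = A * (1 - (a k)^2 / D) * w k" by simp
      then show "(b k)^4 * (w k)^2 = A * (w k - (a k)^2 * w k / D)"
        by (simp add: power2_eq_square algebra_simps)
    qed
    also have "\<dots> = A * ((\<Sum>k\<in>level D. w k) - (\<Sum>k\<in>level D. (a k)^2 * w k) / D)"
      by (simp add: sum_subtractf sum_divide_distrib flip: sum_distrib_left)
    finally show ?thesis by (simp add: sum_w sum_aw)
  qed
  have Q_pos: "0 < Q"
    unfolding Q_def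
  proof (rule sum_pos2[OF finite_level])
    have a1: "(a (axis 1))^2 = 1" using a2_axis[of 1] by simp
    then show "axis 1 \<in> level D" using D1 axis_in_I[of 1] by simp
    show "0 < (b (axis 1))^4 * (w (axis 1))^2"
      unfolding w_def a1 using b_nonzero[OF axis_in_I[of 1]] A D1 by simp
  qed auto
  \<comment> \<open>Dropping the positive part only decreases the coefficients. The remaining
    Lagrangian is linear in the squares of \<theta>', and feasibility bounds it below by its value
    at \<open>w\<close>.\<close>
  have saddle: "Q \<le> (\<Sum>k\<in>level D. (b k)^4 * w k * (\<theta>' k)^2)" if "\<theta>' \<in> alt R r" for \<theta>'
  proof -
    note \<theta>' = alternativeD[OF that less_imp_le[OF assms(1)]]
    have "((\<lambda>k. (\<theta>' k)^2 + - ((a k)^2 * (\<theta>' k)^2 / D)) has_sum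
        (\<Sum>\<^sub>\<infinity>k\<in>I. (\<theta>' k)^2) + - ((\<Sum>\<^sub>\<infinity>k\<in>I. (a k)^2 * (\<theta>' k)^2) / D)) I"
      using \<theta>' by (intro has_sum_add has_sum_uminusI has_sum_divide_const has_sum_infsum)
    from has_sum_cmult_right[OF this, of A]
    have sums: "((\<lambda>k. A * ((\<theta>' k)^2 - (a k)^2 * (\<theta>' k)^2 / D)) has_sum
        A * ((\<Sum>\<^sub>\<infinity>k\<in>I. (\<theta>' k)^2) - (\<Sum>\<^sub>\<infinity>k\<in>I. (a k)^2 * (\<theta>' k)^2) / D)) I"
      by simp
    then have sm: "(\<lambda>k. A * ((\<theta>' k)^2 - (a k)^2 * (\<theta>' k)^2 / D)) summable_on I"
      by (rule has_sum_imp_summable)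
    have "(b k)^4 * w k * (\<theta>' k)^2 = 0" if "k \<in> I - level D" for k
      using w_out[OF that] by simp
    then have fin: "(\<lambda>k. (b k)^4 * w k * (\<theta>' k)^2) summable_on I"
      "(\<Sum>\<^sub>\<infinity>k\<in>I. (b k)^4 * w k * (\<theta>' k)^2) = (\<Sum>k\<in>level D. (b k)^4 * w k * (\<theta>' k)^2)"
      by (intro summable_on_finite_support[OF finite_level Collect_restrict]
          infsum_finite_support[OF finite_level Collect_restrict]; blast)+
    have "Q \<le> A * ((\<Sum>\<^sub>\<infinity>k\<in>I. (\<theta>' k)^2) - (\<Sum>\<^sub>\<infinity>k\<in>I. (a k)^2 * (\<theta>' k)^2) / D)"
      unfolding Q_eq using \<theta>' A D1 by (intro mult_left_mono diff_mono divide_right_mono) auto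
    also have "\<dots> = (\<Sum>\<^sub>\<infinity>k\<in>I. A * ((\<theta>' k)^2 - (a k)^2 * (\<theta>' k)^2 / D))"
      by (rule infsumI[OF sums, symmetric])
    also have "\<dots> \<le> (\<Sum>\<^sub>\<infinity>k\<in>I. (b k)^4 * w k * (\<theta>' k)^2)"
    proof (rule infsum_mono[OF sm fin(1)])
      fix k assume k: "k \<in> I"
      have "A * ((\<theta>' k)^2 - (a k)^2 * (\<theta>' k)^2 / D) = A * (1 - (a k)^2 / D) * (\<theta>' k)^2"
        by (simp add: algebra_simps)
      also have "\<dots> \<le> A * max 0 (1 - (a k)^2 / D) * (\<theta>' k)^2"
        using A by (intro mult_right_mono mult_left_mono) auto
      finally show "A * ((\<theta>' k)^2 - (a k)^2 * (\<theta>' k)^2 / D) \<le> (b k)^4 * w k * (\<theta>' k)^2"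
        using bw[OF k] by simp
    qed
    finally show ?thesis unfolding fin(2) .
  qed
  \<comment> \<open>Expanding the square and using \<open>saddle\<close> shows that
    \<open>quart \<theta>' - Q\<close> is at least the sum of
    \<open>(b k)^4 * ((\<theta>' k)^2 - w k)^2\<close>; this gives minimality and uniqueness of the
    squares at once.\<close>
  have defect: "Q \<le> quart \<theta>' \<and> (quart \<theta>' \<le> Q \<longrightarrow> (\<forall>k\<in>I. (\<theta>' k)^2 = w k))"
    if "\<theta>' \<in> alt R r" for \<theta>'
  proof -
    note \<theta>' = alternativeD[OF that less_imp_le[OF assms(1)]]
    have q: "(\<lambda>k. (b k)^4 * (\<theta>' k)^4) summable_on I"
      by (rule quartic_summable[OF \<theta>'(1)])
    let ?f = "\<lambda>k. (b k)^4 * (w k)^2 - 2 * ((b k)^4 * w k * (\<theta>' k)^2)"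
    have f: "?f summable_on I" "(\<Sum>\<^sub>\<infinity>k\<in>I. ?f k) = (\<Sum>k\<in>level D. ?f k)"
    proof -
      have "?f k = 0" if "k \<in> I - level D" for k
        using w_out[OF that] by simp
      then show "?f summable_on I" "(\<Sum>\<^sub>\<infinity>k\<in>I. ?f k) = (\<Sum>k\<in>level D. ?f k)"
        by (intro summable_on_finite_support[OF finite_level Collect_restrict]
            infsum_finite_support[OF finite_level Collect_restrict]; blast)+
    qed
    have expand: "(b k)^4 * ((\<theta>' k)^2 - w k)^2 = (b k)^4 * (\<theta>' k)^4 + ?f k" for k
      by (simp add: power2_diff algebra_simps flip: power_mult)
    have sm: "(\<lambda>k. (b k)^4 * ((\<theta>' k)^2 - w k)^2) summable_on I"
      unfolding expand using q f by (intro summable_on_add)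
    have val: "(\<Sum>\<^sub>\<infinity>k\<in>I. (b k)^4 * ((\<theta>' k)^2 - w k)^2)
        = quart \<theta>' + Q - 2 * (\<Sum>k\<in>level D. (b k)^4 * w k * (\<theta>' k)^2)"
      unfolding expand infsum_add[OF q f(1)] f(2) quartic_def Q_def
      by (simp add: sum_subtractf flip: sum_distrib_left)
    have "0 \<le> (\<Sum>\<^sub>\<infinity>k\<in>I. (b k)^4 * ((\<theta>' k)^2 - w k)^2)"
      by (intro infsum_nonneg) auto
    then have ge: "Q \<le> quart \<theta>'" using val saddle[OF that] by linarith
    moreover have "(\<theta>' k)^2 = w k" if le: "quart \<theta>' \<le> Q" and k: "k \<in> I" for k
    proof -
      have "(\<Sum>\<^sub>\<infinity>k\<in>I. (b k)^4 * ((\<theta>' k)^2 - w k)^2) \<le> 0"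
        using val saddle[OF \<open>\<theta>' \<in> alt R r\<close>] le by linarith
      then have "(b k)^4 * ((\<theta>' k)^2 - w k)^2 = 0"
        by (rule nonneg_infsum_le_0D[OF _ sm _ k]) auto
      then show ?thesis using b_nonzero[OF k] by simp
    qed
    ultimately show ?thesis by blast
  qed
  define \<eta> where "\<eta> k = sqrt (w k)" for k
  have \<eta>2: "(\<eta> k)^2 = w k" for k using w0 by (simp add: \<eta>_def)
  have \<eta>4: "(\<eta> k)^4 = (w k)^2" for k
    using \<eta>2[of k] by (metis numeral_times_numeral power_mult semiring_norm(12,13))
  have \<eta>: "\<eta> \<in> alt R r" "quart \<eta> = Q"
    using finite_support_in_alternative[OF finite_level, of D \<eta> r R] w_out assms
    by (auto simp: \<eta>2 \<eta>4 sum_w sum_aw Q_def) (auto simp: \<eta>_def)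
  \<comment> \<open>\<open>arg_min_on\<close> is a choice, so its properties need an explicit
    minimiser first.\<close>
  have "is_arg_min (quart) (\<lambda>x. x \<in> alt R r) \<eta>"
    using \<eta> defect by (auto simp: is_arg_min_linorder)
  then have "is_arg_min (quart) (\<lambda>x. x \<in> alt R r) \<theta>"
    unfolding \<theta>_def extremal_solution_def arg_min_on_def arg_min_def
    by (rule someI[where P = "is_arg_min (quart) (\<lambda>x. x \<in> alt R r)"])
  then have \<theta>: "\<theta> \<in> alt R r" "quart \<theta> \<le> Q"
    using \<eta> by (auto simp: is_arg_min_linorder)
  then have \<theta>2: "(\<theta> k)^2 = w k" if "k \<in> I" for k
    using defect that by blast
  have \<theta>4: "(\<theta> k)^4 = (w k)^2" if "k \<in> I" for k
    using \<theta>2[OF that] by (metis numeral_times_numeral power_mult semiring_norm(12,13))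
  have Q\<theta>: "quart \<theta> = Q" using \<theta> defect by (auto intro: antisym)
  show ?thesis
  proof (rule that[OF D A \<theta>(1)])
    show "(\<theta> k)^2 = A / (b k)^4 * max 0 (1 - (a k)^2 / D)" if "k \<in> I" for k
      using \<theta>2[OF that] by (simp add: w_def)
    show "quart \<theta> = (\<Sum>k\<in>level D. (b k)^4 * (\<theta> k)^4)"
      unfolding Q\<theta> Q_def by (intro sum.cong refl) (simp add: \<theta>4)
    show "0 < quart \<theta>" unfolding Q\<theta> by (rule Q_pos)
    fix \<theta>' assume \<theta>': "\<theta>' \<in> alt R r"
    show "quart \<theta> \<le> quart \<theta>'" unfolding Q\<theta> using defect[OF \<theta>'] by blast
    have "(\<Sum>k\<in>level D. (b k)^4 * (\<theta> k)^2 * (\<theta>' k)^2) = (\<Sum>k\<in>level D. (b k)^4 * w k * (\<theta>' k)^2)"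
      by (intro sum.cong refl) (simp add: \<theta>2)
    then show "quart \<theta> \<le> (\<Sum>k\<in>level D. (b k)^4 * (\<theta> k)^2 * (\<theta>' k)^2)"
      unfolding Q\<theta> using saddle[OF \<theta>'] by simp
  qed
qed

section \<open>Orders of magnitude of the extremal value and of the filter coefficients\<close>

lemma quartic_lower:
  assumes R: "0 < R"
  obtains k where "0 < k"
    "\<And>r \<theta>. 0 < r \<Longrightarrow> r < R \<Longrightarrow> \<theta> \<in> alt R r \<Longrightarrow> k * r powr (4 + c 1) \<le> quart \<theta>"
proof -
  obtain K where K: "0 < K" "\<And>x. 1 \<le> x \<Longrightarrow> level_sum x \<le> K * x powr (c 1 / 2)"
    using level_sum_upper by blast
  define k where "k = 1 / (4 * (K * (2 powr (c 1 / 2) * R powr c 1)))"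
  have "0 < k" using K R by (simp add: k_def)
  moreover have "k * r powr (4 + c 1) \<le> quart \<theta>"
    if r: "0 < r" "r < R" and mem: "\<theta> \<in> alt R r" for r \<theta>
  proof -
    note \<theta> = alternativeD[OF mem less_imp_le[OF r(1)]]
    \<comment> \<open>Beyond this level the ellipsoid constraint leaves energy at most R^2 / D = r^2
      / 2, so at least r^2 / 2 sits on \<open>level D\<close>. Cauchy-Schwarz with the weights 1 /
      (b k)^2 then bounds the quartic form from below by r^4 / 4 over
      \<open>level_sum D\<close>.\<close>
    define D where "D = 2 * (R^2 / r^2)"
    have "1 < R^2 / r^2" using r by (simp add: power_strict_mono)
    then have D: "1 \<le> D" by (simp add: D_def)
    let ?f = "\<lambda>k. if (a k)^2 \<le> D then (\<theta> k)^2 else 0"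
    have f: "?f summable_on I" "(\<Sum>\<^sub>\<infinity>k\<in>I. ?f k) = (\<Sum>k\<in>level D. (\<theta> k)^2)"
    proof -
      have "(\<Sum>\<^sub>\<infinity>k\<in>I. ?f k) = (\<Sum>k\<in>level D. ?f k)"
        by (rule infsum_finite_support[OF finite_level]) auto
      also have "\<dots> = (\<Sum>k\<in>level D. (\<theta> k)^2)" by (rule sum.cong) auto
      finally show "(\<Sum>\<^sub>\<infinity>k\<in>I. ?f k) = (\<Sum>k\<in>level D. (\<theta> k)^2)" .
      show "?f summable_on I"
        by (rule summable_on_finite_support[OF finite_level, of D]) auto
    qed
    have aD: "(\<lambda>k. (a k)^2 * (\<theta> k)^2 / D) summable_on I"
      using \<theta>(3) by (rule summable_on_divide_const)
    have "r^2 \<le> (\<Sum>\<^sub>\<infinity>k\<in>I. (\<theta> k)^2)" by (rule \<theta>(5))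
    also have "\<dots> \<le> (\<Sum>\<^sub>\<infinity>k\<in>I. ?f k + (a k)^2 * (\<theta> k)^2 / D)"
    proof (rule infsum_mono[OF \<theta>(2) summable_on_add[OF f(1) aD]])
      fix k
      show "(\<theta> k)^2 \<le> ?f k + (a k)^2 * (\<theta> k)^2 / D"
      proof (cases "(a k)^2 \<le> D")
        case False
        then have "D * (\<theta> k)^2 \<le> (a k)^2 * (\<theta> k)^2" by (intro mult_right_mono) auto
        then show ?thesis using D False by (simp add: field_simps)
      qed (use D in simp)
    qed
    also have "\<dots> = (\<Sum>k\<in>level D. (\<theta> k)^2) + (\<Sum>\<^sub>\<infinity>k\<in>I. (a k)^2 * (\<theta> k)^2) / D"
      unfolding infsum_add[OF f(1) aD] f(2) by (simp only: infsum_divide_const[OF \<theta>(3)])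
    also have "(\<Sum>\<^sub>\<infinity>k\<in>I. (a k)^2 * (\<theta> k)^2) / D \<le> R^2 / D"
      using \<theta>(4) D by (intro divide_right_mono) auto
    also have "R^2 / D = r^2 / 2" using r R by (simp add: D_def)
    finally have half: "r^2 / 2 \<le> (\<Sum>k\<in>level D. (\<theta> k)^2)" by simp
    have "(r^2 / 2)^2 \<le> (\<Sum>k\<in>level D. (\<theta> k)^2)^2"
      using half by (intro power_mono) auto
    also have "(\<Sum>k\<in>level D. (\<theta> k)^2) = (\<Sum>k\<in>level D. 1 / (b k)^2 * ((b k)^2 * (\<theta> k)^2))"
      by (intro sum.cong refl) (simp add: b_nonzero)
    also have "(\<dots>)^2 \<le> (\<Sum>k\<in>level D. (1 / (b k)^2)^2) * (\<Sum>k\<in>level D. ((b k)^2 * (\<theta> k)^2)^2)"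
      by (rule Cauchy_Schwarz_ineq_sum)
    also have "(\<Sum>k\<in>level D. (1 / (b k)^2)^2) = level_sum D"
      unfolding level_sum_def by (simp add: power_divide flip: power_mult)
    also have "(\<Sum>k\<in>level D. ((b k)^2 * (\<theta> k)^2)^2) = (\<Sum>k\<in>level D. (b k)^4 * (\<theta> k)^4)"
      by (simp add: power_mult_distrib flip: power_mult)
    also have "level_sum D * (\<Sum>k\<in>level D. (b k)^4 * (\<theta> k)^4) \<le> (K * D powr (c 1 / 2)) * quart \<theta>"
    proof (rule mult_mono[OF K(2)[OF D]])
      show "(\<Sum>k\<in>level D. (b k)^4 * (\<theta> k)^4) \<le> quart \<theta>"
        unfolding quartic_def by (rule finite_sum_le_infsum[OF quartic_summable[OF \<theta>(1)] finite_level]) auto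
    qed (use K in \<open>auto intro: sum_nonneg\<close>)
    also have "D powr (c 1 / 2) = 2 powr (c 1 / 2) * (R powr c 1 / r powr c 1)"
    proof -
      have "D powr (c 1 / 2) = 2 powr (c 1 / 2) * (R^2 / r^2) powr (c 1 / 2)"
        unfolding D_def by (rule powr_mult)
      also have "(R^2 / r^2) powr (c 1 / 2) = R powr c 1 / r powr c 1"
        using square_ratio_powr[OF R r(1), of "c 1 / 2"] by (simp add: powr_minus_divide)
      finally show ?thesis .
    qed
    finally have "r^4 / 4 \<le> K * (2 powr (c 1 / 2) * (R powr c 1 / r powr c 1)) * quart \<theta>"
      by (simp add: power_divide flip: power_mult)
    then have "r^4 * r powr c 1 \<le> 4 * (K * (2 powr (c 1 / 2) * R powr c 1)) * quart \<theta>"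
      using r by (simp add: field_simps)
    moreover have "r powr (4 + c 1) = r^4 * r powr c 1"
      using r by (simp add: powr_add)
    ultimately show ?thesis
      using K R unfolding k_def by (simp add: field_simps)
  qed
  ultimately show ?thesis by (rule that)
qed

text \<open>The witness has squares proportional to 1 / (b l)^4 on a level set, the case of equality
  in the Cauchy-Schwarz step of the lower bound. The level R^2 / r^2 is the largest for which energy
  r^2 is certain to respect the ellipsoid constraint.\<close>

lemma quartic_upper:
  assumes R: "0 < R"
  obtains K where "0 < K"
    "\<And>r. 0 < r \<Longrightarrow> r < R \<Longrightarrow> \<exists>\<theta>\<in>alt R r. quart \<theta> \<le> K * r powr (4 + c 1)"
proof -
  obtain k where k: "0 < k" "\<And>x. 1 \<le> x \<Longrightarrow> k * x powr (c 1 / 2) \<le> level_sum x"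
    using level_sum_lower by blast
  define K where "K = 1 / (k * R powr c 1)"
  have "0 < K" using k R by (simp add: K_def)
  moreover have "\<exists>\<theta>\<in>alt R r. quart \<theta> \<le> K * r powr (4 + c 1)"
    if r: "0 < r" "r < R" for r
  proof -
    define D where "D = R^2 / r^2"
    have D: "1 \<le> D" using r by (simp add: D_def power_mono)
    have ls: "0 < level_sum D" using k(1) D by (intro less_le_trans[OF _ k(2)[OF D]]) auto
    define A where "A = r^2 / level_sum D"
    define \<theta> where "\<theta> l = (if (a l)^2 \<le> D then sqrt A / (b l)^2 else 0)" for l
    have A: "0 < A" "A * level_sum D = r^2" using ls r by (auto simp: A_def)
    have \<theta>2: "(\<theta> l)^2 = A * (1 / (b l)^4)" if "l \<in> level D" for l
      using that A by (simp add: \<theta>_def power_divide flip: power_mult)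
    have \<theta>4: "(b l)^4 * (\<theta> l)^4 = A^2 * (1 / (b l)^4)" if "l \<in> level D" for l
    proof -
      have "(\<theta> l)^4 = ((\<theta> l)^2)^2" by simp
      also have "\<dots> = A^2 * (1 / (b l)^4 * (1 / (b l)^4))"
        unfolding \<theta>2[OF that] by (simp add: power2_eq_square)
      finally have "(b l)^4 * (\<theta> l)^4 = A^2 * (((b l)^4 * (1 / (b l)^4)) * (1 / (b l)^4))"
        by (simp only: mult_ac)
      moreover have "(b l)^4 * (1 / (b l)^4) = 1"
        using that b_nonzero[of l] by simp
      ultimately show ?thesis by (simp only: mult_1_left)
    qed
    have sum2: "(\<Sum>l\<in>level D. (\<theta> l)^2) = r^2"
      using A(2) by (simp add: \<theta>2 level_sum_def sum_distrib_left)
    have suma: "(\<Sum>l\<in>level D. (a l)^2 * (\<theta> l)^2) \<le> R^2"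
    proof -
      have "(\<Sum>l\<in>level D. (a l)^2 * (\<theta> l)^2) \<le> (\<Sum>l\<in>level D. D * (\<theta> l)^2)"
        by (intro sum_mono mult_right_mono) auto
      also have "\<dots> = D * r^2" by (simp only: sum2 flip: sum_distrib_left)
      also have "\<dots> = R^2" using r by (simp add: D_def)
      finally show ?thesis .
    qed
    have mem: "\<theta> \<in> alt R r" and q: "quart \<theta> = (\<Sum>l\<in>level D. (b l)^4 * (\<theta> l)^4)"
      using finite_support_in_alternative[OF finite_level, of D \<theta> r R] sum2 suma r by (auto simp: \<theta>_def)
    have "quart \<theta> = A^2 * level_sum D"
      unfolding q level_sum_def sum_distrib_left by (intro sum.cong refl) (rule \<theta>4)
    also have "\<dots> = r^4 / level_sum D"
      using ls by (simp add: A_def power2_eq_square power4_eq_xxxx)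
    also have "\<dots> \<le> r^4 / (k * D powr (c 1 / 2))"
      using k D ls by (intro divide_left_mono k(2) mult_pos_pos) auto
    also have "D powr (c 1 / 2) = R powr c 1 / r powr c 1"
      using square_ratio_powr[OF R r(1), of "c 1 / 2"] by (simp add: D_def powr_minus_divide)
    also have "r^4 / (k * (R powr c 1 / r powr c 1)) = K * r powr (4 + c 1)"
      using r by (simp add: K_def powr_add)
    finally show ?thesis using mem by blast
  qed
  ultimately show ?thesis by (rule that)
qed

text \<open>The numerator is at most A * D powr \<tau>, and A is at most of order r^2 * D powr (- c
  1 / 2). As \<tau> < c 1 / 2, the lower bound R^2 / r^2 on D is enough to make this of order r powr
  (2 + c 1 - 2 * \<tau>). The denominator is at least of order r powr (2 + c 1 / 2), which leaves
  the exponent \<rho> = c 1 / 2 - 2 * \<tau> > 0.\<close>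

lemma filter_coeff_vanishing:
  assumes R: "0 < R"
  obtains C \<rho> where "0 < C" "0 < \<rho>"
    "\<And>r k. \<lbrakk>0 < r; 2 * r^2 \<le> R^2; k \<in> I\<rbrakk> \<Longrightarrow> fcoeff R r k \<le> C * r powr \<rho>"
proof -
  obtain q where q: "0 < q"
    "\<And>r \<theta>. 0 < r \<Longrightarrow> r < R \<Longrightarrow> \<theta> \<in> alt R r \<Longrightarrow> q * r powr (4 + c 1) \<le> quart \<theta>"
    using quartic_lower[OF R] by blast
  obtain k0 where k0: "0 < k0" "\<And>x. 1 \<le> x \<Longrightarrow> k0 * x powr (c 1 / 2) \<le> level_sum x"
    using level_sum_lower by blast
  obtain \<tau> where \<tau>: "0 \<le> \<tau>" "4 * \<tau> < c 1" "\<And>l. l \<in> I \<Longrightarrow> 1 / (b l)^2 \<le> ((a l)^2) powr \<tau>"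
    using inverse_b2_le_a2_powr by blast
  define \<rho> where "\<rho> = c 1 / 2 - 2 * \<tau>"
  define C1 where "C1 = 2 * 2 powr (c 1 / 2) / k0 * R powr (2 * (\<tau> - c 1 / 2))"
  define C where "C = C1 / sqrt (2 * q)"
  have C1: "0 < C1" using k0 R by (simp add: C1_def)
  have "0 < C" "0 < \<rho>" using C1 q \<tau> by (auto simp: C_def \<rho>_def)
  moreover have "fcoeff R r k \<le> C * r powr \<rho>"
    if r: "0 < r" "2 * r^2 \<le> R^2" and k: "k \<in> I" for r k
  proof -
    have "0 < r^2" using r by simp
    then have "r^2 < R^2" using r(2) by linarith
    then have rR: "r < R" using R by (rule power2_less_imp_less[OF _ less_imp_le])
    define \<theta> where "\<theta> = solution R r"
    obtain D A where D: "R^2 / r^2 \<le> D" and A: "0 < A" "A * shrunk_sum D = r^2"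
      and mem: "\<theta> \<in> alt R r"
      and \<theta>2: "\<And>k. k \<in> I \<Longrightarrow> (\<theta> k)^2 = A / (b k)^4 * max 0 (1 - (a k)^2 / D)"
      by (rule extremal_solution_structure[OF r(1) rR, folded \<theta>_def], rule that; blast)
    \<comment> \<open>The lower bound on \<open>level_sum\<close> will be used at D / 2, which has
      to be at least 1.\<close>
    have "2 \<le> R^2 / r^2" using r by (simp add: field_simps)
    then have D2: "2 \<le> D" using D by linarith
    have "k0 * (D / 2) powr (c 1 / 2) / 2 \<le> shrunk_sum D"
      using shrunk_sum_ge[of D] k0(2)[of "D / 2"] D2 by linarith
    from mult_left_mono[OF this, of A]
    have "A * (k0 * (D / 2) powr (c 1 / 2) / 2) \<le> r^2" using A by simp
    then have A_le: "A \<le> 2 * 2 powr (c 1 / 2) / k0 * r^2 * D powr (- (c 1 / 2))"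
      using k0 D2 by (simp add: powr_divide powr_minus_divide field_simps)
    have b2\<theta>: "(b k)^2 * (\<theta> k)^2 \<le> A * D powr \<tau>"
    proof (cases "(a k)^2 \<le> D")
      case True
      have "(b k)^2 * (\<theta> k)^2 = A * ((1 / (b k)^2) * max 0 (1 - (a k)^2 / D))"
        unfolding \<theta>2[OF k] using b_nonzero[OF k] by (simp add: power4_eq_xxxx power2_eq_square)
      also have "\<dots> \<le> A * (((a k)^2) powr \<tau> * 1)"
        using A \<tau>(3)[OF k] D2 by (intro mult_left_mono mult_mono) auto
      also have "\<dots> \<le> A * D powr \<tau>"
        using A True \<tau>(1) by (simp add: powr_mono2)
      finally show ?thesis .
    next
      case False
      then show ?thesis using D2 A by (simp add: \<theta>2[OF k])
    qed
    also have "\<dots> \<le> (2 * 2 powr (c 1 / 2) / k0 * r^2 * D powr (- (c 1 / 2))) * D powr \<tau>"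
      using A_le by (intro mult_right_mono) auto
    also have "\<dots> = 2 * 2 powr (c 1 / 2) / k0 * r^2 * D powr (\<tau> - c 1 / 2)"
      by (simp add: powr_add[symmetric] mult.assoc)
    also have "\<dots> \<le> 2 * 2 powr (c 1 / 2) / k0 * r^2 * (R^2 / r^2) powr (\<tau> - c 1 / 2)"
      using D r R k0 \<tau> c1_pos by (intro mult_left_mono powr_mono2') auto
    also have "\<dots> = C1 * (r^2 * r powr (- 2 * (\<tau> - c 1 / 2)))"
      unfolding C1_def square_ratio_powr[OF R r(1)] by simp
    also have "r^2 * r powr (- 2 * (\<tau> - c 1 / 2)) = r powr \<rho> * r powr (2 + c 1 / 2)"
    proof -
      have "r^2 = r powr 2" using r(1) by simp
      then show ?thesis by (simp add: \<rho>_def algebra_simps flip: powr_add)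
    qed
    finally have num: "(b k)^2 * (\<theta> k)^2 \<le> C1 * (r powr \<rho> * r powr (2 + c 1 / 2))" .
    have den: "sqrt (2 * q) * r powr (2 + c 1 / 2) \<le> sqrt (2 * quart \<theta>)"
    proof -
      have "sqrt (r powr (4 + c 1)) = r powr (2 + c 1 / 2)"
        using r(1) by (simp add: powr_half_sqrt[symmetric] powr_powr add_divide_distrib)
      then have "sqrt (2 * q) * r powr (2 + c 1 / 2) = sqrt (2 * (q * r powr (4 + c 1)))"
        by (simp add: real_sqrt_mult)
      also have "\<dots> \<le> sqrt (2 * quart \<theta>)"
        using q(2)[OF r(1) rR mem] by simp
      finally show ?thesis .
    qed
    have "fcoeff R r k = (b k)^2 * (\<theta> k)^2 / sqrt (2 * quart \<theta>)"
      by (simp add: filter_coeff_def \<theta>_def Let_def)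
    also have "\<dots> \<le> C1 * (r powr \<rho> * r powr (2 + c 1 / 2)) / (sqrt (2 * q) * r powr (2 + c 1 / 2))"
      using num den q r C1 by (intro frac_le) auto
    also have "\<dots> = C * r powr \<rho>" using r by (simp add: C_def)
    finally show ?thesis .
  qed
  ultimately show ?thesis by (rule that)
qed

end

subsection \<open>Errors of tests in the sequence model\<close>

text \<open>For real families summability is absolute, so the set where \<open>infsum\<close> takes
  its default value 0 is given by an infinite sum in \<open>ennreal\<close> and is measurable; on
  its complement \<open>infsum\<close> is the series along an enumeration.\<close>

lemma borel_measurable_infsum:
  fixes f :: "'i \<Rightarrow> 'a \<Rightarrow> real"
  assumes "countable S" and meas: "\<And>k. k \<in> S \<Longrightarrow> f k \<in> borel_measurable M"
  shows "(\<lambda>y. \<Sum>\<^sub>\<infinity>k\<in>S. f k y) \<in> borel_measurable M"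
proof (cases "finite S")
  case True
  then show ?thesis using meas by simp
next
  case False
  define g where "g = from_nat_into S"
  have g: "bij_betw g UNIV S"
    unfolding g_def using assms(1) False by (rule bij_betw_from_nat_into)
  have [measurable]: "f (g n) \<in> borel_measurable M" for n
    using meas bij_betwE[OF g] by blast
  let ?s = "\<lambda>y. (\<Sum>n. ennreal \<bar>f (g n) y\<bar>) \<noteq> top"
  have "(\<Sum>\<^sub>\<infinity>k\<in>S. f k y) = (if ?s y then \<Sum>n. f (g n) y else 0)" for y
  proof -
    have sm: "summable (\<lambda>n. \<bar>f (g n) y\<bar>) \<longleftrightarrow> ?s y"
    proof
      assume "summable (\<lambda>n. \<bar>f (g n) y\<bar>)"
      then show "?s y" by (rule ennreal_suminf_neq_top) (rule abs_ge_zero)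
    next
      assume "?s y"
      then show "summable (\<lambda>n. \<bar>f (g n) y\<bar>)" by (rule summable_suminf_not_top[rotated]) (rule abs_ge_zero)
    qed
    have eq: "(\<Sum>\<^sub>\<infinity>k\<in>S. f k y) = (\<Sum>\<^sub>\<infinity>n. f (g n) y)"
      using infsum_reindex_bij_betw[OF g, of "\<lambda>k. f k y"] by simp
    show ?thesis
    proof (cases "?s y")
      case True
      then have abs: "summable (\<lambda>n. norm (f (g n) y))"
        using sm unfolding real_norm_def by blast
      have "((\<lambda>n. f (g n) y) has_sum (\<Sum>n. f (g n) y)) UNIV"
        by (rule norm_summable_imp_has_sum[OF abs summable_sums[OF summable_norm_cancel[OF abs]]])
      then show ?thesis unfolding eq using True by (simp only: infsumI if_True simp_thms)
    next
      case False
      have "\<not> (\<lambda>n. f (g n) y) summable_on UNIV"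
      proof
        assume "(\<lambda>n. f (g n) y) summable_on UNIV"
        then have "(\<lambda>n. norm (f (g n) y)) summable_on UNIV"
          by (rule summable_on_iff_abs_summable_on_real[THEN iffD1])
        then have "summable (\<lambda>n. \<bar>f (g n) y\<bar>)"
          unfolding real_norm_def by (rule summable_on_imp_summable)
        then show False using False sm by blast
      qed
      then show ?thesis unfolding eq using False by (simp only: infsum_not_exists if_False simp_thms)
    qed
  qed
  then show ?thesis by simp
qed

context tensor_weights
begin

lemma countable_I: "countable I"
  unfolding multi_idx_def by (intro countable_PiE) auto

lemma noise_law_eq: "noise_law d = gauss_prod I"
  by (simp add: noise_law_def)

lemma measurable_obs: "(\<lambda>\<xi>. \<lambda>l\<in>I. b l * \<theta> l + \<epsilon> * \<xi> l) \<in> measurable (gauss_prod I) (data_space d)"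
  unfolding data_space_def
proof (rule measurable_restrict)
  fix l assume "l \<in> I"
  from measurable_gauss_component[OF this]
  show "(\<lambda>\<xi>. b l * \<theta> l + \<epsilon> * \<xi> l) \<in> gauss_prod I \<rightarrow>\<^sub>M borel" by simp
qed

lemma prob_space_obs: "prob_space (obs_law d b \<epsilon> \<theta>)"
  unfolding obs_law_def noise_law_eq
  by (rule prob_space.prob_space_distr[OF prob_space_gauss_prod measurable_obs])

lemma measure_obs:
  assumes "{y \<in> space (data_space d). Q y} \<in> sets (data_space d)"
  shows "measure (obs_law d b \<epsilon> \<theta>) {y \<in> space (data_space d). Q y}
    = measure (gauss_prod I) {\<xi> \<in> space (gauss_prod I). Q (\<lambda>l\<in>I. b l * \<theta> l + \<epsilon> * \<xi> l)}"
  unfolding obs_law_def noise_law_eq measure_distr[OF measurable_obs assms]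
  using measurable_space[OF measurable_obs] by (intro arg_cong[where f = "measure _"]) auto

lemma type2_err_le:
  assumes "0 \<le> B"
    and "\<And>\<theta>. \<theta> \<in> A \<Longrightarrow> measure (obs_law d b \<epsilon> \<theta>) {y \<in> space (data_space d). \<psi> y = 0} \<le> B"
  shows "err2 \<epsilon> A \<psi> \<le> B"
  unfolding type2_err_def using assms by (intro cSup_least) auto

lemma bdd_above_type2:
  "bdd_above (insert 0 ((\<lambda>\<theta>. measure (obs_law d b \<epsilon> \<theta>) {y \<in> space (data_space d). \<psi> y = 0}) ` A))"
  using prob_space.prob_le_1[OF prob_space_obs] by (intro bdd_aboveI[where M = 1]) auto

lemma type2_err_ge:
  "\<theta> \<in> A \<Longrightarrow> measure (obs_law d b \<epsilon> \<theta>) {y \<in> space (data_space d). \<psi> y = 0} \<le> err2 \<epsilon> A \<psi>"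
  unfolding type2_err_def by (intro cSup_upper bdd_above_type2) auto

lemma type2_err_nonneg: "0 \<le> err2 \<epsilon> A \<psi>"
  unfolding type2_err_def by (intro cSup_upper bdd_above_type2) auto

lemma type2_err_mono: "A \<subseteq> A' \<Longrightarrow> err2 \<epsilon> A \<psi> \<le> err2 \<epsilon> A' \<psi>"
  unfolding type2_err_def by (intro cSup_subset_mono bdd_above_type2) auto

lemma minimax_err_le:
  assumes "is_test d \<psi>" "err1 \<epsilon> \<psi> \<le> \<alpha> + \<delta> \<epsilon>"
  shows "minimax \<alpha> \<delta> \<epsilon> A \<le> err2 \<epsilon> A \<psi>"
  unfolding minimax_err_def using assms type2_err_nonneg
  by (intro cInf_lower bdd_belowI[where m = 0]) auto

text \<open>The admissible test \<open>\<phi>\<close> excludes an infimum over the empty set, about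
  which nothing could be said.\<close>

lemma minimax_err_ge:
  assumes "is_test d \<phi>" "err1 \<epsilon> \<phi> \<le> \<alpha> + \<delta> \<epsilon>"
    and "\<And>\<psi>. is_test d \<psi> \<Longrightarrow> err1 \<epsilon> \<psi> \<le> \<alpha> + \<delta> \<epsilon> \<Longrightarrow> B \<le> err2 \<epsilon> A \<psi>"
  shows "B \<le> minimax \<alpha> \<delta> \<epsilon> A"
  unfolding minimax_err_def using assms by (intro cInf_greatest) auto

lemma minimax_err_mono:
  assumes "A \<subseteq> A'"
  shows "minimax \<alpha> \<delta> \<epsilon> A \<le> minimax \<alpha> \<delta> \<epsilon> A'"
proof (cases "{\<psi>. is_test d \<psi> \<and> err1 \<epsilon> \<psi> \<le> \<alpha> + \<delta> \<epsilon>} = {}")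
  \<comment> \<open>Without admissible tests, for instance if \<alpha> + \<delta> \<epsilon> < 0,
    both sides are the same unspecified \<open>Inf {}\<close>.\<close>
  case True
  then show ?thesis by (simp only: minimax_err_def image_empty order_refl)
next
  case False
  then obtain \<phi> where "is_test d \<phi>" "err1 \<epsilon> \<phi> \<le> \<alpha> + \<delta> \<epsilon>" by auto
  then show ?thesis
    by (rule minimax_err_ge) (rule order_trans[OF minimax_err_le type2_err_mono[OF assms]])
qed

lemma alternative_antimono: "r \<le> r' \<Longrightarrow> alt R r' \<subseteq> alt R r"
  by (auto simp: alternative_def)

lemma alternative_cong:
  assumes "\<And>k. k \<in> I \<Longrightarrow> (\<theta> k)^2 = (\<theta>' k)^2"
  shows "\<theta> \<in> alt R r \<longleftrightarrow> \<theta>' \<in> alt R r"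
  using assms unfolding alternative_def ellipsoid_def ell2_def ell2_norm_def
  by (simp cong: summable_on_cong infsum_cong)

lemma measurable_test_stat: "stat R \<epsilon> r \<in> borel_measurable (data_space d)"
  unfolding test_stat_def[abs_def]
proof (rule borel_measurable_infsum[OF countable_I])
  fix k assume "k \<in> I"
  then have "(\<lambda>y. y k) \<in> borel_measurable (data_space d)"
    unfolding data_space_def by (rule measurable_component_singleton)
  then show "(\<lambda>y. fcoeff R r k * ((y k / \<epsilon>)^2 - 1)) \<in> borel_measurable (data_space d)"
    by measurable
qed

lemma is_test_filter_test: "is_test d (ftest R \<epsilon> r h)"
proof -
  note measurable_test_stat[measurable]
  have "(\<lambda>y. if h < stat R \<epsilon> r y then 1 else 0 :: real) \<in> borel_measurable (data_space d)"
    by measurable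
  then show ?thesis
    unfolding is_test_def filter_test_def[abs_def] of_bool_def by simp
qed

lemma extremal_value_eq:
  assumes "0 < r" "r < R" "0 < \<epsilon>"
  shows "optimum R \<epsilon> r = sqrt (quart (solution R r) / (2 * \<epsilon>^4))"
proof -
  let ?\<theta> = "solution R r"
  have "(INF \<theta>\<in>alt R r. quart \<theta>) = quart ?\<theta>"
  proof (rule extremal_solution_structure[OF assms(1,2)])
    assume "?\<theta> \<in> alt R r"
      and "\<And>\<theta>'. \<theta>' \<in> alt R r \<Longrightarrow> quart ?\<theta> \<le> quart \<theta>'"
    then show ?thesis by (intro cInf_eq_minimum) auto
  qed
  then show ?thesis by (simp add: extremal_value_def)
qed

text \<open>The core at a fixed noise level. The third bound holds for any set of alternatives,
  since the mean of the statistic is never negative; it bounds the minimax error at radii unrelated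
  to \<open>r\<close>.\<close>

lemma filter_test_errors:
  assumes r: "0 < r" "r < R" and \<epsilon>: "0 < \<epsilon>"
    and clt: "clt_bound I m \<kappa>" and m: "0 < m" "\<And>k. k \<in> I \<Longrightarrow> fcoeff R r k \<le> m"
    and \<eta>: "0 < \<eta>"
  defines "u \<equiv> optimum R \<epsilon> r"
  shows "err1 \<epsilon> (ftest R \<epsilon> r h) \<le> 1 - Gauss_cdf h + \<kappa>"
    and "err2 \<epsilon> (alt R r) (ftest R \<epsilon> r h)
      \<le> Gauss_cdf (h - u + \<eta>) + \<kappa> + 4 * m * (1 / \<eta> + u / \<eta>^2)"
    and "err2 \<epsilon> A (ftest R \<epsilon> r h) \<le> Gauss_cdf (h + \<eta>) + \<kappa> + 4 * m * (1 / \<eta>)"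
    and "is_test d \<psi> \<Longrightarrow> err1 \<epsilon> \<psi> \<le> 1 - Gauss_cdf g + \<eta>0 \<Longrightarrow>
      exp (- \<eta>) * (Gauss_cdf (g - u) - exp (u * g - u^2 / 2) * (\<eta>0 + \<kappa> + 6 * u^4 * m^2 / \<eta>^2))
        \<le> err2 \<epsilon> (alt R r) \<psi>"
proof -
  let ?M = "gauss_prod I"
  interpret prob_space ?M by (rule prob_space_gauss_prod)
  define \<theta> where "\<theta> = solution R r"
  obtain D A0 where D: "R^2 / r^2 \<le> D" "0 < A0" "A0 * shrunk_sum D = r^2"
    and mem: "\<theta> \<in> alt R r"
    and \<theta>2: "\<And>k. k \<in> I \<Longrightarrow> (\<theta> k)^2 = A0 / (b k)^4 * max 0 (1 - (a k)^2 / D)"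
    and Q: "quart \<theta> = (\<Sum>k\<in>level D. (b k)^4 * (\<theta> k)^4)" "0 < quart \<theta>"
      "\<And>\<theta>'. \<theta>' \<in> alt R r \<Longrightarrow> quart \<theta> \<le> quart \<theta>'"
    and saddle: "\<And>\<theta>'. \<theta>' \<in> alt R r \<Longrightarrow> quart \<theta> \<le> (\<Sum>k\<in>level D. (b k)^4 * (\<theta> k)^2 * (\<theta>' k)^2)"
    by (rule extremal_solution_structure[OF r, folded \<theta>_def], rule that; blast)
  have "1 < R^2 / r^2" using r by (simp add: power_strict_mono)
  then have D1: "1 < D" using D(1) by linarith
  define q where "q = sqrt (2 * quart \<theta>)"
  have q: "0 < q" "q^2 = 2 * quart \<theta>" using Q by (simp_all add: q_def)
  \<comment> \<open>Both u and the filter are normalised by the same \<open>q\<close>, which makes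
    the filter the statistic of the likelihood ratio.\<close>
  have u: "u = q / (2 * \<epsilon>^2)"
  proof (rule power2_eq_imp_eq)
    have "u^2 = quart \<theta> / (2 * \<epsilon>^4)"
      unfolding u_def extremal_value_eq[OF r \<epsilon>] \<theta>_def[symmetric] using Q \<epsilon> by simp
    then show "u^2 = (q / (2 * \<epsilon>^2))^2"
      using \<epsilon> by (simp add: power_divide power_mult_distrib q flip: power_mult)
    show "0 \<le> u" unfolding u_def extremal_value_eq[OF r \<epsilon>] using Q \<epsilon> by (simp add: \<theta>_def)
  qed (use q in simp)
  have u_pos: "0 < u" unfolding u using q \<epsilon> by simp
  define w where "w = fcoeff R r"
  have w: "w k = (b k)^2 * (\<theta> k)^2 / q" for k
    by (simp add: w_def filter_coeff_def \<theta>_def q_def Let_def)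
  have w0: "0 \<le> w k" for k unfolding w using q by simp
  have \<theta>_out: "(\<theta> k)^2 = 0" if "k \<in> I - level D" for k
  proof -
    have "D \<le> (a k)^2" using that by auto
    then have "max 0 (1 - (a k)^2 / D) = 0" using D1 by simp
    then show ?thesis using that by (simp only: \<theta>2 DiffD1 mult_zero_right)
  qed
  have w_out: "w k = 0" if "k \<in> I - level D" for k
    unfolding w \<theta>_out[OF that] by simp
  have w_sq: "(\<Sum>k\<in>level D. (w k)^2) = 1 / 2"
  proof -
    have "(\<Sum>k\<in>level D. (w k)^2) = (\<Sum>k\<in>level D. (b k)^4 * (\<theta> k)^4) / q^2"
      unfolding w sum_divide_distrib
      by (intro sum.cong refl) (simp add: power_divide power_mult_distrib flip: power_mult)
    then show ?thesis using Q q by simp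
  qed
  have wm: "w k \<le> m" if "k \<in> level D" for k
    using m(2) that by (simp add: w_def)
  have clt': "\<bar>prob {\<xi> \<in> space ?M. (\<Sum>k\<in>level D. w k * ((\<xi> k)^2 - 1)) \<le> z} - Gauss_cdf z\<bar> \<le> \<kappa>" for z
    using clt[unfolded clt_bound_def, rule_format, of "level D" w z] finite_level w0 wm w_sq by auto
  have stat_eq: "stat R \<epsilon> r (\<lambda>l\<in>I. b l * \<theta>' l + \<epsilon> * \<xi> l)
      = (\<Sum>k\<in>level D. w k * ((b k * \<theta>' k / \<epsilon> + \<xi> k)^2 - 1))" for \<theta>' \<xi>
  proof -
    let ?y = "\<lambda>l\<in>I. b l * \<theta>' l + \<epsilon> * \<xi> l"
    have "stat R \<epsilon> r ?y = (\<Sum>k\<in>level D. w k * ((?y k / \<epsilon>)^2 - 1))"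
      unfolding test_stat_def w_def[symmetric]
      by (rule infsum_finite_support[OF finite_level Collect_restrict]) (simp add: w_out)
    also have "\<dots> = (\<Sum>k\<in>level D. w k * ((b k * \<theta>' k / \<epsilon> + \<xi> k)^2 - 1))"
      using \<epsilon> by (intro sum.cong refl) (simp add: add_divide_distrib)
    finally show ?thesis .
  qed
  have sets: "{y \<in> space (data_space d). stat R \<epsilon> r y \<le> h} \<in> sets (data_space d)"
    "{y \<in> space (data_space d). h < stat R \<epsilon> r y} \<in> sets (data_space d)"
    using measurable_test_stat by measurable
  have err2: "measure (obs_law d b \<epsilon> \<theta>') {y \<in> space (data_space d). ftest R \<epsilon> r h y = 0}
      = prob {\<xi> \<in> space ?M. (\<Sum>k\<in>level D. w k * ((b k * \<theta>' k / \<epsilon> + \<xi> k)^2 - 1)) \<le> h}" for \<theta>'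
    using measure_obs[OF sets(1), of \<epsilon> \<theta>'] by (simp add: filter_test_def stat_eq not_less)

  show "err1 \<epsilon> (ftest R \<epsilon> r h) \<le> 1 - Gauss_cdf h + \<kappa>"
  proof -
    have comp: "(\<lambda>\<xi>. \<xi> k) \<in> borel_measurable ?M" if "k \<in> level D" for k
      using that by (intro measurable_gauss_component) auto
    have "err1 \<epsilon> (ftest R \<epsilon> r h) = prob {\<xi> \<in> space ?M. h < (\<Sum>k\<in>level D. w k * ((\<xi> k)^2 - 1))}"
      unfolding type1_err_def using measure_obs[OF sets(2), of \<epsilon> "\<lambda>_. 0"] stat_eq[of "\<lambda>_. 0"]
      by (simp add: filter_test_def)
    also have "\<dots> = 1 - prob {\<xi> \<in> space ?M. (\<Sum>k\<in>level D. w k * ((\<xi> k)^2 - 1)) \<le> h}"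
      using comp by (subst prob_neg[symmetric]) (simp_all add: not_le)
    finally show ?thesis using clt'[of h] by linarith
  qed

  \<comment> \<open>The guaranteed mean \<open>v\<close> stays a parameter: it is u on the
    alternative, by the variational inequality, and 0 for an arbitrary set.\<close>
  have upper: "err2 \<epsilon> A' (ftest R \<epsilon> r h) \<le> Gauss_cdf (h - v + \<eta>) + \<kappa> + 4 * m * (1 / \<eta> + v / \<eta>^2)"
    if v: "0 \<le> v" "\<And>\<theta>'. \<theta>' \<in> A' \<Longrightarrow> v \<le> (\<Sum>k\<in>level D. w k * (b k * \<theta>' k / \<epsilon>)^2)" for v A'
  proof (rule type2_err_le)
    have "0 \<le> \<kappa>" using clt'[of 0] by linarith
    then show "0 \<le> Gauss_cdf (h - v + \<eta>) + \<kappa> + 4 * m * (1 / \<eta> + v / \<eta>^2)"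
      using Gauss_cdf_nonneg m(1) \<eta> v by (intro add_nonneg_nonneg mult_nonneg_nonneg) auto
    fix \<theta>' assume "\<theta>' \<in> A'"
    show "measure (obs_law d b \<epsilon> \<theta>') {y \<in> space (data_space d). ftest R \<epsilon> r h y = 0}
      \<le> Gauss_cdf (h - v + \<eta>) + \<kappa> + 4 * m * (1 / \<eta> + v / \<eta>^2)"
      unfolding err2
      by (rule gauss_quadratic_test_type2[OF finite_level Collect_restrict w0 wm m(1) \<eta> v(1) v(2)[OF \<open>\<theta>' \<in> A'\<close>] clt'])
  qed
  show "err2 \<epsilon> (alt R r) (ftest R \<epsilon> r h)
      \<le> Gauss_cdf (h - u + \<eta>) + \<kappa> + 4 * m * (1 / \<eta> + u / \<eta>^2)"
  proof (rule upper)
    show "0 \<le> u" using u_pos by simp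
    fix \<theta>' assume "\<theta>' \<in> alt R r"
    have "u = quart \<theta> / (q * \<epsilon>^2)"
      unfolding u using q \<epsilon> by (simp add: field_simps power2_eq_square)
    also have "\<dots> \<le> (\<Sum>k\<in>level D. (b k)^4 * (\<theta> k)^2 * (\<theta>' k)^2) / (q * \<epsilon>^2)"
      using saddle[OF \<open>\<theta>' \<in> alt R r\<close>] q \<epsilon> by (intro divide_right_mono) auto
    also have "\<dots> = (\<Sum>k\<in>level D. w k * (b k * \<theta>' k / \<epsilon>)^2)"
      unfolding w sum_divide_distrib
      by (intro sum.cong refl) (simp add: power_divide power_mult_distrib power4_eq_xxxx power2_eq_square)
    finally show "u \<le> (\<Sum>k\<in>level D. w k * (b k * \<theta>' k / \<epsilon>)^2)" .
  qed
  show "err2 \<epsilon> A (ftest R \<epsilon> r h) \<le> Gauss_cdf (h + \<eta>) + \<kappa> + 4 * m * (1 / \<eta>)"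
    using upper[of 0 A] w0 by (simp add: sum_nonneg)

  show "exp (- \<eta>) * (Gauss_cdf (g - u) - exp (u * g - u^2 / 2) * (\<eta>0 + \<kappa> + 6 * u^4 * m^2 / \<eta>^2))
        \<le> err2 \<epsilon> (alt R r) \<psi>"
    if test: "is_test d \<psi>" "err1 \<epsilon> \<psi> \<le> 1 - Gauss_cdf g + \<eta>0"
  proof -
    have \<psi>: "\<psi> \<in> borel_measurable (data_space d)" "\<And>y. y \<in> space (data_space d) \<Longrightarrow> \<psi> y = 0 \<or> \<psi> y = 1"
      using test(1) by (auto simp: is_test_def)
    have \<psi>_sets: "{y \<in> space (data_space d). \<psi> y = z} \<in> sets (data_space d)" for z
      using \<psi>(1) by measurable
    let ?s = "\<lambda>\<xi>. \<lambda>l\<in>I. \<epsilon> * \<xi> l"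
    have scale: "?s \<in> measurable ?M (data_space d)"
      using measurable_obs[of "\<lambda>_. 0" \<epsilon>] by simp
    \<comment> \<open>The acceptance region of the test, pulled back to the standard noise.\<close>
    define A where "A = {\<xi> \<in> space ?M. \<psi> (?s \<xi>) = 0}"
    have "A = ?s -` {y \<in> space (data_space d). \<psi> y = 0} \<inter> space ?M"
      using measurable_space[OF scale] by (auto simp: A_def)
    then have A: "A \<in> sets ?M" using measurable_sets[OF scale \<psi>_sets] by simp
    have "err1 \<epsilon> \<psi> = prob {\<xi> \<in> space ?M. \<psi> (?s \<xi>) = 1}"
      unfolding type1_err_def using measure_obs[OF \<psi>_sets, of \<epsilon> "\<lambda>_. 0" 1] by simp
    also have "{\<xi> \<in> space ?M. \<psi> (?s \<xi>) = 1} = space ?M - A"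
      unfolding A_def using \<psi>(2) measurable_space[OF scale] by fastforce
    also have "prob (space ?M - A) = 1 - prob A" by (rule prob_compl[OF A])
    finally have PA: "Gauss_cdf g - \<eta>0 \<le> prob A" using test(2) by linarith
    \<comment> \<open>The extremal signal in units of the noise. Its weights (x k)^2 / (2 * u) in
      the likelihood ratio are exactly the filter coefficients.\<close>
    define x where "x k = b k * \<theta> k / \<epsilon>" for k
    have x2: "(x k)^2 / (2 * u) = w k" for k
      unfolding w u x_def using q \<epsilon> by (simp add: power_divide power_mult_distrib)
    have x4: "(\<Sum>k\<in>level D. (x k)^4) = 2 * u^2"
    proof -
      have "(\<Sum>k\<in>level D. (x k)^4) = (\<Sum>k\<in>level D. (2 * u * w k)^2)"
      proof (intro sum.cong refl)
        fix k
        have "(x k)^2 = 2 * u * w k" using x2[of k] u_pos by (simp add: field_simps)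
        then have "((x k)^2)^2 = (2 * u * w k)^2" by simp
        then show "(x k)^4 = (2 * u * w k)^2" by simp
      qed
      also have "\<dots> = (2 * u)^2 * (\<Sum>k\<in>level D. (w k)^2)"
        by (simp add: power_mult_distrib sum_distrib_left)
      finally show ?thesis by (simp add: w_sq power_mult_distrib)
    qed
    show ?thesis
    proof (rule gauss_sign_prior_lower_bound[OF finite_level Collect_restrict u_pos x4 _ \<eta> _ A PA])
      show "(x k)^2 / (2 * u) \<le> m" if "k \<in> level D" for k
        unfolding x2 by (rule wm[OF that])
      show "\<bar>prob {\<xi> \<in> space ?M. (\<Sum>k\<in>level D. (x k)^2 / (2 * u) * ((\<xi> k)^2 - 1)) \<le> z} - Gauss_cdf z\<bar> \<le> \<kappa>" for z
        unfolding x2 by (rule clt')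
      fix \<sigma> :: "idx \<Rightarrow> real"
      assume \<sigma>: "\<And>k. k \<in> level D \<Longrightarrow> (\<sigma> k)^2 = 1"
        and lower: "exp (- \<eta>) * (Gauss_cdf (g - u) - exp (u * g - u^2 / 2) * (\<eta>0 + \<kappa> + 6 * u^4 * m^2 / \<eta>^2))
          \<le> prob {\<xi> \<in> space ?M. (\<lambda>i\<in>I. (if i \<in> level D then \<sigma> i * x i else 0) + \<xi> i) \<in> A}"
      define \<theta>' where "\<theta>' k = (if k \<in> level D then \<sigma> k * \<theta> k else 0)" for k
      have "(\<theta>' k)^2 = (\<theta> k)^2" if "k \<in> I" for k
        using \<sigma>[of k] \<theta>_out[of k] that by (cases "k \<in> level D") (auto simp: \<theta>'_def power_mult_distrib)
      then have \<theta>': "\<theta>' \<in> alt R r" using alternative_cong mem by blast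
      have "prob {\<xi> \<in> space ?M. (\<lambda>i\<in>I. (if i \<in> level D then \<sigma> i * x i else 0) + \<xi> i) \<in> A}
          = measure (obs_law d b \<epsilon> \<theta>') {y \<in> space (data_space d). \<psi> y = 0}"
        unfolding measure_obs[OF \<psi>_sets]
      proof (intro arg_cong[where f = prob] Collect_cong conj_cong refl)
        fix \<xi> assume \<xi>: "\<xi> \<in> space ?M"
        let ?z = "\<lambda>i\<in>I. (if i \<in> level D then \<sigma> i * x i else 0) + \<xi> i"
        have "?z \<in> space ?M" by (simp add: space_PiM PiE_iff)
        moreover have "?s ?z = (\<lambda>l\<in>I. b l * \<theta>' l + \<epsilon> * \<xi> l)"
          using \<epsilon> by (intro restrict_ext) (auto simp: x_def \<theta>'_def distrib_left)
        ultimately show "?z \<in> A \<longleftrightarrow> \<psi> (\<lambda>l\<in>I. b l * \<theta>' l + \<epsilon> * \<xi> l) = 0"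
          by (simp add: A_def)
      qed
      also have "\<dots> \<le> err2 \<epsilon> (alt R r) \<psi>"
        by (rule type2_err_ge[OF \<theta>'])
      finally show ?thesis using lower by linarith
    qed
  qed
qed

end

subsection \<open>Asymptotics at the separation rate\<close>

lemma tendsto_0_eventually_leI:
  fixes f :: "real \<Rightarrow> real"
  assumes "\<And>e. 0 < e \<Longrightarrow> \<forall>\<^sub>F x in F. \<bar>f x\<bar> \<le> e"
  shows "(f \<longlongrightarrow> 0) F"
proof (rule tendstoI)
  fix e :: real assume "0 < e"
  with assms[of "e / 2"] show "\<forall>\<^sub>F x in F. dist (f x) 0 < e"
    by (auto simp: dist_real_def elim!: eventually_mono)
qed

context tensor_weights
begin

abbreviation rate :: "real \<Rightarrow> real \<Rightarrow> real" where
  "rate C \<epsilon> \<equiv> C * \<epsilon> powr (4 / (4 + c 1))"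

abbreviation u_at :: "real \<Rightarrow> real \<Rightarrow> real \<Rightarrow> real" where
  "u_at R C \<epsilon> \<equiv> optimum R \<epsilon> (rate C \<epsilon>)"

lemma eventually_rate_less:
  assumes "0 < C" "0 < y"
  shows "\<forall>\<^sub>F \<epsilon> in at_right 0. 0 < \<epsilon> \<and> 0 < rate C \<epsilon> \<and> rate C \<epsilon> < y"
proof -
  have pos: "\<forall>\<^sub>F \<epsilon> in at_right (0 :: real). 0 < \<epsilon>"
    by (rule eventually_at_right_less)
  have "((\<lambda>\<epsilon> :: real. \<epsilon> powr (4 / (4 + c 1))) \<longlongrightarrow> 0) (at_right 0)"
    using c1_pos
    by (intro tendsto_zero_powrI[where b = "4 / (4 + c 1)"] tendsto_ident_at tendsto_const
        eventually_mono[OF pos]) auto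
  then have "((\<lambda>\<epsilon>. rate C \<epsilon>) \<longlongrightarrow> C * 0) (at_right 0)"
    by (rule tendsto_mult_left)
  then have "\<forall>\<^sub>F \<epsilon> in at_right 0. rate C \<epsilon> < y"
    using assms by (intro order_tendstoD) auto
  with pos show ?thesis
    by eventually_elim (use assms in auto)
qed

text \<open>The exponent 4 / (4 + c 1) is the one for which r powr (4 + c 1) is a multiple of
  \<epsilon>^4. The constants do not depend on C, so C alone can make u small or large.\<close>

lemma extremal_value_scaling:
  assumes R: "0 < R"
  obtains k K where "0 < k" "0 < K"
    "\<And>C. 0 < C \<Longrightarrow> \<forall>\<^sub>F \<epsilon> in at_right 0. k * C powr (2 + c 1 / 2) \<le> u_at R C \<epsilon> \<and>
      u_at R C \<epsilon> \<le> K * C powr (2 + c 1 / 2)"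
proof -
  obtain k where k: "0 < k"
    "\<And>r \<theta>. 0 < r \<Longrightarrow> r < R \<Longrightarrow> \<theta> \<in> alt R r \<Longrightarrow> k * r powr (4 + c 1) \<le> quart \<theta>"
    using quartic_lower[OF R] by blast
  obtain K where K: "0 < K"
    "\<And>r. 0 < r \<Longrightarrow> r < R \<Longrightarrow> \<exists>\<theta>\<in>alt R r. quart \<theta> \<le> K * r powr (4 + c 1)"
    using quartic_upper[OF R] by blast
  have "\<forall>\<^sub>F \<epsilon> in at_right 0. sqrt (k / 2) * C powr (2 + c 1 / 2) \<le> u_at R C \<epsilon> \<and>
      u_at R C \<epsilon> \<le> sqrt (K / 2) * C powr (2 + c 1 / 2)"
    if C: "0 < C" for C
    using eventually_rate_less[OF C R]
  proof eventually_elim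
    case (elim \<epsilon>)
    define r where "r = rate C \<epsilon>"
    have r: "0 < r" "r < R" and \<epsilon>: "0 < \<epsilon>" using elim by (auto simp: r_def)
    let ?Q = "quart (solution R r)"
    have rp: "r powr (4 + c 1) = C powr (4 + c 1) * \<epsilon>^4"
    proof -
      have "r powr (4 + c 1) = C powr (4 + c 1) * (\<epsilon> powr (4 / (4 + c 1))) powr (4 + c 1)"
        unfolding r_def by (rule powr_mult)
      also have "(\<epsilon> powr (4 / (4 + c 1))) powr (4 + c 1) = \<epsilon> powr 4"
        unfolding powr_powr using c1_pos by (intro arg_cong[where f = "(powr) \<epsilon>"]) (simp add: field_simps)
      finally show ?thesis using \<epsilon> by simp
    qed
    have sqrtC: "sqrt (C powr (4 + c 1)) = C powr (2 + c 1 / 2)"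
      using C by (simp add: powr_half_sqrt[symmetric] powr_powr add_divide_distrib)
    have Q: "k * r powr (4 + c 1) \<le> ?Q" "?Q \<le> K * r powr (4 + c 1)"
    proof -
      have "?Q \<le> K * r powr (4 + c 1) \<and> k * r powr (4 + c 1) \<le> ?Q"
      proof (rule extremal_solution_structure[OF r])
        assume mem: "solution R r \<in> alt R r"
          and least: "\<And>\<theta>'. \<theta>' \<in> alt R r \<Longrightarrow> ?Q \<le> quart \<theta>'"
        obtain \<theta>' where "\<theta>' \<in> alt R r" "quart \<theta>' \<le> K * r powr (4 + c 1)"
          using K(2)[OF r] by blast
        then show ?thesis using least[of \<theta>'] k(2)[OF r mem] by linarith
      qed
      then show "k * r powr (4 + c 1) \<le> ?Q" "?Q \<le> K * r powr (4 + c 1)" by auto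
    qed
    have u: "u_at R C \<epsilon> = sqrt (?Q / (2 * \<epsilon>^4))"
      using extremal_value_eq[OF r \<epsilon>] unfolding r_def .
    have "sqrt (k / 2) * C powr (2 + c 1 / 2) = sqrt (k / 2 * C powr (4 + c 1))"
      unfolding sqrtC[symmetric] by (rule real_sqrt_mult[symmetric])
    also have "k / 2 * C powr (4 + c 1) \<le> ?Q / (2 * \<epsilon>^4)"
      using Q(1) \<epsilon> unfolding rp by (simp add: field_simps)
    finally have lower: "sqrt (k / 2) * C powr (2 + c 1 / 2) \<le> sqrt (?Q / (2 * \<epsilon>^4))" by simp
    have "?Q / (2 * \<epsilon>^4) \<le> K / 2 * C powr (4 + c 1)"
      using Q(2) \<epsilon> unfolding rp by (simp add: field_simps)
    then have "sqrt (?Q / (2 * \<epsilon>^4)) \<le> sqrt (K / 2 * C powr (4 + c 1))" by simp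
    also have "\<dots> = sqrt (K / 2) * C powr (2 + c 1 / 2)"
      unfolding sqrtC[symmetric] by (rule real_sqrt_mult)
    finally show ?case using lower unfolding u by blast
  qed
  moreover have "0 < sqrt (k / 2)" "0 < sqrt (K / 2)" using k K by simp_all
  ultimately show ?thesis by (intro that)
qed

lemma extremal_value_bounded:
  assumes "0 < R" "0 < C"
  obtains U where "0 < U" "\<forall>\<^sub>F \<epsilon> in at_right 0. 0 \<le> u_at R C \<epsilon> \<and> u_at R C \<epsilon> \<le> U"
proof (rule extremal_value_scaling[OF assms(1)])
  fix k K
  assume k: "0 < k" "0 < K"
    "\<And>C. 0 < C \<Longrightarrow> \<forall>\<^sub>F \<epsilon> in at_right 0. k * C powr (2 + c 1 / 2) \<le> u_at R C \<epsilon> \<and>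
      u_at R C \<epsilon> \<le> K * C powr (2 + c 1 / 2)"
  show ?thesis
  proof (rule that)
    show "0 < K * C powr (2 + c 1 / 2)" using k assms by simp
    have nonneg: "0 \<le> k * C powr (2 + c 1 / 2)" using k by simp
    show "\<forall>\<^sub>F \<epsilon> in at_right 0. 0 \<le> u_at R C \<epsilon> \<and>
        u_at R C \<epsilon> \<le> K * C powr (2 + c 1 / 2)"
      using k(3)[OF assms(2)] by eventually_elim (use nonneg in linarith)
  qed
qed

lemma eventually_filter_coeff_le:
  assumes R: "0 < R" and C: "0 < C" and m: "0 < m"
  shows "\<forall>\<^sub>F \<epsilon> in at_right 0. 0 < \<epsilon> \<and> 0 < rate C \<epsilon> \<and> rate C \<epsilon> < R \<and> (\<forall>k\<in>I. fcoeff R (rate C \<epsilon>) k \<le> m)"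
proof -
  obtain B \<rho> where B: "0 < B" "0 < \<rho>"
    "\<And>r k. \<lbrakk>0 < r; 2 * r^2 \<le> R^2; k \<in> I\<rbrakk> \<Longrightarrow> fcoeff R r k \<le> B * r powr \<rho>"
    by (rule filter_coeff_vanishing[OF R], rule that; blast)
  \<comment> \<open>The first bound secures 2 * r^2 \<le> R^2, the second solves B * y powr \<rho> =
    m.\<close>
  define y where "y = min (R / 2) ((m / B) powr (1 / \<rho>))"
  have "0 < y" using R m B by (simp add: y_def)
  from eventually_rate_less[OF C this] show ?thesis
  proof eventually_elim
    case (elim \<epsilon>)
    define r where "r = rate C \<epsilon>"
    have r: "0 < r" "r \<le> R / 2" "r \<le> (m / B) powr (1 / \<rho>)" using elim by (auto simp: r_def y_def)
    have "r^2 \<le> (R / 2)^2" using r by (intro power_mono) auto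
    then have "4 * r^2 \<le> R^2" by (simp add: power_divide)
    then have r2: "2 * r^2 \<le> R^2" using zero_le_power2[of r] by linarith
    have "r powr \<rho> \<le> ((m / B) powr (1 / \<rho>)) powr \<rho>"
      using r B by (intro powr_mono2) auto
    also have "\<dots> = m / B" using m B by (simp add: powr_powr)
    finally have "B * r powr \<rho> \<le> m" using B by (simp add: field_simps)
    then have "fcoeff R r k \<le> m" if "k \<in> I" for k
      using B(3)[OF r(1) r2 that] by linarith
    then show ?case using elim r R unfolding r_def by simp
  qed
qed

lemma eventually_filter_test_errors:
  assumes R: "0 < R" and C: "0 < C" and e: "0 < e"
  shows "\<forall>\<^sub>F \<epsilon> in at_right 0. err1 \<epsilon> (ftest R \<epsilon> (rate C \<epsilon>) h) \<le> 1 - Gauss_cdf h + e \<and>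
    err2 \<epsilon> (alt R (rate C \<epsilon>)) (ftest R \<epsilon> (rate C \<epsilon>) h)
      \<le> Gauss_cdf (h - u_at R C \<epsilon>) + e \<and>
    (\<forall>A. err2 \<epsilon> A (ftest R \<epsilon> (rate C \<epsilon>) h) \<le> Gauss_cdf h + e)"
proof -
  obtain U where U: "0 < U" "\<forall>\<^sub>F \<epsilon> in at_right 0. 0 \<le> u_at R C \<epsilon> \<and> u_at R C \<epsilon> \<le> U"
    by (rule extremal_value_bounded[OF R C], rule that; assumption)
  \<comment> \<open>One third each for the normal approximation, the linear term and the margin in
    the threshold.\<close>
  define \<eta> where "\<eta> = e / 3"
  have \<eta>: "0 < \<eta>" using e by (simp add: \<eta>_def)
  obtain m0 where m0: "0 < m0" "clt_bound I m0 \<eta>"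
    by (rule gauss_quadratic_clt[OF \<eta>, where I = I], rule that; assumption)
  define S where "S = 1 / \<eta> + U / \<eta>^2"
  have S: "0 < S" using \<eta> U by (simp add: S_def add_pos_pos)
  define m where "m = min m0 (\<eta> / (4 * S))"
  have m: "0 < m" "clt_bound I m \<eta>" "4 * m * S \<le> \<eta>"
  proof -
    show "0 < m" using m0 \<eta> S by (simp add: m_def)
    show "clt_bound I m \<eta>" using clt_bound_mono[OF m0(2)] by (simp add: m_def)
    have "m \<le> \<eta> / (4 * S)" by (simp add: m_def)
    then show "4 * m * S \<le> \<eta>" using S by (simp add: field_simps)
  qed
  show ?thesis
    using eventually_filter_coeff_le[OF R C m(1)] U(2)
  proof eventually_elim
    case (elim \<epsilon>)
    let ?u = "u_at R C \<epsilon>"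
    have *: "0 < rate C \<epsilon>" "rate C \<epsilon> < R" "0 < \<epsilon>" "\<And>k. k \<in> I \<Longrightarrow> fcoeff R (rate C \<epsilon>) k \<le> m"
      using elim by auto
    note errors = filter_test_errors[OF *(1,2,3) m(2,1) *(4) \<eta>]
    have "1 / \<eta> + ?u / \<eta>^2 \<le> S"
      unfolding S_def using elim by (intro add_left_mono divide_right_mono) auto
    from mult_left_mono[OF this, of "4 * m"] m
    have 1: "4 * m * (1 / \<eta> + ?u / \<eta>^2) \<le> \<eta>" by linarith
    have "1 / \<eta> \<le> S" unfolding S_def using U by simp
    from mult_left_mono[OF this, of "4 * m"] m
    have 2: "4 * m * (1 / \<eta>) \<le> \<eta>" by linarith
    have e3: "e = 3 * \<eta>" by (simp add: \<eta>_def)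
    have "Gauss_cdf (h - ?u + \<eta>) \<le> Gauss_cdf (h - ?u) + \<eta>" "Gauss_cdf (h + \<eta>) \<le> Gauss_cdf h + \<eta>"
      using Gauss_cdf_lipschitz[of "h - ?u" "h - ?u + \<eta>"] Gauss_cdf_lipschitz[of h "h + \<eta>"] \<eta> by auto
    then have "err2 \<epsilon> (alt R (rate C \<epsilon>)) (ftest R \<epsilon> (rate C \<epsilon>) h) \<le> Gauss_cdf (h - ?u) + e"
      and "\<And>A. err2 \<epsilon> A (ftest R \<epsilon> (rate C \<epsilon>) h) \<le> Gauss_cdf h + e"
      using errors(2)[of h] order_trans[OF errors(3)[of _ h]] 1 2 unfolding e3 by (linarith, fastforce)
    moreover have "err1 \<epsilon> (ftest R \<epsilon> (rate C \<epsilon>) h) \<le> 1 - Gauss_cdf h + e"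
      using errors(1)[of h] \<eta> unfolding e3 by linarith
    ultimately show ?case by blast
  qed
qed

text \<open>The tolerance \<open>\<eta>0\<close> is fixed before \<epsilon>, so the bound covers
  every level that differs from its limit by o(1).\<close>

lemma eventually_type2_lower:
  assumes R: "0 < R" and C: "0 < C" and e: "0 < e"
  obtains \<eta>0 where "0 < \<eta>0"
    "\<forall>\<^sub>F \<epsilon> in at_right 0. \<forall>\<psi>. is_test d \<psi> \<longrightarrow> err1 \<epsilon> \<psi> \<le> 1 - Gauss_cdf h + \<eta>0 \<longrightarrow>
      Gauss_cdf (h - u_at R C \<epsilon>) - e \<le> err2 \<epsilon> (alt R (rate C \<epsilon>)) \<psi>"
proof -
  obtain U where U: "0 < U" "\<forall>\<^sub>F \<epsilon> in at_right 0. 0 \<le> u_at R C \<epsilon> \<and> u_at R C \<epsilon> \<le> U"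
    by (rule extremal_value_bounded[OF R C], rule that; assumption)
  \<comment> \<open>Bounds the critical value exp (u * h - u^2 / 2) for all 0 \<le> u \<le>
    U.\<close>
  define \<Lambda> where "\<Lambda> = exp (U * \<bar>h\<bar>)"
  define \<eta> where "\<eta> = e / 2"
  \<comment> \<open>The level tolerance, the normal approximation and the quartic remainder cost at
    most z each, together 3 * z * \<Lambda> = e / 2. The other half of e pays for the factor exp (-
    \<eta>).\<close>
  define z where "z = e / (6 * \<Lambda>)"
  have pos: "0 < \<Lambda>" "0 < \<eta>" "0 < z" using e by (auto simp: \<Lambda>_def \<eta>_def z_def)
  obtain m0 where m0: "0 < m0" "clt_bound I m0 z"
    by (rule gauss_quadratic_clt[OF pos(3), where I = I], rule that; assumption)
  \<comment> \<open>The bound 1 gives m^2 \<le> m, so a linear condition on m controls the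
    remainder.\<close>
  define m where "m = min m0 (min 1 (z * \<eta>^2 / (6 * U^4)))"
  have m: "0 < m" "clt_bound I m z" "6 * U^4 * m^2 / \<eta>^2 \<le> z"
  proof -
    show "0 < m" using m0 pos U by (simp add: m_def)
    moreover have "m \<le> 1" by (simp add: m_def)
    ultimately have "m^2 \<le> m" by (simp add: power2_eq_square mult_left_le)
    show "clt_bound I m z" using clt_bound_mono[OF m0(2)] by (simp add: m_def)
    have "m \<le> z * \<eta>^2 / (6 * U^4)" by (simp add: m_def)
    then have "6 * U^4 * m \<le> z * \<eta>^2" using U by (simp add: field_simps)
    moreover have "6 * U^4 * m^2 \<le> 6 * U^4 * m" using \<open>m^2 \<le> m\<close> by (intro mult_left_mono) auto
    ultimately have "6 * U^4 * m^2 \<le> z * \<eta>^2" by linarith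
    then show "6 * U^4 * m^2 / \<eta>^2 \<le> z" using pos by (simp add: field_simps)
  qed
  show ?thesis
  proof (rule that[OF pos(3)])
    show "\<forall>\<^sub>F \<epsilon> in at_right 0. \<forall>\<psi>. is_test d \<psi> \<longrightarrow> err1 \<epsilon> \<psi> \<le> 1 - Gauss_cdf h + z \<longrightarrow>
      Gauss_cdf (h - u_at R C \<epsilon>) - e \<le> err2 \<epsilon> (alt R (rate C \<epsilon>)) \<psi>"
      using eventually_filter_coeff_le[OF R C m(1)] U(2)
    proof eventually_elim
      case (elim \<epsilon>)
      let ?u = "u_at R C \<epsilon>"
      have *: "0 < rate C \<epsilon>" "rate C \<epsilon> < R" "0 < \<epsilon>" "\<And>k. k \<in> I \<Longrightarrow> fcoeff R (rate C \<epsilon>) k \<le> m"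
        and u: "0 \<le> ?u" "?u \<le> U"
        using elim by auto
      let ?s = "z + z + 6 * ?u^4 * m^2 / \<eta>^2" and ?l = "exp (?u * h - ?u^2 / 2)"
      have s: "0 \<le> ?s" "?s \<le> 3 * z"
      proof -
        show "0 \<le> ?s" using pos by simp
        have "6 * ?u^4 * m^2 / \<eta>^2 \<le> 6 * U^4 * m^2 / \<eta>^2"
          using u by (intro divide_right_mono mult_right_mono mult_left_mono power_mono) auto
        then show "?s \<le> 3 * z" using m(3) by linarith
      qed
      have "?u * h \<le> U * \<bar>h\<bar>"
        using u by (intro order_trans[OF mult_left_mono[OF abs_ge_self] mult_right_mono]) auto
      then have "?u * h - ?u^2 / 2 \<le> U * \<bar>h\<bar>" using zero_le_power2[of ?u] by linarith
      then have "?l \<le> \<Lambda>" unfolding \<Lambda>_def by simp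
      then have "?l * ?s \<le> \<Lambda> * (3 * z)" using s pos by (intro mult_mono) auto
      also have "\<Lambda> * (3 * z) = \<eta>" using pos by (simp add: z_def \<eta>_def)
      finally have ls: "?l * ?s \<le> \<eta>" "0 \<le> ?l * ?s" using s by auto
      have "1 - \<eta> \<le> exp (- \<eta>)" using exp_ge_add_one_self[of "- \<eta>"] by simp
      then have "(1 - \<eta>) * Gauss_cdf (h - ?u) \<le> exp (- \<eta>) * Gauss_cdf (h - ?u)"
        using Gauss_cdf_nonneg by (intro mult_right_mono)
      moreover have "\<eta> * Gauss_cdf (h - ?u) \<le> \<eta>"
        using Gauss_cdf_le_1[of "h - ?u"] pos by (simp add: mult_left_le)
      moreover have "exp (- \<eta>) * (?l * ?s) \<le> ?l * ?s"
        using ls(2) pos by (intro mult_left_le_one_le) auto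
      ultimately have "Gauss_cdf (h - ?u) - e \<le> exp (- \<eta>) * (Gauss_cdf (h - ?u) - ?l * ?s)"
        using ls(1) by (simp add: \<eta>_def algebra_simps)
      then show ?case
        using filter_test_errors(4)[OF *(1,2,3) m(2,1) *(4) pos(2), of _ h z] order_trans by blast
    qed
  qed
qed

text \<open>The last two clauses are uniform in the set \<open>A\<close> because the rate is tested
  with arbitrary radii, which are not multiples of the power of \<epsilon>.\<close>

lemma eventually_minimax_err:
  assumes R: "0 < R" and \<alpha>: "0 < \<alpha>" "\<alpha> < 1" and \<delta>: "(\<delta> \<longlongrightarrow> 0) (at_right 0)" and e: "0 < e" and C: "0 < C"
  shows "\<forall>\<^sub>F \<epsilon> in at_right 0.
    \<bar>minimax \<alpha> \<delta> \<epsilon> (alt R (rate C \<epsilon>))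
      - Gauss_cdf (Gauss_upper_quantile \<alpha> - u_at R C \<epsilon>)\<bar> \<le> e \<and>
    (\<forall>A. minimax \<alpha> \<delta> \<epsilon> A \<le> 1 - \<alpha> + e) \<and>
    (\<forall>A. 0 \<le> minimax \<alpha> \<delta> \<epsilon> A)"
proof -
  define H where "H = Gauss_upper_quantile \<alpha>"
  have H: "Gauss_cdf H = 1 - \<alpha>" unfolding H_def by (rule Gauss_cdf_upper_quantile[OF \<alpha>])
  \<comment> \<open>Raising the threshold lowers the limiting level by \<open>gap\<close>. Half of
    it covers the error of the first kind beyond its limit, half a negative \<delta> \<epsilon>, so
    the test is admissible.\<close>
  define h where "h = H + e / 2"
  define gap where "gap = Gauss_cdf h - Gauss_cdf H"
  have gap: "0 < gap" "gap \<le> e / 2"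
    using Gauss_cdf_strict_mono[of H h] Gauss_cdf_lipschitz[of H h] e by (auto simp: gap_def h_def)
  have gapH: "Gauss_cdf h = 1 - \<alpha> + gap" by (simp add: gap_def H)
  obtain \<eta>0 where \<eta>0: "0 < \<eta>0"
    "\<forall>\<^sub>F \<epsilon> in at_right 0. \<forall>\<psi>. is_test d \<psi> \<longrightarrow> err1 \<epsilon> \<psi> \<le> 1 - Gauss_cdf H + \<eta>0 \<longrightarrow>
      Gauss_cdf (H - u_at R C \<epsilon>) - e \<le> err2 \<epsilon> (alt R (rate C \<epsilon>)) \<psi>"
    by (rule eventually_type2_lower[OF R C e], rule that; assumption)
  have "\<forall>\<^sub>F \<epsilon> in at_right 0. \<bar>\<delta> \<epsilon>\<bar> < min \<eta>0 (gap / 2)"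
    using tendstoD[OF \<delta>, of "min \<eta>0 (gap / 2)"] \<eta>0(1) gap by (simp add: dist_real_def)
  moreover have "\<forall>\<^sub>F \<epsilon> in at_right 0. err1 \<epsilon> (ftest R \<epsilon> (rate C \<epsilon>) h) \<le> 1 - Gauss_cdf h + gap / 2 \<and>
    err2 \<epsilon> (alt R (rate C \<epsilon>)) (ftest R \<epsilon> (rate C \<epsilon>) h)
      \<le> Gauss_cdf (h - u_at R C \<epsilon>) + gap / 2 \<and>
    (\<forall>A. err2 \<epsilon> A (ftest R \<epsilon> (rate C \<epsilon>) h) \<le> Gauss_cdf h + gap / 2)"
    using gap by (intro eventually_filter_test_errors R C) simp
  ultimately show ?thesis
    using \<eta>0(2)
  proof eventually_elim
    case (elim \<epsilon>)
    let ?u = "u_at R C \<epsilon>" and ?\<phi> = "ftest R \<epsilon> (rate C \<epsilon>) h"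
    have \<delta>\<epsilon>: "\<delta> \<epsilon> < \<eta>0" "- (gap / 2) < \<delta> \<epsilon>"
      using elim(1) by linarith+
    have "err1 \<epsilon> ?\<phi> \<le> 1 - Gauss_cdf h + gap / 2"
      using elim(2) by blast
    also have "\<dots> \<le> \<alpha> + \<delta> \<epsilon>"
      using \<delta>\<epsilon>(2) gapH by linarith
    finally have level: "err1 \<epsilon> ?\<phi> \<le> \<alpha> + \<delta> \<epsilon>" .
    have upper: "minimax \<alpha> \<delta> \<epsilon> A \<le> err2 \<epsilon> A ?\<phi>" for A
      using is_test_filter_test level by (rule minimax_err_le)
    have "minimax \<alpha> \<delta> \<epsilon> (alt R (rate C \<epsilon>)) \<le> Gauss_cdf (h - ?u) + gap / 2"
      using order_trans[OF upper] elim(2) by blast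
    also have "Gauss_cdf (h - ?u) \<le> Gauss_cdf (H - ?u) + e / 2"
      using Gauss_cdf_lipschitz[of "H - ?u" "h - ?u"] e by (simp add: h_def)
    finally have 1: "minimax \<alpha> \<delta> \<epsilon> (alt R (rate C \<epsilon>)) \<le> Gauss_cdf (H - ?u) + e"
      using gap by linarith
    have 2: "Gauss_cdf (H - ?u) - e \<le> minimax \<alpha> \<delta> \<epsilon> (alt R (rate C \<epsilon>))"
    proof (rule minimax_err_ge[where \<phi> = ?\<phi>])
      fix \<psi> assume "is_test d \<psi>" "err1 \<epsilon> \<psi> \<le> \<alpha> + \<delta> \<epsilon>"
      moreover from this have "err1 \<epsilon> \<psi> \<le> 1 - Gauss_cdf H + \<eta>0"
        using \<delta>\<epsilon>(1) H by linarith
      ultimately show "Gauss_cdf (H - ?u) - e \<le> err2 \<epsilon> (alt R (rate C \<epsilon>)) \<psi>"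
        using elim(3) by blast
    qed (use level is_test_filter_test in auto)
    have 3: "minimax \<alpha> \<delta> \<epsilon> A \<le> 1 - \<alpha> + e" for A
    proof -
      have "minimax \<alpha> \<delta> \<epsilon> A \<le> Gauss_cdf h + gap / 2"
        using order_trans[OF upper] elim(2) by blast
      then show ?thesis using gap gapH by linarith
    qed
    have 4: "0 \<le> minimax \<alpha> \<delta> \<epsilon> A" for A
      using is_test_filter_test level type2_err_nonneg by (rule minimax_err_ge)
    show ?case using 1 2 3 4 unfolding H_def by (auto simp: abs_le_iff)
  qed
qed

lemma sharp_asymptotics:
  assumes R: "0 < R" and \<alpha>: "0 < \<alpha>" "\<alpha> < 1" and \<delta>: "(\<delta> \<longlongrightarrow> 0) (at_right 0)" and C: "0 < C"
    and r: "\<And>\<epsilon>. 0 < \<epsilon> \<Longrightarrow> r \<epsilon> = rate C \<epsilon>"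
  defines "H \<equiv> Gauss_upper_quantile \<alpha>"
  shows "(\<lambda>\<epsilon>. optimum R \<epsilon> (r \<epsilon>)) \<in> O[at_right 0](\<lambda>_. 1)"
    and "level_test d b \<alpha> (\<lambda>\<epsilon>. ftest R \<epsilon> (r \<epsilon>) H)"
    and "((\<lambda>\<epsilon>. err2 \<epsilon> (alt R (r \<epsilon>)) (ftest R \<epsilon> (r \<epsilon>) H)
             - minimax \<alpha> \<delta> \<epsilon> (alt R (r \<epsilon>))) \<longlongrightarrow> 0) (at_right 0)"
    and "((\<lambda>\<epsilon>. minimax \<alpha> \<delta> \<epsilon> (alt R (r \<epsilon>))
             - Gauss_cdf (H - optimum R \<epsilon> (r \<epsilon>))) \<longlongrightarrow> 0) (at_right 0)"
proof -
  have H: "Gauss_cdf H = 1 - \<alpha>" unfolding H_def by (rule Gauss_cdf_upper_quantile[OF \<alpha>])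
  have r': "\<forall>\<^sub>F \<epsilon> in at_right 0. r \<epsilon> = rate C \<epsilon>"
    using eventually_at_right_less[of "0 :: real"] by eventually_elim (rule r)
  let ?u = "\<lambda>\<epsilon>. optimum R \<epsilon> (r \<epsilon>)"
  let ?\<phi> = "\<lambda>\<epsilon>. ftest R \<epsilon> (r \<epsilon>) H"
  let ?A = "\<lambda>\<epsilon>. alt R (r \<epsilon>)"
  obtain U where U: "\<forall>\<^sub>F \<epsilon> in at_right 0. 0 \<le> u_at R C \<epsilon> \<and> u_at R C \<epsilon> \<le> U"
    by (rule extremal_value_bounded[OF R C], rule that; assumption)
  show "?u \<in> O[at_right 0](\<lambda>_. 1)"
  proof (rule bigoI)
    show "\<forall>\<^sub>F \<epsilon> in at_right 0. norm (?u \<epsilon>) \<le> U * norm (1 :: real)"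
      using U r' by eventually_elim simp
  qed
  have ev1: "\<forall>\<^sub>F \<epsilon> in at_right 0. err1 \<epsilon> (?\<phi> \<epsilon>) \<le> \<alpha> + e" if "0 < e" for e
    using eventually_filter_test_errors[OF R C that, of H] r' by eventually_elim (simp add: H)
  show "level_test d b \<alpha> ?\<phi>"
    unfolding level_test_def
  proof (intro conjI exI allI impI)
    show "is_test d (?\<phi> \<epsilon>)" for \<epsilon> by (rule is_test_filter_test)
    \<comment> \<open>\<open>level_test\<close> asks for the bound at every \<epsilon> > 0, so the
      excess over \<alpha> itself serves as the vanishing term.\<close>
    show "((\<lambda>\<epsilon>. max 0 (err1 \<epsilon> (?\<phi> \<epsilon>) - \<alpha>)) \<longlongrightarrow> 0) (at_right 0)"
    proof (rule tendsto_0_eventually_leI)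
      fix e :: real assume e: "0 < e"
      from ev1[OF e] show "\<forall>\<^sub>F \<epsilon> in at_right 0. \<bar>max 0 (err1 \<epsilon> (?\<phi> \<epsilon>) - \<alpha>)\<bar> \<le> e"
        by eventually_elim (use e in auto)
    qed
  qed auto
  show mm: "((\<lambda>\<epsilon>. minimax \<alpha> \<delta> \<epsilon> (?A \<epsilon>) - Gauss_cdf (H - ?u \<epsilon>)) \<longlongrightarrow> 0) (at_right 0)"
  proof (rule tendsto_0_eventually_leI)
    fix e :: real assume e: "0 < e"
    show "\<forall>\<^sub>F \<epsilon> in at_right 0. \<bar>minimax \<alpha> \<delta> \<epsilon> (?A \<epsilon>) - Gauss_cdf (H - ?u \<epsilon>)\<bar> \<le> e"
      using eventually_minimax_err[OF R \<alpha> \<delta> e C] r' unfolding H_def by eventually_elim simp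
  qed
  have "((\<lambda>\<epsilon>. err2 \<epsilon> (?A \<epsilon>) (?\<phi> \<epsilon>) - Gauss_cdf (H - ?u \<epsilon>)) \<longlongrightarrow> 0) (at_right 0)"
  proof (rule tendsto_0_eventually_leI)
    fix e :: real assume e: "0 < e"
    obtain \<eta>0 where \<eta>0: "0 < \<eta>0"
      "\<forall>\<^sub>F \<epsilon> in at_right 0. \<forall>\<psi>. is_test d \<psi> \<longrightarrow> err1 \<epsilon> \<psi> \<le> 1 - Gauss_cdf H + \<eta>0 \<longrightarrow>
        Gauss_cdf (H - u_at R C \<epsilon>) - e \<le> err2 \<epsilon> (alt R (rate C \<epsilon>)) \<psi>"
      by (rule eventually_type2_lower[OF R C e], rule that; assumption)
    show "\<forall>\<^sub>F \<epsilon> in at_right 0. \<bar>err2 \<epsilon> (?A \<epsilon>) (?\<phi> \<epsilon>) - Gauss_cdf (H - ?u \<epsilon>)\<bar> \<le> e"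
      using eventually_filter_test_errors[OF R C e, of H] ev1[OF \<eta>0(1)] \<eta>0(2) r'
    proof eventually_elim
      case (elim \<epsilon>)
      have "Gauss_cdf (H - ?u \<epsilon>) - e \<le> err2 \<epsilon> (?A \<epsilon>) (?\<phi> \<epsilon>)"
        using elim(2,3) is_test_filter_test H unfolding elim(4) by simp
      moreover have "err2 \<epsilon> (?A \<epsilon>) (?\<phi> \<epsilon>) \<le> Gauss_cdf (H - ?u \<epsilon>) + e"
        using elim(1) unfolding elim(4) by blast
      ultimately show ?case by linarith
    qed
  qed
  from tendsto_diff[OF this mm]
  show "((\<lambda>\<epsilon>. err2 \<epsilon> (?A \<epsilon>) (?\<phi> \<epsilon>) - minimax \<alpha> \<delta> \<epsilon> (?A \<epsilon>)) \<longlongrightarrow> 0) (at_right 0)"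
    by simp
qed

lemma minimax_rate_powr:
  assumes R: "0 < R" and \<alpha>: "0 < \<alpha>" "\<alpha> < 1" and \<delta>: "(\<delta> \<longlongrightarrow> 0) (at_right 0)"
  shows "minimax_rate d b a R \<alpha> \<delta> (\<lambda>\<epsilon>. \<epsilon> powr (4 / (4 + c 1)))"
proof -
  define H where "H = Gauss_upper_quantile \<alpha>"
  have H: "Gauss_cdf H = 1 - \<alpha>" unfolding H_def by (rule Gauss_cdf_upper_quantile[OF \<alpha>])
  obtain k K where k: "0 < k" and K: "0 < K"
    and scale: "\<And>C. 0 < C \<Longrightarrow> \<forall>\<^sub>F \<epsilon> in at_right 0. k * C powr (2 + c 1 / 2) \<le> u_at R C \<epsilon> \<and>
      u_at R C \<epsilon> \<le> K * C powr (2 + c 1 / 2)"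
    by (rule extremal_value_scaling[OF R], rule that; blast)
  have p: "0 < 2 + c 1 / 2" using c1_pos by simp
  have cancel: "(x powr (1 / (2 + c 1 / 2))) powr (2 + c 1 / 2) = x" if "0 < x" for x
    using p that by (simp add: powr_powr)
  let ?w = "\<lambda>\<epsilon> :: real. \<epsilon> powr (4 / (4 + c 1))"
  let ?m = "\<lambda>\<epsilon> r. minimax \<alpha> \<delta> \<epsilon> (alt R r)"
  note pos = eventually_at_right_less[of "0 :: real"]
  have small: "((\<lambda>\<epsilon>. ?m \<epsilon> (r \<epsilon>)) \<longlongrightarrow> 1 - \<alpha>) (at_right 0)"
    if lim: "((\<lambda>\<epsilon>. r \<epsilon> / ?w \<epsilon>) \<longlongrightarrow> 0) (at_right 0)" for r
  proof (rule LIM_zero_cancel, rule tendsto_0_eventually_leI)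
    fix e :: real assume e: "0 < e"
    \<comment> \<open>Solves K * C powr (2 + c 1 / 2) = e / 2, so that u \<le> e / 2 and the
      Lipschitz bound applies.\<close>
    define C where "C = (e / (2 * K)) powr (1 / (2 + c 1 / 2))"
    have "C powr (2 + c 1 / 2) = e / (2 * K)"
      unfolding C_def using e K by (intro cancel) simp
    then have C: "0 < C" "K * C powr (2 + c 1 / 2) = e / 2"
      using e K by (simp_all add: C_def)
    have e2: "0 < e / 2" using e by simp
    show "\<forall>\<^sub>F \<epsilon> in at_right 0. \<bar>?m \<epsilon> (r \<epsilon>) - (1 - \<alpha>)\<bar> \<le> e"
      using order_tendstoD(2)[OF lim C(1)] pos scale[OF C(1)] eventually_minimax_err[OF R \<alpha> \<delta> e2 C(1)]
    proof eventually_elim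
      case (elim \<epsilon>)
      have "r \<epsilon> \<le> rate C \<epsilon>" using elim(1,2) by (simp add: field_simps)
      then have "?m \<epsilon> (rate C \<epsilon>) \<le> ?m \<epsilon> (r \<epsilon>)"
        by (intro minimax_err_mono alternative_antimono)
      moreover have "Gauss_cdf H \<le> Gauss_cdf (H - u_at R C \<epsilon>) + e / 2"
      proof -
        have "0 \<le> k * C powr (2 + c 1 / 2)" using k by simp
        then have "0 \<le> u_at R C \<epsilon>" "u_at R C \<epsilon> \<le> e / 2"
          using elim(3) C(2) by linarith+
        then show ?thesis
          using Gauss_cdf_lipschitz[of "H - u_at R C \<epsilon>" H] by simp
      qed
      moreover have "\<bar>?m \<epsilon> (rate C \<epsilon>) - Gauss_cdf (H - u_at R C \<epsilon>)\<bar> \<le> e / 2"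
        and "?m \<epsilon> (r \<epsilon>) \<le> 1 - \<alpha> + e / 2"
        using elim(4) unfolding H_def by blast+
      ultimately show ?case using H by linarith
    qed
  qed
  have large: "((\<lambda>\<epsilon>. ?m \<epsilon> (r \<epsilon>)) \<longlongrightarrow> 0) (at_right 0)"
    if lim: "filterlim (\<lambda>\<epsilon>. r \<epsilon> / ?w \<epsilon>) at_top (at_right 0)" for r
  proof (rule tendsto_0_eventually_leI)
    fix e :: real assume e: "0 < e"
    then have e2: "0 < e / 2" by simp
    have "\<forall>\<^sub>F x in at_bot. Gauss_cdf x < e / 2"
      by (rule order_tendstoD(2)[OF Gauss_cdf_at_bot e2])
    then obtain x where x: "Gauss_cdf x < e / 2"
      by (meson eventually_at_bot_linorder order_refl)
    \<comment> \<open>Forces u \<ge> H - x, where the Gaussian tail below x is less than e / 2. The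
      maximum with 1 keeps C positive.\<close>
    define C where "C = (max 1 (H - x) / k) powr (1 / (2 + c 1 / 2))"
    have "C powr (2 + c 1 / 2) = max 1 (H - x) / k"
      unfolding C_def using k by (intro cancel) simp
    then have C: "0 < C" "k * C powr (2 + c 1 / 2) = max 1 (H - x)"
      using k by (simp_all add: C_def)
    have "\<forall>\<^sub>F \<epsilon> in at_right 0. C \<le> r \<epsilon> / ?w \<epsilon>"
      using lim by (simp add: filterlim_at_top)
    then show "\<forall>\<^sub>F \<epsilon> in at_right 0. \<bar>?m \<epsilon> (r \<epsilon>)\<bar> \<le> e"
      using pos scale[OF C(1)] eventually_minimax_err[OF R \<alpha> \<delta> e2 C(1)]
    proof eventually_elim
      case (elim \<epsilon>)
      have "rate C \<epsilon> \<le> r \<epsilon>" using elim(1,2) by (simp add: field_simps)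
      then have "?m \<epsilon> (r \<epsilon>) \<le> ?m \<epsilon> (rate C \<epsilon>)"
        by (intro minimax_err_mono alternative_antimono)
      moreover have "Gauss_cdf (H - u_at R C \<epsilon>) \<le> Gauss_cdf x"
        using elim(3) C(2) by (intro Gauss_cdf_mono) linarith
      moreover have "\<bar>?m \<epsilon> (rate C \<epsilon>) - Gauss_cdf (H - u_at R C \<epsilon>)\<bar> \<le> e / 2"
        and "0 \<le> ?m \<epsilon> (r \<epsilon>)"
        using elim(4) unfolding H_def by blast+
      ultimately show ?case using x by linarith
    qed
  qed
  show ?thesis
    unfolding minimax_rate_def using small large by auto
qed

end

section \<open>Uniqueness of the separation rate up to constants\<close>

lemma minimax_rate_same_order:
  assumes v: "minimax_rate d b a R \<alpha> \<delta> v" and w: "minimax_rate d b a R \<alpha> \<delta> w" and "\<alpha> < 1"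
  obtains k where "0 < k" "\<forall>\<^sub>F z in at_right 0. k * w z \<le> v z"
proof (rule ccontr)
  assume not: "\<not> thesis"
  let ?m = "\<lambda>z r. minimax_err d b \<alpha> \<delta> z (alternative d a R r)"
  have v0: "0 < v z" and w0: "0 < w z" if "0 < z" for z
    using v w that by (auto simp: minimax_rate_def)
  have v1: "((\<lambda>z. ?m z (r z)) \<longlongrightarrow> 0) (at_right 0)"
    if "\<And>z. 0 < z \<Longrightarrow> 0 \<le> r z" "filterlim (\<lambda>z. r z / v z) at_top (at_right 0)" for r
    using v that unfolding minimax_rate_def by blast
  have w1: "((\<lambda>z. ?m z (r z)) \<longlongrightarrow> 1 - \<alpha>) (at_right 0)"
    if "\<And>z. 0 < z \<Longrightarrow> 0 \<le> r z" "((\<lambda>z. r z / w z) \<longlongrightarrow> 0) (at_right 0)" for r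
    using w that unfolding minimax_rate_def by blast
  define k where "k n = inverse (real (Suc n)) ^ 2" for n
  have freq: "\<exists>z. 0 < z \<and> z < inverse (real (Suc n)) \<and> v z < k n * w z" for n
  proof (rule ccontr)
    assume no: "\<not> ?thesis"
    have "\<forall>\<^sub>F z in at_right (0 :: real). z < inverse (real (Suc n))"
      by (intro order_tendstoD(2)[OF tendsto_ident_at]) simp
    then have "\<forall>\<^sub>F z in at_right 0. k n * w z \<le> v z"
      using eventually_at_right_less[of "0 :: real"]
      by eventually_elim (use no not_less in blast)
    then have thesis by (intro that[of "k n"]) (auto simp: k_def)
    with not show False by contradiction
  qed
  then obtain z where z: "\<And>n. 0 < z n" "\<And>n. z n < inverse (real (Suc n))" "\<And>n. v (z n) < k n * w (z n)"
    by metis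
  have z_lim: "filterlim z (at_right 0) sequentially"
    unfolding filterlim_at
  proof (intro conjI)
    show "z \<longlonglongrightarrow> 0"
      by (rule real_tendsto_sandwich[OF always_eventually always_eventually tendsto_const LIMSEQ_inverse_real_of_nat])
        (intro allI less_imp_le z)+
    show "\<forall>\<^sub>F n in sequentially. z n \<in> {0<..} \<and> z n \<noteq> 0"
      using z(1) by (intro always_eventually) (simp add: less_imp_neq[THEN not_sym])
  qed
  define S where "S = range z"
  \<comment> \<open>The quotient v / w tends to 0 along \<open>S\<close>: close enough to 0, the
    points z i with i < M are excluded, and only indices n with k n < e remain.\<close>
  have ratio: "\<forall>\<^sub>F x in at_right 0. x \<in> S \<longrightarrow> v x < e * w x" if e: "0 < e" for e
  proof -
    have "(\<lambda>n. inverse (real (Suc n)) ^ 2) \<longlonglongrightarrow> 0 ^ 2"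
      by (intro tendsto_intros LIMSEQ_inverse_real_of_nat)
    then have "\<forall>\<^sub>F n in sequentially. k n < e"
      using e by (intro order_tendstoD(2)[of k 0]) (simp_all add: k_def[abs_def])
    then obtain M where M: "\<And>n. M \<le> n \<Longrightarrow> k n < e"
      by (auto simp: eventually_sequentially)
    have "\<forall>\<^sub>F x in at_right 0. \<forall>i\<in>{..<M}. x < z i"
      using z(1) by (intro eventually_ball_finite ballI order_tendstoD(2)[OF tendsto_ident_at]) auto
    then show ?thesis
    proof eventually_elim
      case (elim x)
      show ?case
      proof
        assume "x \<in> S"
        then obtain n where n: "x = z n" by (auto simp: S_def)
        then have "M \<le> n" using elim by (metis lessThan_iff less_irrefl not_le)
        have "v x < k n * w x" using z(3) n by simp
        also have "\<dots> \<le> e * w x"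
          using M[OF \<open>M \<le> n\<close>] w0[OF z(1), of n] n by (intro mult_right_mono) auto
        finally show "v x < e * w x" .
      qed
    qed
  qed
  \<comment> \<open>On \<open>S\<close> the geometric mean dominates v and is negligible against w.
    Off \<open>S\<close> the radius \<open>f\<close> is completed to dominate v, and
    \<open>g\<close> to be negligible against w; along z both coincide, yet one error tends to 0 and
    the other to 1 - \<alpha>.\<close>
  define r where "r x = sqrt (v x * w x)" for x
  define f where "f x = (if x \<in> S then r x else v x / x)" for x
  define g where "g x = (if x \<in> S then r x else 0)" for x
  note pos = eventually_at_right_less[of "0 :: real"]
  have "((\<lambda>n. ?m (z n) (f (z n))) \<longlonglongrightarrow> 0)"
  proof (rule filterlim_compose[OF v1 z_lim])
    fix x :: real assume "0 < x"
    then show "0 \<le> f x" using v0[of x] w0[of x] by (simp add: f_def r_def)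
  next
    show "filterlim (\<lambda>x. f x / v x) at_top (at_right 0)"
      unfolding filterlim_at_top_gt[where c = 0]
    proof (intro allI impI)
      fix Z :: real assume Z: "0 < Z"
      have "\<forall>\<^sub>F x in at_right (0 :: real). x < 1 / Z"
        using Z by (intro order_tendstoD(2)[OF tendsto_ident_at]) simp
      moreover have "\<forall>\<^sub>F x in at_right 0. x \<in> S \<longrightarrow> v x < 1 / Z^2 * w x"
        using Z by (intro ratio) simp
      ultimately show "\<forall>\<^sub>F x in at_right 0. Z \<le> f x / v x"
        using pos
      proof eventually_elim
        case (elim x)
        have vx: "0 < v x" and wx: "0 < w x" using v0 w0 elim(3) by auto
        show ?case
        proof (cases "x \<in> S")
          case True
          then have "v x < 1 / Z^2 * w x" using elim(2) by blast
          then have "Z^2 * v x \<le> w x" using Z by (simp add: field_simps)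
          then have "(Z * v x)^2 \<le> v x * w x"
            using mult_right_mono[of "Z^2 * v x" "w x" "v x"] vx by (simp add: power2_eq_square mult_ac)
          then have "Z * v x \<le> r x" unfolding r_def by (rule real_le_rsqrt)
          then show ?thesis using True vx by (simp add: f_def field_simps)
        next
          case False
          then show ?thesis using vx elim(1,3) Z by (simp add: f_def field_simps)
        qed
      qed
    qed
  qed
  moreover have "((\<lambda>n. ?m (z n) (g (z n))) \<longlonglongrightarrow> 1 - \<alpha>)"
  proof (rule filterlim_compose[OF w1 z_lim])
    fix x :: real assume "0 < x"
    then show "0 \<le> g x" using v0[of x] w0[of x] by (simp add: g_def r_def)
  next
    show "((\<lambda>x. g x / w x) \<longlongrightarrow> 0) (at_right 0)"
    proof (rule tendstoI)
      fix e :: real assume e: "0 < e"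
      then have "\<forall>\<^sub>F x in at_right 0. x \<in> S \<longrightarrow> v x < e^2 * w x"
        by (intro ratio) simp
      then show "\<forall>\<^sub>F x in at_right 0. dist (g x / w x) 0 < e"
        using pos
      proof eventually_elim
        case (elim x)
        have vx: "0 < v x" and wx: "0 < w x" using v0 w0 elim(2) by auto
        show ?case
        proof (cases "x \<in> S")
          case True
          then have "v x * w x < e^2 * w x * w x" using elim(1) wx by simp
          also have "\<dots> = (e * w x)^2" by (simp add: power2_eq_square)
          finally have "r x < e * w x" unfolding r_def using e wx by (intro real_less_lsqrt) auto
          moreover have "0 \<le> r x" using vx wx by (simp add: r_def)
          ultimately show ?thesis using True wx by (simp add: g_def dist_real_def field_simps)
        next
          case False
          then show ?thesis using e by (simp add: g_def)
        qed
      qed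
    qed
  qed
  moreover have "f (z n) = g (z n)" for n by (simp add: f_def g_def S_def)
  ultimately show False using LIMSEQ_unique \<open>\<alpha> < 1\<close> by fastforce
qed

theorem proposition1:
  fixes d :: nat and R \<alpha> :: real
    and t s c :: "nat \<Rightarrow> real"
    and b a :: "idx \<Rightarrow> real"
    and \<delta> :: "real \<Rightarrow> real"
  assumes d: "1 \<le> d"
    and R: "0 < R"
    and \<alpha>: "0 < \<alpha>" "\<alpha> < 1"
    and t: "\<And>j. j \<in> {1..d} \<Longrightarrow> 0 \<le> t j"
    and s: "\<And>j. j \<in> {1..d} \<Longrightarrow> 0 < s j"
    and b: "\<And>l. l \<in> multi_idx d \<Longrightarrow> (b l)\<^sup>2 = (\<Prod>j=1..d. real (l j) powr (- 2 * t j))"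
    and a: "\<And>l. l \<in> multi_idx d \<Longrightarrow> (a l)\<^sup>2 = (\<Prod>j=1..d. real (l j) powr (2 * s j))"
    and c: "\<And>j. j \<in> {1..d} \<Longrightarrow> c j = (1 + 4 * t j) / s j"
    and c_ordered: "\<And>i j. i \<in> {1..d} \<Longrightarrow> j \<in> {1..d} \<Longrightarrow> i < j \<Longrightarrow> c j < c i"
    and \<delta>: "(\<delta> \<longlongrightarrow> 0) (at_right 0)"
  shows
    "minimax_rate d b a R \<alpha> \<delta> (\<lambda>\<epsilon>. \<epsilon> powr (4 / (4 + c 1))) \<and>
     (\<forall>rs. minimax_rate d b a R \<alpha> \<delta> rs \<longrightarrow> same_order rs (\<lambda>\<epsilon>. \<epsilon> powr (4 / (4 + c 1)))) \<and>
     (\<forall>C r. 0 < C \<longrightarrow> (\<forall>\<epsilon>>0. r \<epsilon> = C * \<epsilon> powr (4 / (4 + c 1))) \<longrightarrow>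
        (\<lambda>\<epsilon>. extremal_value d b a R \<epsilon> (r \<epsilon>)) \<in> O[at_right 0](\<lambda>_. 1) \<and>
        level_test d b \<alpha> (\<lambda>\<epsilon>. filter_test d b a R \<epsilon> (r \<epsilon>) (Gauss_upper_quantile \<alpha>)) \<and>
        ((\<lambda>\<epsilon>. type2_err d b \<epsilon> (alternative d a R (r \<epsilon>))
                 (filter_test d b a R \<epsilon> (r \<epsilon>) (Gauss_upper_quantile \<alpha>))
             - minimax_err d b \<alpha> \<delta> \<epsilon> (alternative d a R (r \<epsilon>))) \<longlongrightarrow> 0) (at_right 0) \<and>
        ((\<lambda>\<epsilon>. minimax_err d b \<alpha> \<delta> \<epsilon> (alternative d a R (r \<epsilon>))
             - Gauss_cdf (Gauss_upper_quantile \<alpha> - extremal_value d b a R \<epsilon> (r \<epsilon>))) \<longlongrightarrow> 0)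
          (at_right 0))"
proof -
  interpret tensor_weights d t s c b a
    by unfold_locales (fact d t s b a c c_ordered)+
  note rate = minimax_rate_powr[OF R \<alpha> \<delta>]
  have "same_order rs (\<lambda>\<epsilon>. \<epsilon> powr (4 / (4 + c 1)))" if rs: "minimax_rate d b a R \<alpha> \<delta> rs" for rs
  proof -
    obtain k where k: "0 < k" "\<forall>\<^sub>F \<epsilon> in at_right 0. k * \<epsilon> powr (4 / (4 + c 1)) \<le> rs \<epsilon>"
      using minimax_rate_same_order[OF rs rate \<alpha>(2)] by blast
    obtain k' where k': "0 < k'" "\<forall>\<^sub>F \<epsilon> in at_right 0. k' * rs \<epsilon> \<le> \<epsilon> powr (4 / (4 + c 1))"
      using minimax_rate_same_order[OF rate rs \<alpha>(2)] by blast
    have "\<forall>\<^sub>F \<epsilon> in at_right 0. k * \<epsilon> powr (4 / (4 + c 1)) \<le> rs \<epsilon> \<and> rs \<epsilon> \<le> 1 / k' * \<epsilon> powr (4 / (4 + c 1))"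
      using k(2) k'(2) by eventually_elim (use k'(1) in \<open>simp add: field_simps\<close>)
    then show ?thesis
      unfolding same_order_def using k(1) k'(1) by (intro exI[of _ k] conjI exI[of _ "1 / k'"]) auto
  qed
  then show ?thesis
    using rate sharp_asymptotics[OF R \<alpha> \<delta>] by simp
qed

end
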